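(* Let $A_N$ and $B_N$ be independent $N\times N$ random matrices, each sampled from the Gaussian Orthogonal Ensemble, and let $\{A_N,B_N\}=A_NB_N+B_NA_N$. The limiting spectral density of $\{\mathrm{GOE},\mathrm{GOE}\}$, i.e. the density of the limiting spectral distribution of $\{A_N,B_N\}/N$ as $N\to\infty$, is $$\mu(x)=-\frac{\sqrt{3}}{2\pi|x|}\left(\frac{3x^2+1}{9h(x)}-h(x)\right),\qquad |x|\le\sqrt{\frac{11+5\sqrt5}{2}},$$ where $$h(x)=\sqrt[3]{\frac{18x^2+1}{27}+\sqrt{\frac{x^2(1+11x^2-x^4)}{27}}}.$$
   Context: The $N\times N$ Gaussian Orthogonal Ensemble (GOE) consists of real symmetric matrices $(a_{ij})$ whose entries $a_{ij}$, $i\le j$, are independent with $a_{ij}=a_{ji}\sim N(0,1)$ for $i\neq j$ and $a_{ii}\sim N(0,2)$. For an $N\times N$ real symmetric random matrix $C_N$ with eigenvalues $\lambda_1,\dots,\lambda_N$, the empirical spectral distribution of $C_N/N$ is $F^{C_N/N}(x)=\frac1N\#\{i\le N:\lambda_i/N\le x\}$. If $F^{C_N/N}$ converges (in probability or almost surely) to a distribution $F$ as $N\to\infty$, then $F$ is called the limiting spectral distribution of the ensemble, and its density is the limiting spectral density. The density $\mu$ is zero outside the stated interval. *)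

theory Defs
  imports "HOL-Probability.Probability" "Jordan_Normal_Form.Char_Poly"
begin

definition GOE :: "'a measure \<Rightarrow> nat \<Rightarrow> ('a \<Rightarrow> real mat) \<Rightarrow> bool" where
  "GOE M N X \<longleftrightarrow>
     (\<forall>\<omega>\<in>space M. X \<omega> \<in> carrier_mat N N \<and> transpose_mat (X \<omega>) = X \<omega>) \<and>
     prob_space.indep_vars M (\<lambda>_. borel) (\<lambda>(i, j) \<omega>. X \<omega> $$ (i, j)) {(i, j). i \<le> j \<and> j < N} \<and>
     (\<forall>i j. i < j \<and> j < N \<longrightarrow>
        distributed M lborel (\<lambda>\<omega>. X \<omega> $$ (i, j)) (\<lambda>x. ennreal (normal_density 0 1 x))) \<and>
     (\<forall>i<N. distributed M lborel (\<lambda>\<omega>. X \<omega> $$ (i, i)) (\<lambda>x. ennreal (normal_density 0 (sqrt 2) x)))"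

text \<open>A random matrix is treated as a random element of the product space
  \<open>\<real>\<close> to the power \<open>N \<times> N\<close> of its entries.\<close>

definition entry_space :: "nat \<Rightarrow> (nat \<times> nat \<Rightarrow> real) measure" where
  "entry_space N = PiM ({..<N} \<times> {..<N}) (\<lambda>_. borel)"

definition entries :: "nat \<Rightarrow> real mat \<Rightarrow> nat \<times> nat \<Rightarrow> real" where
  "entries N C = (\<lambda>ij \<in> {..<N} \<times> {..<N}. C $$ ij)"

definition indep_matrices ::
  "'a measure \<Rightarrow> nat \<Rightarrow> ('a \<Rightarrow> real mat) \<Rightarrow> ('a \<Rightarrow> real mat) \<Rightarrow> bool" where
  "indep_matrices M N X Y \<longleftrightarrow>
     prob_space.indep_var M (entry_space N) (\<lambda>\<omega>. entries N (X \<omega>))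
                            (entry_space N) (\<lambda>\<omega>. entries N (Y \<omega>))"

definition anticommutator :: "real mat \<Rightarrow> real mat \<Rightarrow> real mat" where
  "anticommutator A B = A * B + B * A"

text \<open>The empirical spectral distribution of \<open>C / N\<close> for a real symmetric \<open>N \<times> N\<close> matrix \<open>C\<close>.
  The multiset \<open>proots (char_poly C)\<close> of real roots, with multiplicity, then consists of all \<open>N\<close>
  eigenvalues of \<open>C\<close>.\<close>

definition esd :: "nat \<Rightarrow> real mat \<Rightarrow> real \<Rightarrow> real" where
  "esd N C x = real (size {# l \<in># proots (char_poly C). l / real N \<le> x #}) / real N"

text \<open>The limiting spectral distribution is a probability measure on the line. Convergence of
  distribution functions is, as usual, convergence at the continuity points of the limit.\<close>

definition esd_converges_in_probability ::
  "'a measure \<Rightarrow> (nat \<Rightarrow> 'a \<Rightarrow> real mat) \<Rightarrow> real measure \<Rightarrow> bool" where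
  "esd_converges_in_probability M C D \<longleftrightarrow>
     (\<forall>x. isCont (cdf D) x \<longrightarrow>
       (\<forall>\<epsilon>>0. (\<lambda>N. measure M {\<omega> \<in> space M. \<bar>esd N (C N \<omega>) x - cdf D x\<bar> > \<epsilon>}) \<longlonglongrightarrow> 0))"

definition esd_converges_almost_surely ::
  "'a measure \<Rightarrow> (nat \<Rightarrow> 'a \<Rightarrow> real mat) \<Rightarrow> real measure \<Rightarrow> bool" where
  "esd_converges_almost_surely M C D \<longleftrightarrow>
     (AE \<omega> in M. weak_conv (\<lambda>N. esd N (C N \<omega>)) (cdf D))"

definition limiting_spectral_distribution ::
  "'a measure \<Rightarrow> (nat \<Rightarrow> 'a \<Rightarrow> real mat) \<Rightarrow> real measure \<Rightarrow> bool" where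
  "limiting_spectral_distribution M C D \<longleftrightarrow>
     real_distribution D \<and>
     (esd_converges_in_probability M C D \<or> esd_converges_almost_surely M C D)"

definition limiting_spectral_density ::
  "'a measure \<Rightarrow> (nat \<Rightarrow> 'a \<Rightarrow> real mat) \<Rightarrow> (real \<Rightarrow> real) \<Rightarrow> bool" where
  "limiting_spectral_density M C f \<longleftrightarrow>
     f \<in> borel_measurable borel \<and> (\<forall>x. 0 \<le> f x) \<and>
     limiting_spectral_distribution M C (density lborel (\<lambda>x. ennreal (f x)))"

definition h :: "real \<Rightarrow> real" where
  "h x = root 3 ((18 * x^2 + 1) / 27 + sqrt (x^2 * (1 + 11 * x^2 - x^4) / 27))"

text \<open>At the single point \<open>x = 0\<close> the formula reads \<open>0 / 0\<close>; here it yields the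
  value 0 (the limit is \<open>1 / pi\<close>), which is immaterial for a density.\<close>

definition mu :: "real \<Rightarrow> real" where
  "mu x = (if \<bar>x\<bar> \<le> sqrt ((11 + 5 * sqrt 5) / 2)
           then - (sqrt 3 / (2 * pi * \<bar>x\<bar>)) * ((3 * x^2 + 1) / (9 * h x) - h x)
           else 0)"

end

theory Submission
  imports Defs "HOL-Complex_Analysis.Complex_Analysis" "Jordan_Normal_Form.Schur_Decomposition"
begin

text \<open>
  The proof is by the method of moments. Write $y_1 = A_N / \sqrt N$ and $y_0 = B_N / \sqrt N$.
  The $k$-th moment of the empirical spectral distribution of \<open>(AB + BA) / N\<close> is the normalized trace
  of $(y_1 y_0 + y_0 y_1)^k$, a sum of normalized traces of words in the two letters.

  Convergence of the traces. Gaussian integration by parts (Wick's recursion for monomials in the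
  entries, lemma \<open>pair_GOE_wick\<close>, and its polynomial form \<open>stein\<close>) gives the Schwinger--Dyson
  equation \<open>schwinger_dyson\<close> for the expectation of a product of traces of words. After normalization
  the words on its right-hand side have smaller total length, and all terms except the ones that split a word \<open>c w\<close>
  with \<open>w = u c v\<close> into the pair \<open>u\<close>, \<open>v\<close> carry at least one factor \<open>1/N\<close>. Hence one induction
  (\<open>trace_products_converge\<close>) shows that the expectation of every product of normalized traces
  tends to the product of the limits \<open>wlim w\<close>. As this includes products of two traces,
  the variances vanish, and normalized traces converge in probability without a separate
  concentration estimate (\<open>linear_statistic_in_probability\<close>).

  The limit moments. Splitting the words of $(y_1 y_0 + y_0 y_1)^k$ at their letters shows that the
  generating series \<open>F\<close> of the limit moments satisfies \<open>F = 1 + X^2 F^2 (F + 1)\<close> (\<open>acm_fps\<close>), an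
  equation with only one power series solution.

  The density. The Stieltjes transform \<open>G\<close> of the limit satisfies \<open>z = (1 + G^2) / (G (1 - G^2))\<close>.
  The boundary values of \<open>G\<close> on the two sides of the cut form a closed curve \<open>r e^{i t}\<close> with
  \<open>r^4 + 4 r^2 cos^2 t = 1\<close>; on this curve \<open>z\<close> is real and
  for \<open>z \<noteq> 0\<close> the absolute value of \<open>Im G\<close> is \<open>pi * mu z\<close> (\<open>zmap_curve_path\<close>, \<open>mu_curve_x\<close>).
  So the \<open>k\<close>-th moment of \<open>mu\<close> is, up to a
  constant, the contour integral of \<open>z^k G dz\<close> along the curve. The curve is homotopic, in the plane
  without \<open>0\<close>, \<open>1\<close> and \<open>-1\<close>, to the image of a small circle under the local inverse of \<open>1/z\<close>,
  where the integral is a Taylor coefficient of that inverse. These coefficients solve the same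
  equation as \<open>F\<close>, hence are the limit moments (\<open>moment_form_integral\<close>, \<open>mu_moment\<close>).

  From moments to distribution functions. As \<open>mu\<close> has compact support, an indicator of a half-line lies
  between two polynomials, on the whole line, whose integrals against \<open>mu\<close> are arbitrarily
  close (\<open>indicator_polynomial_sandwich\<close>). A polynomial of degree \<open>n\<close> integrates against the
  empirical spectral distribution to a combination of its moments up to order \<open>n\<close>, which converges
  in probability.
\<close>

section \<open>Wick's recursion for the entries of two independent GOE matrices\<close>

text \<open>All ways to pick one element of a list: the element, paired with the list of the others.\<close>

fun picks :: "'a list \<Rightarrow> ('a \<times> 'a list) list" where
  "picks [] = []"
| "picks (x # xs) = (x, xs) # map (\<lambda>(y, ys). (y, x # ys)) (picks xs)"

lemma map_fst_picks: "map fst (picks xs) = xs"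
  by (induction xs) (auto simp: case_prod_beta comp_def)

lemma count_list_picks:
  "(f, r) \<in> set (picks xs) \<Longrightarrow> count_list xs i = count_list r i + (if f = i then 1 else 0)"
  by (induction xs arbitrary: f r) fastforce+

lemma set_picks: "(f, r) \<in> set (picks xs) \<Longrightarrow> f \<in> set xs \<and> set r \<subseteq> set xs"
  by (induction xs arbitrary: f r) fastforce+

lemma sum_list_picks_eq:
  fixes K :: real
  shows "(\<Sum>(f, r)\<leftarrow>picks xs. if f = e then K else 0) = real (count_list xs e) * K"
proof -
  have "(\<Sum>(f, r)\<leftarrow>picks xs. if f = e then K else 0)
      = (\<Sum>f\<leftarrow>map fst (picks xs). if f = e then K else 0)"
    by (simp add: comp_def case_prod_unfold)
  also have "\<dots> = (\<Sum>f\<leftarrow>xs. if f = e then K else 0)" by (simp only: map_fst_picks)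
  also have "\<dots> = real (count_list xs e) * K"
    by (induction xs) (auto simp: algebra_simps)
  finally show ?thesis .
qed

lemma prod_list_eq_prod_count:
  fixes g :: "'i \<Rightarrow> real"
  assumes "finite I" "set ms \<subseteq> I"
  shows "(\<Prod>e\<leftarrow>ms. g e) = (\<Prod>i\<in>I. g i ^ count_list ms i)"
  using assms(2)
proof (induction ms)
  case (Cons e ms)
  have "(\<Prod>i\<in>I. g i ^ count_list (e # ms) i)
      = (\<Prod>i\<in>I. (if i = e then g e else 1) * g i ^ count_list ms i)"
    by (intro prod.cong) auto
  also have "\<dots> = g e * (\<Prod>i\<in>I. g i ^ count_list ms i)"
    using assms(1) Cons.prems by (simp add: prod.distrib prod.delta)
  finally show ?case using Cons by simp
qed simp

text \<open>For independent variables, the expectation of a monomial is the product over the variables of the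
  moments at their multiplicities. If the moments of each variable \<open>i\<close> obey the Gaussian recursion with
  variance \<open>v i\<close>, this product obeys Wick's recursion.\<close>

lemma wick_recursion_of_moments:
  fixes m :: "'i \<Rightarrow> nat \<Rightarrow> real" and v :: "'i \<Rightarrow> real"
  assumes I: "finite I" "e \<in> I" "set ms \<subseteq> I"
    and m: "\<And>i n. i \<in> I \<Longrightarrow> m i (Suc n) = real n * v i * m i (n - 1)"
  shows "(\<Prod>i\<in>I. m i (count_list (e # ms) i))
       = (\<Sum>(f, r)\<leftarrow>picks ms. (if f = e then v e else 0) * (\<Prod>i\<in>I. m i (count_list r i)))"
proof -
  define R where "R = (\<Prod>i\<in>I - {e}. m i (count_list ms i))"
  define n where "n = count_list ms e"
  have "(\<Sum>(f, r)\<leftarrow>picks ms. (if f = e then v e else 0) * (\<Prod>i\<in>I. m i (count_list r i)))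
      = (\<Sum>(f, r)\<leftarrow>picks ms. if f = e then v e * (m e (n - 1) * R) else 0)"
  proof (rule arg_cong[where f = sum_list], rule map_cong[OF refl])
    fix x assume x: "x \<in> set (picks ms)"
    obtain f r where [simp]: "x = (f, r)" by (cases x)
    show "(case x of (f, r) \<Rightarrow> (if f = e then v e else 0) * (\<Prod>i\<in>I. m i (count_list r i)))
      = (case x of (f, r) \<Rightarrow> if f = e then v e * (m e (n - 1) * R) else 0)"
    proof (cases "f = e")
      case True
      have c: "count_list ms i = count_list r i + (if f = i then 1 else 0)" for i
        using count_list_picks x by fastforce
      have "(\<Prod>i\<in>I. m i (count_list r i)) = m e (count_list r e) * (\<Prod>i\<in>I - {e}. m i (count_list r i))"
        using I by (simp add: prod.remove)
      also have "(\<Prod>i\<in>I - {e}. m i (count_list r i)) = R"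
        unfolding R_def using c True by (intro prod.cong) auto
      also have "count_list r e = n - 1" using c[of e] True by (simp add: n_def)
      finally show ?thesis using True by simp
    qed simp
  qed
  also have "\<dots> = real n * (v e * (m e (n - 1) * R))"
    unfolding n_def by (rule sum_list_picks_eq)
  also have "\<dots> = m e (Suc n) * R" using m[OF I(2), of n] by simp
  also have "\<dots> = (\<Prod>i\<in>I. m i (count_list (e # ms) i))"
  proof -
    have "(\<Prod>i\<in>I. m i (count_list (e # ms) i))
       = m e (Suc n) * (\<Prod>i\<in>I - {e}. m i (count_list (e # ms) i))"
      using I by (simp add: prod.remove n_def)
    also have "(\<Prod>i\<in>I - {e}. m i (count_list (e # ms) i)) = R"
      unfolding R_def by (intro prod.cong) auto
    finally show ?thesis ..
  qed
  finally show ?thesis ..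
qed

text \<open>The moments of the centered normal distribution with standard deviation \<open>\<sigma>\<close>.\<close>

definition gmom :: "real \<Rightarrow> nat \<Rightarrow> real" where
  "gmom \<sigma> n = (LBINT x. normal_density 0 \<sigma> x * x ^ n)"

lemma gmom_even: "\<sigma> > 0 \<Longrightarrow> gmom \<sigma> (2 * k) = fact (2 * k) / ((2 / \<sigma>\<^sup>2) ^ k * fact k)"
  unfolding gmom_def using integral_normal_moment_even[of \<sigma> 0 k] by simp

lemma gmom_odd: "\<sigma> > 0 \<Longrightarrow> gmom \<sigma> (Suc (2 * k)) = 0"
  unfolding gmom_def using integral_normal_moment_odd[of \<sigma> 0 k] by simp

lemma gmom_Suc:
  assumes "\<sigma> > 0"
  shows "gmom \<sigma> (Suc n) = real n * \<sigma>\<^sup>2 * gmom \<sigma> (n - 1)"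
proof (cases "even n")
  case True
  then obtain k where k: "n = 2 * k" by blast
  show ?thesis
  proof (cases k)
    case 0
    then show ?thesis using k assms gmom_odd[of \<sigma> 0] by simp
  next
    case (Suc l)
    then have "n - 1 = Suc (2 * l)" using k by simp
    then show ?thesis using k assms by (simp add: gmom_odd)
  qed
next
  case False
  then obtain k where k: "n = 2 * k + 1" using oddE by blast
  have 1: "Suc n = 2 * Suc k" using k by simp
  have 2: "fact (2 * Suc k) = (2 * real k + 2) * (2 * real k + 1) * fact (2 * k)"
    by (simp add: algebra_simps)
  have "gmom \<sigma> (Suc n) = fact (2 * Suc k) / ((2 / \<sigma>\<^sup>2) ^ Suc k * fact (Suc k))"
    unfolding 1 by (rule gmom_even[OF assms])
  also have "\<dots> = (2 * real k + 1) * \<sigma>\<^sup>2 * (fact (2 * k) / ((2 / \<sigma>\<^sup>2) ^ k * fact k))"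
    unfolding 2 using assms by (simp add: divide_simps del: fact_Suc) (simp add: algebra_simps)
  also have "\<dots> = real n * \<sigma>\<^sup>2 * gmom \<sigma> (n - 1)"
    using k gmom_even[OF assms, of k] by simp
  finally show ?thesis .
qed

lemma gaussian_moment:
  assumes "prob_space M" "distributed M lborel g (\<lambda>x. ennreal (normal_density 0 \<sigma> x))" "\<sigma> > 0"
  shows "integrable M (\<lambda>\<omega>. g \<omega> ^ n)" "(LINT \<omega>|M. g \<omega> ^ n) = gmom \<sigma> n"
proof -
  have "integrable lborel (\<lambda>x. normal_density 0 \<sigma> x * x ^ n)"
    using integrable_normal_moment[OF assms(3), of 0 n] by simp
  then show "integrable M (\<lambda>\<omega>. g \<omega> ^ n)"
    using distributed_integrable[OF assms(2), of "\<lambda>x. x ^ n"] assms(3) by simp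
  show "(LINT \<omega>|M. g \<omega> ^ n) = gmom \<sigma> n"
    unfolding gmom_def
    using distributed_integral[OF assms(2), of "\<lambda>x. x ^ n"] assms(3) by simp
qed

text \<open>The positions on and above the diagonal, where the entries of a GOE matrix are independent.\<close>

definition upper_idx :: "nat \<Rightarrow> (nat \<times> nat) set" where
  "upper_idx N = {(i, j). i \<le> j \<and> j < N}"

lemma finite_upper_idx[simp]: "finite (upper_idx N)"
  by (rule finite_subset[of _ "{..<N} \<times> {..<N}"]) (auto simp: upper_idx_def)

text \<open>The standard deviation of a GOE entry at the given position.\<close>

definition entry_sd :: "nat \<times> nat \<Rightarrow> real" where
  "entry_sd p = (if fst p = snd p then sqrt 2 else 1)"

lemma entry_sd_pos: "entry_sd p > 0" by (simp add: entry_sd_def)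

text \<open>The monomial in the upper triangular entries with exponents \<open>k\<close>, as a function on the space of all
  entries, so that independence of two matrices applies to it.\<close>

definition monom_fun :: "nat \<Rightarrow> (nat \<times> nat \<Rightarrow> nat) \<Rightarrow> (nat \<times> nat \<Rightarrow> real) \<Rightarrow> real" where
  "monom_fun N k \<eta> = (\<Prod>p\<in>upper_idx N. \<eta> p ^ k p)"

lemma measurable_monom_fun: "monom_fun N k \<in> borel_measurable (entry_space N)"
proof -
  have "(\<lambda>\<eta>. \<eta> p) \<in> borel_measurable (entry_space N)" if "p \<in> upper_idx N" for p
    unfolding entry_space_def using that
    by (intro measurable_component_singleton) (auto simp: upper_idx_def)
  then show ?thesis unfolding monom_fun_def by (intro borel_measurable_prod borel_measurable_power)
qed

lemma monom_fun_entries: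
  "monom_fun N k (entries N C) = (\<Prod>p\<in>upper_idx N. (C $$ p) ^ k p)"
  unfolding monom_fun_def entries_def by (intro prod.cong) (auto simp: upper_idx_def)

lemma GOE_monomial_moment:
  assumes "prob_space M" "GOE M N X"
  shows "integrable M (\<lambda>\<omega>. monom_fun N k (entries N (X \<omega>)))"
    "(LINT \<omega>|M. monom_fun N k (entries N (X \<omega>))) = (\<Prod>p\<in>upper_idx N. gmom (entry_sd p) (k p))"
proof -
  interpret prob_space M by fact
  have d: "distributed M lborel (\<lambda>\<omega>. X \<omega> $$ p) (\<lambda>x. ennreal (normal_density 0 (entry_sd p) x))"
    if "p \<in> upper_idx N" for p
    using that assms(2) by (cases p) (auto simp: GOE_def upper_idx_def entry_sd_def)
  have "indep_vars (\<lambda>_. borel) (\<lambda>p \<omega>. X \<omega> $$ p) (upper_idx N)"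
    using assms(2) unfolding GOE_def upper_idx_def by (simp add: case_prod_beta')
  then have ind: "indep_vars (\<lambda>_. borel) (\<lambda>p \<omega>. (X \<omega> $$ p) ^ k p) (upper_idx N)"
    by (rule indep_vars_compose2[where Y = "\<lambda>p x. x ^ k p"]) simp
  note g = gaussian_moment[OF assms(1) d entry_sd_pos]
  show "integrable M (\<lambda>\<omega>. monom_fun N k (entries N (X \<omega>)))"
    unfolding monom_fun_entries
    using indep_vars_integrable[OF finite_upper_idx ind] g(1) by simp
  show "(LINT \<omega>|M. monom_fun N k (entries N (X \<omega>))) = (\<Prod>p\<in>upper_idx N. gmom (entry_sd p) (k p))"
    unfolding monom_fun_entries
    using indep_vars_lebesgue_integral[OF finite_upper_idx ind] g by simp
qed

text \<open>An index \<open>(c, i, j)\<close> names the entry \<open>(i, j)\<close> of the first matrix if \<open>c\<close> is true, and of the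
  second one otherwise.\<close>

type_synonym idx = "bool \<times> nat \<times> nat"

text \<open>The position on or above the diagonal that carries the same random variable.\<close>

fun canon :: "idx \<Rightarrow> idx" where
  "canon (c, i, j) = (c, min i j, max i j)"

definition valid_idx :: "nat \<Rightarrow> idx set" where
  "valid_idx N = UNIV \<times> {..<N} \<times> {..<N}"

text \<open>The covariance of two entries. The sum of the two products of Kronecker deltas also gives the variance
  2 on the diagonal.\<close>

fun idx_cov :: "idx \<Rightarrow> idx \<Rightarrow> real" where
  "idx_cov (c, i, j) (d, k, l) =
     of_bool (c = d) * (of_bool (i = k) * of_bool (j = l) + of_bool (i = l) * of_bool (j = k))"

lemma idx_cov_canon:
  "idx_cov e f = (if canon f = canon e then (entry_sd (snd (canon e)))\<^sup>2 else 0)"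
proof -
  obtain c i j d k l where [simp]: "e = (c, i, j)" "f = (d, k, l)" by (cases e; cases f)
  consider "i < j" | "i = j" | "j < i" by linarith
  then show ?thesis
    by cases (auto simp: entry_sd_def min_def max_def)
qed

fun pair_entry :: "('a \<Rightarrow> real mat) \<Rightarrow> ('a \<Rightarrow> real mat) \<Rightarrow> idx \<Rightarrow> 'a \<Rightarrow> real" where
  "pair_entry A B (c, i, j) \<omega> = (if c then A \<omega> else B \<omega>) $$ (i, j)"

lemma picks_map: "picks (map f xs) = map (\<lambda>(y, ys). (f y, map f ys)) (picks xs)"
  by (induction xs) (auto simp: case_prod_beta comp_def)

text \<open>Independence makes the expectation of a monomial in the entries of both matrices the product of the
  Gaussian moments at the multiplicities of the positions on and above the diagonal.\<close>

lemma pair_GOE_wick: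
  assumes "prob_space M" "GOE M N A" "GOE M N B" "indep_matrices M N A B"
  defines "X \<equiv> pair_entry A B"
  shows pair_GOE_integrable:
      "set ms \<subseteq> valid_idx N \<Longrightarrow> integrable M (\<lambda>\<omega>. \<Prod>f\<leftarrow>ms. X f \<omega>)"
    and pair_GOE_wick_recursion: "e \<in> valid_idx N \<Longrightarrow> set ms \<subseteq> valid_idx N \<Longrightarrow>
      (LINT \<omega>|M. X e \<omega> * (\<Prod>f\<leftarrow>ms. X f \<omega>))
        = (\<Sum>(f, r)\<leftarrow>picks ms. idx_cov e f * (LINT \<omega>|M. (\<Prod>g\<leftarrow>r. X g \<omega>)))"
proof -
  interpret prob_space M by fact
  define I where "I = (UNIV :: bool set) \<times> upper_idx N"
  have finI: "finite I" by (simp add: I_def)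
  have canonI: "canon f \<in> I" if "f \<in> valid_idx N" for f
    using that by (cases f) (auto simp: I_def upper_idx_def valid_idx_def)
  have X_canon: "X f \<omega> = X (canon f) \<omega>" if "f \<in> valid_idx N" "\<omega> \<in> space M" for f \<omega>
  proof -
    have sym: "C $$ (i, j) = C $$ (j, i)"
      if C: "C \<in> carrier_mat N N \<and> transpose_mat C = C" and ij: "i < N" "j < N" for C :: "real mat" and i j
      using C ij by (metis carrier_matD index_transpose_mat(1))
    obtain c i j where f: "f = (c, i, j)" by (cases f)
    have AB: "A \<omega> \<in> carrier_mat N N \<and> transpose_mat (A \<omega>) = A \<omega>"
       "B \<omega> \<in> carrier_mat N N \<and> transpose_mat (B \<omega>) = B \<omega>"
      using assms(2,3) that(2) by (auto simp: GOE_def)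
    have ij: "i < N" "j < N" using that(1) f by (auto simp: valid_idx_def)
    show ?thesis unfolding X_def f using sym[OF AB(1) ij] sym[OF AB(2) ij]
      by (auto simp: min_def max_def)
  qed
  have mon: "(\<Prod>f\<leftarrow>ms. X f \<omega>) =
      monom_fun N (\<lambda>p. count_list (map canon ms) (True, p)) (entries N (A \<omega>)) *
      monom_fun N (\<lambda>p. count_list (map canon ms) (False, p)) (entries N (B \<omega>))"
    if "set ms \<subseteq> valid_idx N" "\<omega> \<in> space M" for ms \<omega>
  proof -
    have "(\<Prod>f\<leftarrow>ms. X f \<omega>) = (\<Prod>f\<leftarrow>map canon ms. X f \<omega>)"
      using that X_canon by (auto intro!: arg_cong[where f = prod_list] simp: subset_iff)
    also have "\<dots> = (\<Prod>i\<in>I. X i \<omega> ^ count_list (map canon ms) i)"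
      using that canonI by (intro prod_list_eq_prod_count finI) auto
    also have "\<dots> = (\<Prod>c\<in>UNIV. \<Prod>p\<in>upper_idx N. X (c, p) \<omega> ^ count_list (map canon ms) (c, p))"
      unfolding I_def by (subst prod.cartesian_product) simp
    also have "\<dots> = (\<Prod>p\<in>upper_idx N. X (True, p) \<omega> ^ count_list (map canon ms) (True, p)) *
        (\<Prod>p\<in>upper_idx N. X (False, p) \<omega> ^ count_list (map canon ms) (False, p))"
      by (simp add: UNIV_bool mult.commute)
    finally show ?thesis unfolding monom_fun_entries X_def
      by (simp add: case_prod_beta split_paired_all)
  qed
  have ind: "indep_var borel (monom_fun N k \<circ> (\<lambda>\<omega>. entries N (A \<omega>)))
                    borel (monom_fun N l \<circ> (\<lambda>\<omega>. entries N (B \<omega>)))" for k l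
    using assms(4) unfolding indep_matrices_def
    by (rule indep_var_compose) (rule measurable_monom_fun)+
  note intA = GOE_monomial_moment[OF assms(1,2)] and intB = GOE_monomial_moment[OF assms(1,3)]
  show int: "integrable M (\<lambda>\<omega>. \<Prod>f\<leftarrow>ms. X f \<omega>)" if "set ms \<subseteq> valid_idx N" for ms
    using indep_var_integrable[OF ind[unfolded comp_def] intA(1) intB(1)] mon[OF that]
    by (subst Bochner_Integration.integrable_cong[OF refl mon[OF that]]) auto
  define m where "m = (\<lambda>i::idx. gmom (entry_sd (snd i)))"
  have Ex: "(LINT \<omega>|M. (\<Prod>f\<leftarrow>ms. X f \<omega>)) = (\<Prod>i\<in>I. m i (count_list (map canon ms) i))"
    if "set ms \<subseteq> valid_idx N" for ms
  proof -
    have "(LINT \<omega>|M. (\<Prod>f\<leftarrow>ms. X f \<omega>)) =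
        (\<Prod>p\<in>upper_idx N. gmom (entry_sd p) (count_list (map canon ms) (True, p))) *
        (\<Prod>p\<in>upper_idx N. gmom (entry_sd p) (count_list (map canon ms) (False, p)))"
      using indep_var_lebesgue_integral[OF ind[unfolded comp_def] intA(1) intB(1)]
      by (subst Bochner_Integration.integral_cong[OF refl mon[OF that]]) (auto simp: intA intB)
    also have "\<dots> = (\<Prod>c\<in>UNIV. \<Prod>p\<in>upper_idx N. m (c, p) (count_list (map canon ms) (c, p)))"
      by (simp add: UNIV_bool m_def mult.commute)
    also have "\<dots> = (\<Prod>i\<in>I. m i (count_list (map canon ms) i))"
      unfolding I_def by (subst prod.cartesian_product) simp
    finally show ?thesis .
  qed
  show "(LINT \<omega>|M. X e \<omega> * (\<Prod>f\<leftarrow>ms. X f \<omega>))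
        = (\<Sum>(f, r)\<leftarrow>picks ms. idx_cov e f * (LINT \<omega>|M. (\<Prod>g\<leftarrow>r. X g \<omega>)))"
    if e: "e \<in> valid_idx N" and ms: "set ms \<subseteq> valid_idx N" for e ms
  proof -
    have "(LINT \<omega>|M. X e \<omega> * (\<Prod>f\<leftarrow>ms. X f \<omega>))
        = (\<Prod>i\<in>I. m i (count_list (canon e # map canon ms) i))"
      using Ex[of "e # ms"] e ms by simp
    also have "\<dots> = (\<Sum>(f, r)\<leftarrow>picks (map canon ms).
        (if f = canon e then (entry_sd (snd (canon e)))\<^sup>2 else 0) * (\<Prod>i\<in>I. m i (count_list r i)))"
      using canonI[OF e] canonI ms
      by (intro wick_recursion_of_moments[where v = "\<lambda>i. (entry_sd (snd i))\<^sup>2"] finI)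
         (auto simp: m_def gmom_Suc entry_sd_pos)
    also have "\<dots> = (\<Sum>(f, r)\<leftarrow>picks ms. idx_cov e f * (LINT \<omega>|M. (\<Prod>g\<leftarrow>r. X g \<omega>)))"
      unfolding picks_map list.map_comp
    proof (rule arg_cong[where f = sum_list], rule map_cong[OF refl])
      fix x assume x: "x \<in> set (picks ms)"
      obtain f r where [simp]: "x = (f, r)" by (cases x)
      have "set r \<subseteq> valid_idx N" using set_picks[of f r ms] x ms by auto
      then show "((\<lambda>(f, r). (if f = canon e then (entry_sd (snd (canon e)))\<^sup>2 else 0) *
            (\<Prod>i\<in>I. m i (count_list r i))) \<circ> (\<lambda>(y, ys). (canon y, map canon ys))) x
          = (case x of (f, r) \<Rightarrow> idx_cov e f * (LINT \<omega>|M. (\<Prod>g\<leftarrow>r. X g \<omega>)))"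
        by (simp add: idx_cov_canon Ex)
    qed
    finally show ?thesis .
  qed
qed

section \<open>Gaussian integration by parts for polynomials in the entries\<close>

text \<open>The value at \<open>y\<close> of the polynomial given by a list of coefficients and monomials.\<close>

definition poly_val :: "(real \<times> idx list) list \<Rightarrow> (idx \<Rightarrow> real) \<Rightarrow> real" where
  "poly_val L y = (\<Sum>(a, ms)\<leftarrow>L. a * (\<Prod>f\<leftarrow>ms. y f))"

text \<open>The derivative of that polynomial in which the entry \<open>f\<close> moves with speed \<open>s * idx_cov e f\<close>.\<close>

definition poly_der :: "real \<Rightarrow> idx \<Rightarrow> (real \<times> idx list) list \<Rightarrow> (idx \<Rightarrow> real) \<Rightarrow> real" where
  "poly_der s e L y = (\<Sum>(a, ms)\<leftarrow>L. a * (\<Sum>(f, r)\<leftarrow>picks ms. s * idx_cov e f * (\<Prod>g\<leftarrow>r. y g)))"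

text \<open>\<open>poly_deriv s N e F F'\<close> means that \<open>F\<close> is a polynomial in the entries and that \<open>F'\<close> is the directional
  derivative of \<open>F\<close> in which the entry \<open>f\<close> moves with speed \<open>s * idx_cov e f\<close>. A polynomial is
  given by a list of monomials with coefficients; the relation is used through its closure properties only.\<close>

definition poly_deriv :: "real \<Rightarrow> nat \<Rightarrow> idx \<Rightarrow> ((idx \<Rightarrow> real) \<Rightarrow> real) \<Rightarrow> ((idx \<Rightarrow> real) \<Rightarrow> real) \<Rightarrow> bool" where
  "poly_deriv s N e F F' \<longleftrightarrow>
     (\<exists>L. (\<forall>(a, ms)\<in>set L. set ms \<subseteq> valid_idx N) \<and> F = poly_val L \<and> F' = poly_der s e L)"

lemma poly_deriv_const: "poly_deriv s N e (\<lambda>y. a) (\<lambda>y. 0)"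
  unfolding poly_deriv_def
  by (rule exI[of _ "[(a, [])]"]) (auto simp: poly_val_def poly_der_def fun_eq_iff)

lemma poly_deriv_var:
  "f \<in> valid_idx N \<Longrightarrow> poly_deriv s N e (\<lambda>y. y f) (\<lambda>y. s * idx_cov e f)"
  unfolding poly_deriv_def
  by (rule exI[of _ "[(1, [f])]"]) (auto simp: poly_val_def poly_der_def fun_eq_iff)

lemma poly_deriv_add:
  assumes "poly_deriv s N e F F'" "poly_deriv s N e G G'"
  shows "poly_deriv s N e (\<lambda>y. F y + G y) (\<lambda>y. F' y + G' y)"
proof -
  obtain L where L: "\<forall>(a, ms)\<in>set L. set ms \<subseteq> valid_idx N" "F = poly_val L" "F' = poly_der s e L"
    using assms(1) by (auto simp: poly_deriv_def)
  obtain K where K: "\<forall>(a, ms)\<in>set K. set ms \<subseteq> valid_idx N" "G = poly_val K" "G' = poly_der s e K"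
    using assms(2) by (auto simp: poly_deriv_def)
  show ?thesis unfolding poly_deriv_def
    by (rule exI[of _ "L @ K"]) (use L K in \<open>auto simp: poly_val_def poly_der_def fun_eq_iff\<close>)
qed

lemma picks_append:
  "picks (ms @ ns) = map (\<lambda>(f, r). (f, r @ ns)) (picks ms) @ map (\<lambda>(f, r). (f, ms @ r)) (picks ns)"
  by (induction ms) (auto simp: case_prod_beta comp_def)

text \<open>The same derivative for a single monomial.\<close>

definition monom_der :: "real \<Rightarrow> idx \<Rightarrow> idx list \<Rightarrow> (idx \<Rightarrow> real) \<Rightarrow> real" where
  "monom_der s e ms y = (\<Sum>(f, r)\<leftarrow>picks ms. s * idx_cov e f * (\<Prod>g\<leftarrow>r. y g))"

lemma monom_der_append:
  "monom_der s e (ms @ ns) y = monom_der s e ms y * (\<Prod>g\<leftarrow>ns. y g) + (\<Prod>g\<leftarrow>ms. y g) * monom_der s e ns y"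
  unfolding monom_der_def picks_append
  by (simp add: case_prod_beta comp_def sum_list_mult_const[symmetric] sum_list_const_mult[symmetric] mult_ac)

lemma poly_deriv_mult:
  assumes "poly_deriv s N e F F'" "poly_deriv s N e G G'"
  shows "poly_deriv s N e (\<lambda>y. F y * G y) (\<lambda>y. F' y * G y + F y * G' y)"
proof -
  obtain L where L: "\<forall>(a, ms)\<in>set L. set ms \<subseteq> valid_idx N" "F = poly_val L" "F' = poly_der s e L"
    using assms(1) by (auto simp: poly_deriv_def)
  obtain K where K: "\<forall>(a, ms)\<in>set K. set ms \<subseteq> valid_idx N" "G = poly_val K" "G' = poly_der s e K"
    using assms(2) by (auto simp: poly_deriv_def)
  define T where "T = (\<lambda>(a, ms). map (\<lambda>(b, ns). (a * b :: real, ms @ ns :: idx list)) K)"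
  have v1: "poly_val (T (a, ms)) y = a * (\<Prod>f\<leftarrow>ms. y f) * poly_val K y" for a ms y
    unfolding T_def poly_val_def
    by (simp add: case_prod_beta comp_def sum_list_const_mult[symmetric] mult_ac)
  have d1: "poly_der s e (T (a, ms)) y =
      a * monom_der s e ms y * poly_val K y + a * (\<Prod>f\<leftarrow>ms. y f) * poly_der s e K y" for a ms y
    unfolding T_def poly_val_def poly_der_def monom_der_def[symmetric]
    by (simp add: case_prod_beta comp_def monom_der_append sum_list_const_mult[symmetric]
         sum_list_addf[symmetric] algebra_simps)
  have v: "poly_val (concat (map T L)) y = poly_val L y * poly_val K y" for y
  proof (induction L)
    case (Cons x L)
    obtain a ms where x: "x = (a, ms)" by (cases x)
    have "poly_val (concat (map T (x # L))) y = poly_val (T x) y + poly_val (concat (map T L)) y"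
      by (simp add: poly_val_def)
    then show ?case unfolding x v1 using Cons by (simp add: poly_val_def algebra_simps)
  qed (simp add: poly_val_def)
  have d: "poly_der s e (concat (map T L)) y
      = poly_der s e L y * poly_val K y + poly_val L y * poly_der s e K y" for y
  proof (induction L)
    case (Cons x L)
    obtain a ms where x: "x = (a, ms)" by (cases x)
    have "poly_der s e (concat (map T (x # L))) y
        = poly_der s e (T x) y + poly_der s e (concat (map T L)) y"
      by (simp add: poly_der_def)
    moreover have "poly_der s e (x # L) y = a * monom_der s e ms y + poly_der s e L y"
      by (simp add: poly_der_def x monom_der_def)
    moreover have "poly_val (x # L) y = a * (\<Prod>f\<leftarrow>ms. y f) + poly_val L y"
      by (simp add: poly_val_def x)
    ultimately show ?case unfolding x d1 using Cons by (simp add: algebra_simps)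
  qed (simp add: poly_val_def poly_der_def)
  have val: "\<forall>(a, ms)\<in>set (concat (map T L)). set ms \<subseteq> valid_idx N"
  proof (clarify)
    fix a ms f assume x: "(a, ms) \<in> set (concat (map T L))" and f: "f \<in> set ms"
    then obtain l k where lk: "l \<in> set L" "k \<in> set K" "(a, ms) = (fst l * fst k, snd l @ snd k)"
      by (auto simp: T_def case_prod_unfold)
    then have "set (snd l) \<subseteq> valid_idx N" "set (snd k) \<subseteq> valid_idx N"
      using L(1) K(1) by (simp_all add: case_prod_unfold)
    then show "f \<in> valid_idx N" using lk f by auto
  qed
  have "(\<lambda>y. F y * G y) = poly_val (concat (map T L))"
    "(\<lambda>y. F' y * G y + F y * G' y) = poly_der s e (concat (map T L))"
    unfolding L K v d by auto
  then show ?thesis unfolding poly_deriv_def using val by blast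
qed

lemma poly_deriv_sum:
  assumes "finite A" "\<And>i. i \<in> A \<Longrightarrow> poly_deriv s N e (F i) (F' i)"
  shows "poly_deriv s N e (\<lambda>y. \<Sum>i\<in>A. F i y) (\<lambda>y. \<Sum>i\<in>A. F' i y)"
  using assms by (induction A rule: finite_induct) (auto intro: poly_deriv_const poly_deriv_add)

lemma poly_deriv_cong:
  assumes "poly_deriv s N e F F'" "\<And>y. F y = G y" "\<And>y. F' y = G' y"
  shows "poly_deriv s N e G G'"
proof -
  have "F = G" "F' = G'" using assms by auto
  then show ?thesis using assms by simp
qed

lemma poly_deriv_prod_list:
  assumes "\<And>w. w \<in> set ws \<Longrightarrow> poly_deriv s N e (F w) (F' w)"
  shows "poly_deriv s N e (\<lambda>y. \<Prod>w\<leftarrow>ws. F w y)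
            (\<lambda>y. \<Sum>(v, r)\<leftarrow>picks ws. F' v y * (\<Prod>w\<leftarrow>r. F w y))"
  using assms
proof (induction ws)
  case Nil
  then show ?case using poly_deriv_const[of s N e 1] by simp
next
  case (Cons w ws)
  have "poly_deriv s N e (\<lambda>y. F w y * (\<Prod>w\<leftarrow>ws. F w y))
     (\<lambda>y. F' w y * (\<Prod>w\<leftarrow>ws. F w y) + F w y * (\<Sum>(v, r)\<leftarrow>picks ws. F' v y * (\<Prod>w\<leftarrow>r. F w y)))"
    using Cons by (intro poly_deriv_mult) auto
  then show ?case
    by (rule poly_deriv_cong)
       (auto simp: case_prod_beta comp_def sum_list_const_mult[symmetric] mult_ac)
qed

section \<open>Traces of words and the Schwinger--Dyson equation\<close>

text \<open>A word in the two matrices; the letter \<open>True\<close> stands for the first matrix.\<close>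

type_synonym word = "bool list"

text \<open>The entry \<open>(i, j)\<close> of the product of matrices spelled by a word.\<close>

fun wmat :: "nat \<Rightarrow> (idx \<Rightarrow> real) \<Rightarrow> word \<Rightarrow> nat \<Rightarrow> nat \<Rightarrow> real" where
  "wmat N y [] i j = of_bool (i = j)"
| "wmat N y (c # w) i j = (\<Sum>k<N. y (c, i, k) * wmat N y w k j)"

text \<open>The trace of the product of matrices spelled by a word.\<close>

definition wtr :: "nat \<Rightarrow> (idx \<Rightarrow> real) \<Rightarrow> word \<Rightarrow> real" where
  "wtr N y w = (\<Sum>i<N. wmat N y w i i)"

text \<open>All pairs \<open>(u, v)\<close> with \<open>w = u @ c # v\<close>.\<close>

fun splits :: "bool \<Rightarrow> word \<Rightarrow> (word \<times> word) list" where
  "splits c [] = []"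
| "splits c (d # w) = (if c = d then [([], w)] else []) @ map (\<lambda>(u, v). (d # u, v)) (splits c w)"

lemma splits_length: "(u, v) \<in> set (splits c w) \<Longrightarrow> length w = Suc (length u + length v)"
  by (induction w arbitrary: u v) (auto split: if_splits)

lemma sum_list_sum_swap:
  fixes f :: "'a \<Rightarrow> 'b \<Rightarrow> real"
  shows "(\<Sum>i\<in>A. \<Sum>x\<leftarrow>xs. f i x) = (\<Sum>x\<leftarrow>xs. \<Sum>i\<in>A. f i x)"
  by (induction xs) (auto simp: sum.distrib)

lemma wmat_append:
  "i < N \<Longrightarrow> wmat N y (u @ v) i j = (\<Sum>k<N. wmat N y u i k * wmat N y v k j)"
proof (induction u arbitrary: i)
  case Nil
  have "(\<Sum>k<N. of_bool (i = k) * wmat N y v k j) = (\<Sum>k<N. if k = i then wmat N y v k j else 0)"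
    by (intro sum.cong) auto
  with Nil show ?case by simp
next
  case (Cons c u)
  have "wmat N y ((c # u) @ v) i j = (\<Sum>l<N. \<Sum>k<N. y (c, i, l) * (wmat N y u l k * wmat N y v k j))"
    using Cons by (simp add: sum_distrib_left)
  also have "\<dots> = (\<Sum>k<N. \<Sum>l<N. y (c, i, l) * (wmat N y u l k * wmat N y v k j))"
    by (rule sum.swap)
  also have "\<dots> = (\<Sum>k<N. wmat N y (c # u) i k * wmat N y v k j)"
    by (simp add: sum_distrib_right mult.assoc)
  finally show ?case .
qed

lemma wmat_singleton: "j < N \<Longrightarrow> wmat N y [c] i j = y (c, i, j)"
proof -
  assume "j < N"
  have "(\<Sum>k<N. y (c, i, k) * of_bool (k = j)) = (\<Sum>k<N. if k = j then y (c, i, k) else 0)"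
    by (intro sum.cong) auto
  then show ?thesis using \<open>j < N\<close> by simp
qed

text \<open>Both matrices are symmetric.\<close>

definition sym_family :: "nat \<Rightarrow> (idx \<Rightarrow> real) \<Rightarrow> bool" where
  "sym_family N y \<longleftrightarrow> (\<forall>c i j. i < N \<longrightarrow> j < N \<longrightarrow> y (c, i, j) = y (c, j, i))"

lemma wmat_rev:
  assumes "sym_family N y" "i < N" "j < N"
  shows "wmat N y (rev w) i j = wmat N y w j i"
  using assms(2,3)
proof (induction w arbitrary: i j)
  case (Cons c w)
  have "wmat N y (rev (c # w)) i j = (\<Sum>k<N. wmat N y (rev w) i k * wmat N y [c] k j)"
    using Cons.prems by (simp add: wmat_append del: wmat.simps)
  also have "\<dots> = (\<Sum>k<N. y (c, j, k) * wmat N y w k i)"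
    using Cons assms(1) by (intro sum.cong) (auto simp: wmat_singleton sym_family_def simp del: wmat.simps)
  finally show ?case by simp
qed auto

text \<open>Leibniz rule: moving the entries \<open>(p, q)\<close> and \<open>(q, p)\<close> of the letter \<open>c\<close> cuts a word at each occurrence
  of \<open>c\<close>, in the two orders.\<close>

lemma poly_deriv_wmat:
  assumes "p < N" "q < N" "i < N" "j < N"
  shows "poly_deriv s N (c, p, q) (\<lambda>y. wmat N y w i j)
    (\<lambda>y. s * (\<Sum>x\<leftarrow>splits c w. wmat N y (fst x) i p * wmat N y (snd x) q j
                             + wmat N y (fst x) i q * wmat N y (snd x) p j))"
  using assms(3)
proof (induction w arbitrary: i)
  case Nil
  show ?case using poly_deriv_const[of s N "(c, p, q)" "of_bool (i = j)"] by simp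
next
  case (Cons d w)
  let ?S = "\<lambda>y i. s * (\<Sum>x\<leftarrow>splits c w. wmat N y (fst x) i p * wmat N y (snd x) q j
                             + wmat N y (fst x) i q * wmat N y (snd x) p j)"
  have "poly_deriv s N (c, p, q) (\<lambda>y. \<Sum>k<N. y (d, i, k) * wmat N y w k j)
      (\<lambda>y. \<Sum>k<N. s * idx_cov (c, p, q) (d, i, k) * wmat N y w k j + y (d, i, k) * ?S y k)"
    by (intro poly_deriv_sum poly_deriv_mult poly_deriv_var Cons.IH)
       (use Cons.prems in \<open>auto simp: valid_idx_def\<close>)
  then show ?case
  proof (rule poly_deriv_cong)
    fix y
    have 1: "(\<Sum>k<N. s * idx_cov (c, p, q) (d, i, k) * wmat N y w k j)
        = s * (if c = d then wmat N y [] i p * wmat N y w q j + wmat N y [] i q * wmat N y w p j else 0)"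
    proof -
      have "(\<Sum>k<N. s * idx_cov (c, p, q) (d, i, k) * wmat N y w k j)
        = (\<Sum>k<N. (if k = q then s * (of_bool (c = d) * of_bool (i = p) * wmat N y w k j) else 0)
               + (if k = p then s * (of_bool (c = d) * of_bool (i = q) * wmat N y w k j) else 0))"
        by (intro sum.cong) auto
      also have "\<dots> = s * (of_bool (c = d) * of_bool (i = p) * wmat N y w q j)
               + s * (of_bool (c = d) * of_bool (i = q) * wmat N y w p j)"
        using assms by (simp add: sum.distrib)
      finally show ?thesis by (simp add: algebra_simps)
    qed
    have 2: "(\<Sum>k<N. y (d, i, k) * ?S y k)
       = s * (\<Sum>x\<leftarrow>splits c w. wmat N y (d # fst x) i p * wmat N y (snd x) q j
                             + wmat N y (d # fst x) i q * wmat N y (snd x) p j)"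
    proof -
      have "(\<Sum>k<N. y (d, i, k) * ?S y k) = (\<Sum>k<N. \<Sum>x\<leftarrow>splits c w.
          s * (y (d, i, k) * wmat N y (fst x) k p * wmat N y (snd x) q j
             + y (d, i, k) * wmat N y (fst x) k q * wmat N y (snd x) p j))"
        by (simp add: sum_list_const_mult[symmetric] algebra_simps)
      also have "\<dots> = (\<Sum>x\<leftarrow>splits c w. s * (wmat N y (d # fst x) i p * wmat N y (snd x) q j
                             + wmat N y (d # fst x) i q * wmat N y (snd x) p j))"
        unfolding sum_list_sum_swap
        by (simp add: sum_distrib_left[symmetric] sum_distrib_right[symmetric] sum.distrib)
      finally show ?thesis by (simp add: sum_list_const_mult)
    qed
    show "(\<Sum>k<N. s * idx_cov (c, p, q) (d, i, k) * wmat N y w k j + y (d, i, k) * ?S y k)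
      = s * (\<Sum>x\<leftarrow>splits c (d # w). wmat N y (fst x) i p * wmat N y (snd x) q j
                             + wmat N y (fst x) i q * wmat N y (snd x) p j)"
      unfolding sum.distrib 1 2
      by (simp add: case_prod_beta comp_def distrib_left del: wmat.simps)
  qed simp
qed

lemma poly_deriv_wtr:
  assumes "p < N" "q < N"
  shows "poly_deriv s N (c, p, q) (\<lambda>y. wtr N y w)
    (\<lambda>y. s * (\<Sum>x\<leftarrow>splits c w. wmat N y (snd x @ fst x) q p + wmat N y (snd x @ fst x) p q))"
proof -
  have "poly_deriv s N (c, p, q) (\<lambda>y. wtr N y w)
    (\<lambda>y. \<Sum>i<N. s * (\<Sum>x\<leftarrow>splits c w. wmat N y (fst x) i p * wmat N y (snd x) q i
                             + wmat N y (fst x) i q * wmat N y (snd x) p i))"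
    unfolding wtr_def using assms by (intro poly_deriv_sum poly_deriv_wmat) auto
  then show ?thesis
  proof (rule poly_deriv_cong)
    fix y
    show "(\<Sum>i<N. s * (\<Sum>x\<leftarrow>splits c w. wmat N y (fst x) i p * wmat N y (snd x) q i
                             + wmat N y (fst x) i q * wmat N y (snd x) p i))
       = s * (\<Sum>x\<leftarrow>splits c w. wmat N y (snd x @ fst x) q p + wmat N y (snd x @ fst x) p q)"
      unfolding sum_distrib_left[symmetric] sum_list_sum_swap
      using assms by (simp add: wmat_append sum.distrib mult.commute)
  qed simp
qed

text \<open>Random symmetric matrices whose entries obey Wick's recursion with \<open>s\<close> times the GOE covariance.\<close>

locale wick_family = prob_space M for M :: "'a measure" +
  fixes N :: nat and s :: real and Y :: "'a \<Rightarrow> idx \<Rightarrow> real"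
  assumes integrable_monom: "set ms \<subseteq> valid_idx N \<Longrightarrow> integrable M (\<lambda>\<omega>. \<Prod>f\<leftarrow>ms. Y \<omega> f)"
    and wick: "e \<in> valid_idx N \<Longrightarrow> set ms \<subseteq> valid_idx N \<Longrightarrow>
      (LINT \<omega>|M. Y \<omega> e * (\<Prod>f\<leftarrow>ms. Y \<omega> f))
        = (\<Sum>(f, r)\<leftarrow>picks ms. s * idx_cov e f * (LINT \<omega>|M. (\<Prod>g\<leftarrow>r. Y \<omega> g)))"
    and sym: "\<omega> \<in> space M \<Longrightarrow> sym_family N (Y \<omega>)"
begin

lemma integrable_sum_list:
  fixes f :: "'b \<Rightarrow> 'a \<Rightarrow> real"
  assumes "\<And>x. x \<in> set xs \<Longrightarrow> integrable M (f x)"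
  shows "integrable M (\<lambda>\<omega>. \<Sum>x\<leftarrow>xs. f x \<omega>)"
    and "(LINT \<omega>|M. (\<Sum>x\<leftarrow>xs. f x \<omega>)) = (\<Sum>x\<leftarrow>xs. LINT \<omega>|M. f x \<omega>)"
proof -
  have "integrable M (\<lambda>\<omega>. \<Sum>x\<leftarrow>xs. f x \<omega>) \<and>
     (LINT \<omega>|M. (\<Sum>x\<leftarrow>xs. f x \<omega>)) = (\<Sum>x\<leftarrow>xs. LINT \<omega>|M. f x \<omega>)"
    using assms by (induction xs) auto
  then show "integrable M (\<lambda>\<omega>. \<Sum>x\<leftarrow>xs. f x \<omega>)"
    and "(LINT \<omega>|M. (\<Sum>x\<leftarrow>xs. f x \<omega>)) = (\<Sum>x\<leftarrow>xs. LINT \<omega>|M. f x \<omega>)" by auto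
qed

text \<open>Gaussian integration by parts.\<close>

lemma stein:
  assumes "poly_deriv s N e F F'" "e \<in> valid_idx N"
  shows "integrable M (\<lambda>\<omega>. F (Y \<omega>))" "integrable M (\<lambda>\<omega>. F' (Y \<omega>))"
    "integrable M (\<lambda>\<omega>. Y \<omega> e * F (Y \<omega>))"
    "(LINT \<omega>|M. Y \<omega> e * F (Y \<omega>)) = (LINT \<omega>|M. F' (Y \<omega>))"
proof -
  obtain L where L: "\<forall>(a, ms)\<in>set L. set ms \<subseteq> valid_idx N" "F = poly_val L" "F' = poly_der s e L"
    using assms(1) by (auto simp: poly_deriv_def)
  have L1: "set (snd x) \<subseteq> valid_idx N" if "x \<in> set L" for x
    using L(1) that by (simp add: case_prod_unfold)
  have m1: "integrable M (\<lambda>\<omega>. \<Prod>f\<leftarrow>snd x. Y \<omega> f)" if "x \<in> set L" for x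
    using L1 that by (intro integrable_monom)
  have m2: "integrable M (\<lambda>\<omega>. Y \<omega> e * (\<Prod>f\<leftarrow>snd x. Y \<omega> f))" if "x \<in> set L" for x
    using L1[OF that] assms(2) integrable_monom[of "e # snd x"] by simp
  have m3: "integrable M (\<lambda>\<omega>. \<Prod>f\<leftarrow>snd z. Y \<omega> f)" if "x \<in> set L" "z \<in> set (picks (snd x))" for x z
    using L1[OF that(1)] that(2) set_picks[of "fst z" "snd z" "snd x"]
    by (intro integrable_monom) (simp; blast)
  show "integrable M (\<lambda>\<omega>. F (Y \<omega>))"
    unfolding L(2) poly_val_def case_prod_unfold
    by (intro integrable_sum_list integrable_mult_right m1)
  show "integrable M (\<lambda>\<omega>. F' (Y \<omega>))"
    unfolding L(3) poly_der_def case_prod_unfold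
    by (intro integrable_sum_list integrable_mult_right m3)
  have eq: "Y \<omega> e * F (Y \<omega>) = (\<Sum>x\<leftarrow>L. fst x * (Y \<omega> e * (\<Prod>f\<leftarrow>snd x. Y \<omega> f)))" for \<omega>
    unfolding L(2) poly_val_def case_prod_unfold
    by (simp add: sum_list_const_mult[symmetric] mult_ac)
  show "integrable M (\<lambda>\<omega>. Y \<omega> e * F (Y \<omega>))"
    unfolding eq by (intro integrable_sum_list integrable_mult_right m2)
  have "(LINT \<omega>|M. Y \<omega> e * F (Y \<omega>)) = (\<Sum>x\<leftarrow>L. fst x * (LINT \<omega>|M. Y \<omega> e * (\<Prod>f\<leftarrow>snd x. Y \<omega> f)))"
    unfolding eq by (subst integrable_sum_list) (auto intro!: m2)
  also have "\<dots> = (\<Sum>x\<leftarrow>L. fst x * (\<Sum>z\<leftarrow>picks (snd x). s * idx_cov e (fst z) * (LINT \<omega>|M. (\<Prod>g\<leftarrow>snd z. Y \<omega> g))))"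
  proof (intro arg_cong[where f = sum_list] map_cong refl)
    fix x assume "x \<in> set L"
    then have "set (snd x) \<subseteq> valid_idx N" by (rule L1)
    from wick[OF assms(2) this] show "fst x * (LINT \<omega>|M. Y \<omega> e * (\<Prod>f\<leftarrow>snd x. Y \<omega> f))
      = fst x * (\<Sum>z\<leftarrow>picks (snd x). s * idx_cov e (fst z) * (LINT \<omega>|M. (\<Prod>g\<leftarrow>snd z. Y \<omega> g)))"
      by (simp add: case_prod_unfold)
  qed
  also have "\<dots> = (\<Sum>x\<leftarrow>L. LINT \<omega>|M. fst x * (\<Sum>z\<leftarrow>picks (snd x). s * idx_cov e (fst z) * (\<Prod>g\<leftarrow>snd z. Y \<omega> g)))"
    by (intro arg_cong[where f = sum_list] map_cong refl)
       (simp add: integrable_sum_list(2) m3)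
  also have "\<dots> = (LINT \<omega>|M. F' (Y \<omega>))"
    unfolding L(3) poly_der_def case_prod_unfold
    by (intro integrable_sum_list(2)[symmetric] integrable_sum_list(1) integrable_mult_right m3)
  finally show "(LINT \<omega>|M. Y \<omega> e * F (Y \<omega>)) = (LINT \<omega>|M. F' (Y \<omega>))" .
qed

lemma integrable_prod_wtr:
  assumes "N > 0"
  shows "integrable M (\<lambda>\<omega>. \<Prod>w\<leftarrow>ws. wtr N (Y \<omega>) w)"
proof -
  have e: "(True, 0, 0) \<in> valid_idx N" using assms by (simp add: valid_idx_def)
  show ?thesis
    by (rule stein(1)[OF poly_deriv_prod_list e]) (rule poly_deriv_wtr[OF assms assms])
qed

lemma integral_double_sum:
  fixes f :: "nat \<Rightarrow> nat \<Rightarrow> 'a \<Rightarrow> real"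
  assumes f: "\<And>p q. p < n \<Longrightarrow> q < n \<Longrightarrow> integrable M (f p q)"
  shows "(LINT \<omega>|M. (\<Sum>p<n. \<Sum>q<n. f p q \<omega>)) = (\<Sum>p<n. \<Sum>q<n. LINT \<omega>|M. f p q \<omega>)"
proof -
  have "(LINT \<omega>|M. (\<Sum>p<n. \<Sum>q<n. f p q \<omega>)) = (\<Sum>p<n. LINT \<omega>|M. (\<Sum>q<n. f p q \<omega>))"
    by (rule Bochner_Integration.integral_sum) (rule Bochner_Integration.integrable_sum, simp add: f)
  also have "\<dots> = (\<Sum>p<n. \<Sum>q<n. LINT \<omega>|M. f p q \<omega>)"
    by (intro sum.cong refl Bochner_Integration.integral_sum) (simp add: f)
  finally show ?thesis .
qed

text \<open>Integration by parts in the first letter \<open>c\<close> of the first word. The derivative hits either the rest \<open>w\<close>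
  of this word, which is cut into two traces or, with a reversal, rejoined into one, or another
  word of the list, which is then merged with \<open>w\<close>.\<close>

lemma schwinger_dyson:
  assumes N: "N > 0"
  defines "T \<equiv> \<lambda>ws. LINT \<omega>|M. (\<Prod>w\<leftarrow>ws. wtr N (Y \<omega>) w)"
  shows "T ((c # w) # ws) = s *
     ((\<Sum>x\<leftarrow>splits c w. T (fst x # snd x # ws) + T ((fst x @ rev (snd x)) # ws))
    + (\<Sum>z\<leftarrow>picks ws. \<Sum>x\<leftarrow>splits c (fst z).
          T ((w @ snd x @ fst x) # snd z) + T ((w @ rev (snd x @ fst x)) # snd z)))"
proof -
  note ip = integrable_prod_wtr[OF N]
  have ip1: "integrable M (\<lambda>\<omega>. wtr N (Y \<omega>) w * (\<Prod>w\<leftarrow>ws. wtr N (Y \<omega>) w))" for w ws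
    using ip[of "w # ws"] by simp
  have ip2: "integrable M (\<lambda>\<omega>. wtr N (Y \<omega>) w * (wtr N (Y \<omega>) v * (\<Prod>w\<leftarrow>ws. wtr N (Y \<omega>) w)))" for v w ws
    using ip[of "w # v # ws"] by simp
  let ?P = "\<lambda>y. \<Prod>w\<leftarrow>ws. wtr N y w"
  let ?dm = "\<lambda>p q y. s * (\<Sum>x\<leftarrow>splits c w. wmat N y (fst x) q p * wmat N y (snd x) q p
                             + wmat N y (fst x) q q * wmat N y (snd x) p p)"
  let ?dt = "\<lambda>p q y v. s * (\<Sum>x\<leftarrow>splits c v. wmat N y (snd x @ fst x) q p + wmat N y (snd x @ fst x) p q)"
  let ?D = "\<lambda>p q y. ?dm p q y * ?P y + wmat N y w q p * (\<Sum>(v, r)\<leftarrow>picks ws. ?dt p q y v * (\<Prod>w\<leftarrow>r. wtr N y w))"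
  have pd: "poly_deriv s N (c, p, q) (\<lambda>y. wmat N y w q p * ?P y) (?D p q)" if "p < N" "q < N" for p q
    by (intro poly_deriv_mult poly_deriv_prod_list poly_deriv_wmat poly_deriv_wtr that)
  have v: "(c, p, q) \<in> valid_idx N" if "p < N" "q < N" for p q
    using that by (simp add: valid_idx_def)
  note st = stein[OF pd v]
  have "T ((c # w) # ws) = (LINT \<omega>|M. (\<Sum>p<N. \<Sum>q<N. Y \<omega> (c, p, q) * (wmat N (Y \<omega>) w q p * ?P (Y \<omega>))))"
  proof -
    have "wtr N y (c # w) * ?P y = (\<Sum>p<N. \<Sum>q<N. y (c, p, q) * (wmat N y w q p * ?P y))" for y
      unfolding wtr_def[of N y "c # w"] wmat.simps by (simp only: sum_distrib_right mult.assoc)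
    then show ?thesis by (simp add: T_def)
  qed
  also have "\<dots> = (\<Sum>p<N. \<Sum>q<N. LINT \<omega>|M. Y \<omega> (c, p, q) * (wmat N (Y \<omega>) w q p * ?P (Y \<omega>)))"
    by (rule integral_double_sum) (rule st(3))
  also have "\<dots> = (\<Sum>p<N. \<Sum>q<N. LINT \<omega>|M. ?D p q (Y \<omega>))"
    using st(4) by (intro sum.cong refl) auto
  also have "\<dots> = (LINT \<omega>|M. (\<Sum>p<N. \<Sum>q<N. ?D p q (Y \<omega>)))"
    by (rule integral_double_sum[symmetric]) (rule st(2))
  also have "\<dots> = (LINT \<omega>|M. s *
     ((\<Sum>x\<leftarrow>splits c w. wtr N (Y \<omega>) (fst x) * (wtr N (Y \<omega>) (snd x) * ?P (Y \<omega>))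
            + wtr N (Y \<omega>) (fst x @ rev (snd x)) * ?P (Y \<omega>))
    + (\<Sum>z\<leftarrow>picks ws. \<Sum>x\<leftarrow>splits c (fst z).
          wtr N (Y \<omega>) (w @ snd x @ fst x) * (\<Prod>w\<leftarrow>snd z. wtr N (Y \<omega>) w)
        + wtr N (Y \<omega>) (w @ rev (snd x @ fst x)) * (\<Prod>w\<leftarrow>snd z. wtr N (Y \<omega>) w))))"
  proof (rule Bochner_Integration.integral_cong[OF refl])
    fix \<omega> assume "\<omega> \<in> space M"
    define y where "y = Y \<omega>"
    have sy: "sym_family N y" using sym \<open>\<omega> \<in> space M\<close> by (simp add: y_def)
    have tr_rev: "(\<Sum>p<N. \<Sum>q<N. wmat N y u q p * wmat N y v q p) = wtr N y (u @ rev v)" for u v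
    proof -
      have "(\<Sum>p<N. \<Sum>q<N. wmat N y u q p * wmat N y v q p) = (\<Sum>q<N. \<Sum>p<N. wmat N y u q p * wmat N y v q p)"
        by (rule sum.swap)
      also have "\<dots> = wtr N y (u @ rev v)"
        unfolding wtr_def by (intro sum.cong) (auto simp: wmat_append wmat_rev[OF sy])
      finally show ?thesis .
    qed
    have tr_app: "(\<Sum>p<N. \<Sum>q<N. wmat N y u q p * wmat N y v p q) = wtr N y (u @ v)" for u v
    proof -
      have "(\<Sum>p<N. \<Sum>q<N. wmat N y u q p * wmat N y v p q) = (\<Sum>q<N. \<Sum>p<N. wmat N y u q p * wmat N y v p q)"
        by (rule sum.swap)
      also have "\<dots> = wtr N y (u @ v)"
        unfolding wtr_def by (intro sum.cong) (auto simp: wmat_append)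
      finally show ?thesis .
    qed
    have tr_tr: "(\<Sum>p<N. \<Sum>q<N. wmat N y u q q * wmat N y v p p) = wtr N y u * wtr N y v" for u v
      unfolding wtr_def by (simp add: sum_distrib_left[symmetric] sum_distrib_right[symmetric])
    have 1: "(\<Sum>p<N. \<Sum>q<N. ?dm p q y) = s * (\<Sum>x\<leftarrow>splits c w. wtr N y (fst x @ rev (snd x)) + wtr N y (fst x) * wtr N y (snd x))"
      unfolding sum_distrib_left[symmetric] sum_list_sum_swap sum.distrib tr_rev tr_tr ..
    have 2: "(\<Sum>p<N. \<Sum>q<N. wmat N y w q p * (\<Sum>(v, r)\<leftarrow>picks ws. ?dt p q y v * (\<Prod>w\<leftarrow>r. wtr N y w)))
      = (\<Sum>z\<leftarrow>picks ws. s * (\<Sum>x\<leftarrow>splits c (fst z). wtr N y (w @ rev (snd x @ fst x)) + wtr N y (w @ snd x @ fst x))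
             * (\<Prod>w\<leftarrow>snd z. wtr N y w))"
    proof -
      have "(\<Sum>p<N. \<Sum>q<N. wmat N y w q p * (\<Sum>(v, r)\<leftarrow>picks ws. ?dt p q y v * (\<Prod>w\<leftarrow>r. wtr N y w)))
         = (\<Sum>p<N. \<Sum>q<N. \<Sum>z\<leftarrow>picks ws. s * (\<Sum>x\<leftarrow>splits c (fst z). wmat N y w q p * wmat N y (snd x @ fst x) q p
              + wmat N y w q p * wmat N y (snd x @ fst x) p q) * (\<Prod>w\<leftarrow>snd z. wtr N y w))"
        by (simp add: case_prod_unfold sum_list_const_mult[symmetric] sum_list_mult_const[symmetric] algebra_simps)
      also have "\<dots> = (\<Sum>z\<leftarrow>picks ws. s * (\<Sum>x\<leftarrow>splits c (fst z). wtr N y (w @ rev (snd x @ fst x)) + wtr N y (w @ snd x @ fst x))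
             * (\<Prod>w\<leftarrow>snd z. wtr N y w))"
        unfolding sum_list_sum_swap sum_distrib_left[symmetric] sum_distrib_right[symmetric] sum.distrib tr_rev tr_app ..
      finally show ?thesis .
    qed
    have "(\<Sum>p<N. \<Sum>q<N. ?D p q y) = (\<Sum>p<N. \<Sum>q<N. ?dm p q y) * ?P y +
       (\<Sum>p<N. \<Sum>q<N. wmat N y w q p * (\<Sum>(v, r)\<leftarrow>picks ws. ?dt p q y v * (\<Prod>w\<leftarrow>r. wtr N y w)))"
      by (simp add: sum.distrib sum_distrib_right)
    also have "\<dots> = s *
     ((\<Sum>x\<leftarrow>splits c w. wtr N y (fst x) * (wtr N y (snd x) * ?P y)
            + wtr N y (fst x @ rev (snd x)) * ?P y)
    + (\<Sum>z\<leftarrow>picks ws. \<Sum>x\<leftarrow>splits c (fst z).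
          wtr N y (w @ snd x @ fst x) * (\<Prod>w\<leftarrow>snd z. wtr N y w)
        + wtr N y (w @ rev (snd x @ fst x)) * (\<Prod>w\<leftarrow>snd z. wtr N y w)))"
      unfolding 1 2 by (simp add: sum_list_const_mult[symmetric] sum_list_mult_const[symmetric] algebra_simps)
    finally show "(\<Sum>p<N. \<Sum>q<N. ?D p q (Y \<omega>)) = s *
     ((\<Sum>x\<leftarrow>splits c w. wtr N (Y \<omega>) (fst x) * (wtr N (Y \<omega>) (snd x) * ?P (Y \<omega>))
            + wtr N (Y \<omega>) (fst x @ rev (snd x)) * ?P (Y \<omega>))
    + (\<Sum>z\<leftarrow>picks ws. \<Sum>x\<leftarrow>splits c (fst z).
          wtr N (Y \<omega>) (w @ snd x @ fst x) * (\<Prod>w\<leftarrow>snd z. wtr N (Y \<omega>) w)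
        + wtr N (Y \<omega>) (w @ rev (snd x @ fst x)) * (\<Prod>w\<leftarrow>snd z. wtr N (Y \<omega>) w)))"
      unfolding y_def .
  qed
  also have "\<dots> = s *
     ((\<Sum>x\<leftarrow>splits c w. T (fst x # snd x # ws) + T ((fst x @ rev (snd x)) # ws))
    + (\<Sum>z\<leftarrow>picks ws. \<Sum>x\<leftarrow>splits c (fst z).
          T ((w @ snd x @ fst x) # snd z) + T ((w @ rev (snd x @ fst x)) # snd z)))"
    unfolding T_def
    by (simp add: integrable_sum_list ip1 ip2)
  finally show ?thesis .
qed

end

section \<open>Limits of normalized traces\<close>

lemma splits_eq: "(u, v) \<in> set (splits c w) \<Longrightarrow> w = u @ c # v"
  by (induction w arbitrary: u v) (auto split: if_splits)

text \<open>The limit of the normalized trace of a word. Unfolding the recursion, it is the number of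
  non-crossing pairings of equal letters of the word.\<close>

function wlim :: "word \<Rightarrow> real" where
  "wlim [] = 1"
| "wlim (c # w) = (\<Sum>x\<leftarrow>splits c w. wlim (fst x) * wlim (snd x))"
  by pat_completeness auto
termination
  by (relation "Wellfounded.measure length") (auto dest: splits_length)

lemma tendsto_sum_list:
  fixes f :: "'b \<Rightarrow> nat \<Rightarrow> real"
  assumes "\<And>x. x \<in> set xs \<Longrightarrow> (\<lambda>n. f x n) \<longlonglongrightarrow> g x"
  shows "(\<lambda>n. \<Sum>x\<leftarrow>xs. f x n) \<longlonglongrightarrow> (\<Sum>x\<leftarrow>xs. g x)"
  using assms by (induction xs) (auto intro!: tendsto_add)

lemma sum_list_prod:
  fixes f :: "'a \<Rightarrow> real" and g :: "'b \<Rightarrow> real"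
  shows "(\<Sum>x\<leftarrow>xs. \<Sum>y\<leftarrow>ys. f x * g y) = (\<Sum>x\<leftarrow>xs. f x) * (\<Sum>y\<leftarrow>ys. g y)"
  by (simp add: sum_list_const_mult sum_list_mult_const)

text \<open>The normalized trace of a word.\<close>

definition ntr :: "nat \<Rightarrow> (idx \<Rightarrow> real) \<Rightarrow> word \<Rightarrow> real" where
  "ntr N y w = wtr N y w / real N"

lemma prod_list_ntr: "(\<Prod>w\<leftarrow>ws. ntr N y w) = (\<Prod>w\<leftarrow>ws. wtr N y w) / real N ^ length ws"
  by (induction ws) (auto simp: ntr_def)

lemma picks_length: "(f, r) \<in> set (picks xs) \<Longrightarrow> length xs = Suc (length r)"
  by (induction xs arbitrary: f r) auto

lemma picks_sum_list:
  fixes h :: "'a \<Rightarrow> nat"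
  assumes "(f, r) \<in> set (picks xs)"
  shows "sum_list (map h xs) = h f + sum_list (map h r)"
  using assms
proof (induction xs arbitrary: f r)
  case (Cons a xs)
  from Cons.prems consider "f = a" "r = xs" | r' where "r = a # r'" "(f, r') \<in> set (picks xs)"
    by auto
  then show ?case
  proof cases
    case 2
    then show ?thesis using Cons.IH[of f r'] by simp
  qed simp
qed simp

lemma schwinger_dyson_normalized:
  assumes "wick_family M N (1 / real N) Y" "N \<ge> 1"
  defines "E \<equiv> \<lambda>ws. LINT \<omega>|M. (\<Prod>w\<leftarrow>ws. ntr N (Y \<omega>) w)"
  shows "E ((c # w) # ws) =
     (\<Sum>x\<leftarrow>splits c w. E (fst x # snd x # ws) + 1 / real N * E ((fst x @ rev (snd x)) # ws))
    + (\<Sum>z\<leftarrow>picks ws. \<Sum>x\<leftarrow>splits c (fst z).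
          (1 / real N)\<^sup>2 * E ((w @ snd x @ fst x) # snd z) + (1 / real N)\<^sup>2 * E ((w @ rev (snd x @ fst x)) # snd z))"
proof -
  interpret wick_family M N "1 / real N" Y by fact
  define T where "T = (\<lambda>ws. LINT \<omega>|M. (\<Prod>w\<leftarrow>ws. wtr N (Y \<omega>) w))"
  have N: "real N > 0" using assms(2) by simp
  have ET: "E ws = T ws / real N ^ length ws" for ws
    unfolding E_def T_def prod_list_ntr by simp
  let ?n = "real N ^ Suc (length ws)"
  have "E ((c # w) # ws) = 1 / real N *
     ((\<Sum>x\<leftarrow>splits c w. T (fst x # snd x # ws) + T ((fst x @ rev (snd x)) # ws))
    + (\<Sum>z\<leftarrow>picks ws. \<Sum>x\<leftarrow>splits c (fst z).
          T ((w @ snd x @ fst x) # snd z) + T ((w @ rev (snd x @ fst x)) # snd z))) / ?n"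
    using schwinger_dyson[of c w ws] assms(2) unfolding ET T_def by simp
  also have "\<dots> =
     (\<Sum>x\<leftarrow>splits c w. (T (fst x # snd x # ws) + T ((fst x @ rev (snd x)) # ws)) * (1 / real N / ?n))
    + (\<Sum>z\<leftarrow>picks ws. \<Sum>x\<leftarrow>splits c (fst z).
          (T ((w @ snd x @ fst x) # snd z) + T ((w @ rev (snd x @ fst x)) # snd z)) * (1 / real N / ?n))"
    unfolding sum_list_mult_const
  proof -
    have "(p * (a + b)) / q = a * (p / q) + b * (p / q)" for a b p q :: real
      by (simp add: add_divide_distrib distrib_left mult.commute)
    then show "1 / real N * ((\<Sum>x\<leftarrow>splits c w. T (fst x # snd x # ws) + T ((fst x @ rev (snd x)) # ws))
      + (\<Sum>z\<leftarrow>picks ws. \<Sum>x\<leftarrow>splits c (fst z).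
          T ((w @ snd x @ fst x) # snd z) + T ((w @ rev (snd x @ fst x)) # snd z))) / ?n
      = (\<Sum>x\<leftarrow>splits c w. T (fst x # snd x # ws) + T ((fst x @ rev (snd x)) # ws)) * (1 / real N / ?n)
      + (\<Sum>z\<leftarrow>picks ws. \<Sum>x\<leftarrow>splits c (fst z).
          T ((w @ snd x @ fst x) # snd z) + T ((w @ rev (snd x @ fst x)) # snd z)) * (1 / real N / ?n)"
      by blast
  qed
  also have "\<dots> = (\<Sum>x\<leftarrow>splits c w. E (fst x # snd x # ws) + 1 / real N * E ((fst x @ rev (snd x)) # ws))
    + (\<Sum>z\<leftarrow>picks ws. \<Sum>x\<leftarrow>splits c (fst z).
          (1 / real N)\<^sup>2 * E ((w @ snd x @ fst x) # snd z) + (1 / real N)\<^sup>2 * E ((w @ rev (snd x @ fst x)) # snd z))"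
  proof (intro arg_cong2[where f = "(+)"] arg_cong[where f = sum_list] map_cong refl)
    fix x
    show "(T (fst x # snd x # ws) + T ((fst x @ rev (snd x)) # ws)) * (1 / real N / ?n)
       = E (fst x # snd x # ws) + 1 / real N * E ((fst x @ rev (snd x)) # ws)"
      unfolding ET using N by (simp add: field_simps)
  next
    fix z x assume "z \<in> set (picks ws)"
    then have "length ws = Suc (length (snd z))" using picks_length[of "fst z" "snd z" ws] by simp
    then show "(T ((w @ snd x @ fst x) # snd z) + T ((w @ rev (snd x @ fst x)) # snd z)) * (1 / real N / ?n)
      = (1 / real N)\<^sup>2 * E ((w @ snd x @ fst x) # snd z) + (1 / real N)\<^sup>2 * E ((w @ rev (snd x @ fst x)) # snd z)"
      unfolding ET using N by (simp add: field_simps power2_eq_square)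
  qed
  finally show ?thesis .
qed

text \<open>Induction on the total length plus the number of words, which decreases in every term of the
  Schwinger--Dyson equation; only the terms with two split words survive in the limit.\<close>

theorem trace_products_converge:
  assumes "\<And>N. N \<ge> 1 \<Longrightarrow> wick_family M N (1 / real N) (Y N)"
  shows "(\<lambda>N. LINT \<omega>|M. (\<Prod>w\<leftarrow>ws. ntr N (Y N \<omega>) w)) \<longlonglongrightarrow> (\<Prod>w\<leftarrow>ws. wlim w)"
proof (induction "sum_list (map (\<lambda>w. Suc (length w)) ws)" arbitrary: ws rule: less_induct)
  case less
  define E where "E = (\<lambda>N ws. LINT \<omega>|M. (\<Prod>w\<leftarrow>ws. ntr N (Y N \<omega>) w))"
  have IH: "(\<lambda>N. E N vs) \<longlonglongrightarrow> (\<Prod>w\<leftarrow>vs. wlim w)"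
    if "sum_list (map (\<lambda>w. Suc (length w)) vs) < sum_list (map (\<lambda>w. Suc (length w)) ws)" for vs
    unfolding E_def using less that by blast
  have ev: "eventually (\<lambda>N. N \<ge> 1) sequentially" by (rule eventually_ge_at_top)
  have inv: "(\<lambda>N. 1 / real N) \<longlonglongrightarrow> 0" by (rule lim_1_over_n)
  have inv2: "(\<lambda>N. (1 / real N)\<^sup>2) \<longlonglongrightarrow> 0" using tendsto_power[OF inv, of 2] by simp
  have "(\<lambda>N. E N ws) \<longlonglongrightarrow> (\<Prod>w\<leftarrow>ws. wlim w)"
  proof (cases ws)
    case Nil
    have "E N [] = 1" if "N \<ge> 1" for N
    proof -
      interpret wick_family M N "1 / real N" "Y N" using assms that by blast
      show ?thesis by (simp add: E_def prob_space)
    qed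
    then show ?thesis unfolding Nil
      by (intro tendsto_eventually) (auto intro!: eventually_mono[OF ev])
  next
    case (Cons v vs)
    show ?thesis
    proof (cases v)
      case Nil
      have "E N ws = E N vs" if "N \<ge> 1" for N
        unfolding E_def Cons Nil using that by (simp add: ntr_def wtr_def)
      then have "eventually (\<lambda>N. E N vs = E N ws) sequentially"
        by (intro eventually_mono[OF ev]) auto
      moreover have "(\<lambda>N. E N vs) \<longlonglongrightarrow> (\<Prod>w\<leftarrow>vs. wlim w)" by (rule IH) (simp add: Cons)
      ultimately show ?thesis unfolding Cons Nil by (simp add: tendsto_cong)
    next
      case v: (Cons c w)
      define R where "R = (\<lambda>N. 
        (\<Sum>x\<leftarrow>splits c w. E N (fst x # snd x # vs) + 1 / real N * E N ((fst x @ rev (snd x)) # vs))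
      + (\<Sum>z\<leftarrow>picks vs. \<Sum>x\<leftarrow>splits c (fst z).
          (1 / real N)\<^sup>2 * E N ((w @ snd x @ fst x) # snd z) + (1 / real N)\<^sup>2 * E N ((w @ rev (snd x @ fst x)) # snd z)))"
      have sl: "length w = Suc (length (fst x) + length (snd x))" if "x \<in> set (splits c w)" for x c w
        using splits_length[of "fst x" "snd x" c w] that by simp
      have "(\<lambda>N. R N) \<longlonglongrightarrow>
        (\<Sum>x\<leftarrow>splits c w. (\<Prod>w\<leftarrow>fst x # snd x # vs. wlim w) + 0 * (\<Prod>w\<leftarrow>(fst x @ rev (snd x)) # vs. wlim w))
      + (\<Sum>z\<leftarrow>picks vs. \<Sum>x\<leftarrow>splits c (fst z).
          0 * (\<Prod>w\<leftarrow>(w @ snd x @ fst x) # snd z. wlim w) + 0 * (\<Prod>w\<leftarrow>(w @ rev (snd x @ fst x)) # snd z. wlim w))"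
        unfolding R_def
      proof (intro tendsto_add tendsto_sum_list tendsto_mult inv inv2 IH)
        fix x assume x: "x \<in> set (splits c w)"
        show "sum_list (map (\<lambda>w. Suc (length w)) (fst x # snd x # vs)) < sum_list (map (\<lambda>w. Suc (length w)) ws)"
          "sum_list (map (\<lambda>w. Suc (length w)) ((fst x @ rev (snd x)) # vs)) < sum_list (map (\<lambda>w. Suc (length w)) ws)"
          using sl[OF x] by (auto simp: Cons v)
      next
        fix z x assume z: "z \<in> set (picks vs)" and x: "x \<in> set (splits c (fst z))"
        have "sum_list (map (\<lambda>w. Suc (length w)) vs) = Suc (length (fst z)) + sum_list (map (\<lambda>w. Suc (length w)) (snd z))"
          by (rule picks_sum_list) (use z in simp)
        then show "sum_list (map (\<lambda>w. Suc (length w)) ((w @ snd x @ fst x) # snd z)) < sum_list (map (\<lambda>w. Suc (length w)) ws)"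
          "sum_list (map (\<lambda>w. Suc (length w)) ((w @ rev (snd x @ fst x)) # snd z)) < sum_list (map (\<lambda>w. Suc (length w)) ws)"
          using sl[OF x] by (auto simp: Cons v)
      qed
      also have "(\<Sum>x\<leftarrow>splits c w. (\<Prod>w\<leftarrow>fst x # snd x # vs. wlim w) + 0 * (\<Prod>w\<leftarrow>(fst x @ rev (snd x)) # vs. wlim w))
      + (\<Sum>z\<leftarrow>picks vs. \<Sum>x\<leftarrow>splits c (fst z).
          0 * (\<Prod>w\<leftarrow>(w @ snd x @ fst x) # snd z. wlim w) + 0 * (\<Prod>w\<leftarrow>(w @ rev (snd x @ fst x)) # snd z. wlim w))
        = (\<Prod>w\<leftarrow>ws. wlim w)"
        unfolding Cons v by (simp add: sum_list_mult_const[symmetric] mult.assoc)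
      finally have "R \<longlonglongrightarrow> (\<Prod>w\<leftarrow>ws. wlim w)" .
      moreover have "R N = E N ws" if "N \<ge> 1" for N
        unfolding R_def Cons v E_def using schwinger_dyson_normalized[OF assms[OF that] that] by simp
      then have "eventually (\<lambda>N. R N = E N ws) sequentially"
        by (intro eventually_mono[OF ev]) auto
      ultimately show ?thesis by (simp add: tendsto_cong)
    qed
  qed
  then show ?case unfolding E_def .
qed

lemma prod_list_divide_const:
  fixes g :: "'b \<Rightarrow> real"
  shows "(\<Prod>f\<leftarrow>ms. g f / r) = (\<Prod>f\<leftarrow>ms. g f) / r ^ length ms"
  by (induction ms) auto

text \<open>Dividing the matrices by \<open>sqrt N\<close> divides all covariances by \<open>N\<close>.\<close>

lemma GOE_pair_wick_family:
  assumes "prob_space M" "GOE M N A" "GOE M N B" "indep_matrices M N A B" "N \<ge> 1"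
  shows "wick_family M N (1 / real N) (\<lambda>\<omega> e. pair_entry A B e \<omega> / sqrt (real N))"
proof -
  interpret prob_space M by fact
  note W = pair_GOE_wick[OF assms(1-4)]
  let ?r = "sqrt (real N)"
  have r: "?r > 0" "?r * ?r = real N" using assms(5) by auto
  show ?thesis
  proof
    show "integrable M (\<lambda>\<omega>. \<Prod>f\<leftarrow>ms. pair_entry A B f \<omega> / ?r)" if "set ms \<subseteq> valid_idx N" for ms
      unfolding prod_list_divide_const using W(1)[OF that] by simp
    show "sym_family N (\<lambda>e. pair_entry A B e \<omega> / ?r)" if \<omega>: "\<omega> \<in> space M" for \<omega>
    proof -
      have AB: "A \<omega> \<in> carrier_mat N N \<and> transpose_mat (A \<omega>) = A \<omega>"
        "B \<omega> \<in> carrier_mat N N \<and> transpose_mat (B \<omega>) = B \<omega>"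
        using assms(2,3) \<omega> by (auto simp: GOE_def)
      have s: "C $$ (i, j) = C $$ (j, i)" if "C \<in> carrier_mat N N \<and> transpose_mat C = C" "i < N" "j < N"
        for C :: "real mat" and i j
        using that by (metis carrier_matD index_transpose_mat(1))
      show ?thesis unfolding sym_family_def using s[OF AB(1)] s[OF AB(2)] by auto
    qed
    fix e ms assume e: "e \<in> valid_idx N" and ms: "set ms \<subseteq> valid_idx N"
    have "(LINT \<omega>|M. pair_entry A B e \<omega> / ?r * (\<Prod>f\<leftarrow>ms. pair_entry A B f \<omega> / ?r))
       = (LINT \<omega>|M. pair_entry A B e \<omega> * (\<Prod>f\<leftarrow>ms. pair_entry A B f \<omega>)) / ?r ^ Suc (length ms)"
      unfolding prod_list_divide_const by (simp add: mult.commute)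
    also have "\<dots> = (\<Sum>x\<leftarrow>picks ms. idx_cov e (fst x) * (LINT \<omega>|M. (\<Prod>g\<leftarrow>snd x. pair_entry A B g \<omega>)) / ?r ^ Suc (length ms))"
      unfolding W(2)[OF e ms] by (simp add: case_prod_unfold divide_inverse sum_list_mult_const)
    also have "\<dots> = (\<Sum>x\<leftarrow>picks ms. 1 / real N * idx_cov e (fst x) * (LINT \<omega>|M. (\<Prod>g\<leftarrow>snd x. pair_entry A B g \<omega> / ?r)))"
    proof (intro arg_cong[where f = sum_list] map_cong refl)
      fix x assume "x \<in> set (picks ms)"
      then have l: "length ms = Suc (length (snd x))" using picks_length[of "fst x" "snd x" ms] by simp
      have "?r ^ Suc (length ms) = real N * ?r ^ length (snd x)"
        unfolding l power_Suc mult.assoc[symmetric] r(2) ..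
      then show "idx_cov e (fst x) * (LINT \<omega>|M. (\<Prod>g\<leftarrow>snd x. pair_entry A B g \<omega>)) / ?r ^ Suc (length ms)
        = 1 / real N * idx_cov e (fst x) * (LINT \<omega>|M. (\<Prod>g\<leftarrow>snd x. pair_entry A B g \<omega> / ?r))"
        unfolding prod_list_divide_const by simp
    qed
    finally show "(LINT \<omega>|M. pair_entry A B e \<omega> / ?r * (\<Prod>f\<leftarrow>ms. pair_entry A B f \<omega> / ?r))
      = (\<Sum>(f, r)\<leftarrow>picks ms. 1 / real N * idx_cov e f * (LINT \<omega>|M. (\<Prod>g\<leftarrow>r. pair_entry A B g \<omega> / ?r)))"
      by (simp add: case_prod_unfold)
  qed
qed

text \<open>Convergence in probability of a linear combination of normalized traces, by Markov's inequality for its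
  squared distance from the limit: the first and second moments converge by
  \<open>trace_products_converge\<close>.\<close>

theorem linear_statistic_in_probability:
  fixes L :: "(real \<times> word) list"
  assumes wf: "\<And>N. N \<ge> 1 \<Longrightarrow> wick_family M N (1 / real N) (Y N)" and \<eta>: "\<eta> > 0"
  defines "U \<equiv> \<lambda>N \<omega>. \<Sum>x\<leftarrow>L. fst x * ntr N (Y N \<omega>) (snd x)"
    and "z \<equiv> \<Sum>x\<leftarrow>L. fst x * wlim (snd x)"
  shows linear_statistic_measurable: "N \<ge> 1 \<Longrightarrow> {\<omega> \<in> space M. \<eta> \<le> \<bar>U N \<omega> - z\<bar>} \<in> sets M"
    and linear_statistic_converges: "(\<lambda>N. measure M {\<omega> \<in> space M. \<eta> \<le> \<bar>U N \<omega> - z\<bar>}) \<longlonglongrightarrow> 0"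
proof -
  define E1 where "E1 = (\<lambda>N. \<Sum>x\<leftarrow>L. fst x * (LINT \<omega>|M. (\<Prod>w\<leftarrow>[snd x]. ntr N (Y N \<omega>) w)))"
  define E2 where "E2 = (\<lambda>N. \<Sum>x\<leftarrow>L. \<Sum>x'\<leftarrow>L. (fst x * fst x') * (LINT \<omega>|M. (\<Prod>w\<leftarrow>[snd x, snd x']. ntr N (Y N \<omega>) w)))"
  have sq: "(U N \<omega> - z)\<^sup>2 = (\<Sum>x\<leftarrow>L. \<Sum>x'\<leftarrow>L. (fst x * fst x') * (\<Prod>w\<leftarrow>[snd x, snd x']. ntr N (Y N \<omega>) w)) - 2 * z * U N \<omega> + z\<^sup>2" for N \<omega>
  proof -
    have "U N \<omega> * U N \<omega> = (\<Sum>x\<leftarrow>L. \<Sum>x'\<leftarrow>L. (fst x * ntr N (Y N \<omega>) (snd x)) * (fst x' * ntr N (Y N \<omega>) (snd x')))"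
      unfolding sum_list_prod U_def ..
    also have "\<dots> = (\<Sum>x\<leftarrow>L. \<Sum>x'\<leftarrow>L. (fst x * fst x') * (\<Prod>w\<leftarrow>[snd x, snd x']. ntr N (Y N \<omega>) w))"
      by (simp add: mult_ac)
    finally have "U N \<omega> * U N \<omega> = (\<Sum>x\<leftarrow>L. \<Sum>x'\<leftarrow>L. (fst x * fst x') * (\<Prod>w\<leftarrow>[snd x, snd x']. ntr N (Y N \<omega>) w))" .
    moreover have "(U N \<omega> - z)\<^sup>2 = U N \<omega> * U N \<omega> - 2 * z * U N \<omega> + z\<^sup>2"
      by (simp add: power2_eq_square algebra_simps)
    ultimately show ?thesis by (simp only:)
  qed
  have main: "integrable M (U N) \<and> integrable M (\<lambda>\<omega>. (U N \<omega> - z)\<^sup>2) \<and>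
      (LINT \<omega>|M. (U N \<omega> - z)\<^sup>2) = E2 N - 2 * z * E1 N + z\<^sup>2" if N: "N \<ge> 1" for N
  proof -
    interpret wick_family M N "1 / real N" "Y N" using wf N by blast
    have ip: "integrable M (\<lambda>\<omega>. \<Prod>w\<leftarrow>ws. ntr N (Y N \<omega>) w)" for ws
      unfolding prod_list_ntr using integrable_prod_wtr[of ws] N by simp
    have i1: "integrable M (U N)" and e1: "(LINT \<omega>|M. U N \<omega>) = E1 N"
      unfolding U_def E1_def using ip[of "[_]"] by (simp_all add: integrable_sum_list)
    have i2: "integrable M (\<lambda>\<omega>. \<Sum>x\<leftarrow>L. \<Sum>x'\<leftarrow>L. (fst x * fst x') * (\<Prod>w\<leftarrow>[snd x, snd x']. ntr N (Y N \<omega>) w))"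
      by (intro integrable_sum_list integrable_mult_right ip)
    have e2: "(LINT \<omega>|M. (\<Sum>x\<leftarrow>L. \<Sum>x'\<leftarrow>L. (fst x * fst x') * (\<Prod>w\<leftarrow>[snd x, snd x']. ntr N (Y N \<omega>) w))) = E2 N"
      unfolding E2_def
      by (simp only: integrable_sum_list integrable_mult_right ip integral_mult_right_zero)
    show ?thesis unfolding sq using i1 i2 e1 e2 by (simp add: prob_space)
  qed
  show meas: "{\<omega> \<in> space M. \<eta> \<le> \<bar>U N \<omega> - z\<bar>} \<in> sets M" if "N \<ge> 1" for N
  proof -
    have [measurable]: "U N \<in> borel_measurable M" using main[OF that] by auto
    show ?thesis by measurable
  qed
  have "(\<lambda>N. E2 N - 2 * z * E1 N + z\<^sup>2) \<longlonglongrightarrow>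
     (\<Sum>x\<leftarrow>L. \<Sum>x'\<leftarrow>L. (fst x * fst x') * (\<Prod>w\<leftarrow>[snd x, snd x']. wlim w))
      - 2 * z * (\<Sum>x\<leftarrow>L. fst x * (\<Prod>w\<leftarrow>[snd x]. wlim w)) + z\<^sup>2"
    unfolding E1_def E2_def
    by (intro tendsto_intros tendsto_sum_list trace_products_converge wf)
  also have "(\<Sum>x\<leftarrow>L. \<Sum>x'\<leftarrow>L. (fst x * fst x') * (\<Prod>w\<leftarrow>[snd x, snd x']. wlim w)) = z * z"
  proof -
    have "z * z = (\<Sum>x\<leftarrow>L. \<Sum>x'\<leftarrow>L. (fst x * wlim (snd x)) * (fst x' * wlim (snd x')))"
      unfolding sum_list_prod z_def ..
    then show ?thesis by (simp add: mult_ac)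
  qed
  also have "(\<Sum>x\<leftarrow>L. fst x * (\<Prod>w\<leftarrow>[snd x]. wlim w)) = z" by (simp add: z_def)
  finally have "(\<lambda>N. E2 N - 2 * z * E1 N + z\<^sup>2) \<longlonglongrightarrow> 0" by (simp add: power2_eq_square)
  then have lim: "(\<lambda>N. (E2 N - 2 * z * E1 N + z\<^sup>2) / \<eta>\<^sup>2) \<longlonglongrightarrow> 0"
    using tendsto_divide[OF _ tendsto_const[of "\<eta>\<^sup>2"]] \<eta> by fastforce
  have bound: "measure M {\<omega> \<in> space M. \<eta> \<le> \<bar>U N \<omega> - z\<bar>} \<le> (E2 N - 2 * z * E1 N + z\<^sup>2) / \<eta>\<^sup>2" if N: "N \<ge> 1" for N
  proof -
    have "{\<omega> \<in> space M. \<eta> \<le> \<bar>U N \<omega> - z\<bar>} = {\<omega> \<in> space M. \<eta>\<^sup>2 \<le> (U N \<omega> - z)\<^sup>2}"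
      using \<eta> abs_le_square_iff[of \<eta>] by auto
    also have "measure M \<dots> \<le> (LINT \<omega>|M. (U N \<omega> - z)\<^sup>2) / \<eta>\<^sup>2"
      by (rule integral_Markov_inequality_measure[of _ _ "{}"]) (use main[OF N] \<eta> in auto)
    finally show ?thesis using main[OF N] by simp
  qed
  show "(\<lambda>N. measure M {\<omega> \<in> space M. \<eta> \<le> \<bar>U N \<omega> - z\<bar>}) \<longlonglongrightarrow> 0"
    by (rule tendsto_sandwich[OF _ _ tendsto_const lim])
       (auto intro!: always_eventually eventually_mono[OF eventually_ge_at_top[of 1]] bound)
qed

section \<open>Limit moments of the anticommutator\<close>

text \<open>The words in the expansion of the \<open>k\<close>-th power of the anticommutator.\<close>

fun acw :: "nat \<Rightarrow> word list" where
  "acw 0 = [[]]"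
| "acw (Suc k) = concat (map (\<lambda>w. [True # False # w, False # True # w]) (acw k))"

lemma sum_acw_Suc:
  fixes f :: "word \<Rightarrow> real"
  shows "(\<Sum>w\<leftarrow>acw (Suc k). f w) = (\<Sum>w\<leftarrow>acw k. f (c # (\<not> c) # w) + f ((\<not> c) # c # w))"
proof -
  have *: "(\<Sum>w\<leftarrow>concat (map (\<lambda>w. [True # False # w, False # True # w]) ws). f w)
      = (\<Sum>w\<leftarrow>ws. f (c # (\<not> c) # w) + f ((\<not> c) # c # w))" for ws
    by (induction ws; cases c) simp_all
  show ?thesis by (simp only: acw.simps *)
qed

text \<open>Cutting a word of the \<open>k\<close>-th power at a letter \<open>c\<close> removes one factor of the power: the
  other letter of this factor stays with the right or with the left part.\<close>

lemma sum_splits_acw: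
  fixes F :: "word \<Rightarrow> word \<Rightarrow> real"
  shows "(\<Sum>w\<leftarrow>acw k. \<Sum>x\<leftarrow>splits c w. F (fst x) (snd x))
     = (\<Sum>j<k. \<Sum>w1\<leftarrow>acw j. \<Sum>w2\<leftarrow>acw (k - 1 - j). F w1 ((\<not> c) # w2) + F (w1 @ [\<not> c]) w2)"
proof (induction k arbitrary: F)
  case (Suc k)
  let ?F = "\<lambda>u v. F (c # (\<not> c) # u) v + F ((\<not> c) # c # u) v"
  let ?G = "\<lambda>w1 w2. F w1 ((\<not> c) # w2) + F (w1 @ [\<not> c]) w2"
  have nc: "(\<not> c) \<noteq> c" "c \<noteq> (\<not> c)" by auto
  have "(\<Sum>w\<leftarrow>acw (Suc k). \<Sum>x\<leftarrow>splits c w. F (fst x) (snd x))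
      = (\<Sum>w\<leftarrow>acw k. ?G [] w + (\<Sum>x\<leftarrow>splits c w. ?F (fst x) (snd x)))"
    unfolding sum_acw_Suc[where c = c]
    by (simp add: case_prod_unfold comp_def sum_list_addf nc algebra_simps)
  also have "\<dots> = (\<Sum>w\<leftarrow>acw k. ?G [] w) + (\<Sum>w\<leftarrow>acw k. \<Sum>x\<leftarrow>splits c w. ?F (fst x) (snd x))"
    by (simp only: sum_list_addf)
  also have "(\<Sum>w\<leftarrow>acw k. \<Sum>x\<leftarrow>splits c w. ?F (fst x) (snd x))
      = (\<Sum>j<k. \<Sum>w1\<leftarrow>acw j. \<Sum>w2\<leftarrow>acw (k - 1 - j). ?F w1 ((\<not> c) # w2) + ?F (w1 @ [\<not> c]) w2)"
    by (rule Suc.IH)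
  also have "\<dots> = (\<Sum>j<k. \<Sum>w1\<leftarrow>acw (Suc j). \<Sum>w2\<leftarrow>acw (k - 1 - j). ?G w1 w2)"
    unfolding sum_acw_Suc[where c = c] by (simp add: sum_list_addf algebra_simps)
  also have "(\<Sum>w\<leftarrow>acw k. ?G [] w) + \<dots> = (\<Sum>j<Suc k. \<Sum>w1\<leftarrow>acw j. \<Sum>w2\<leftarrow>acw (Suc k - 1 - j). ?G w1 w2)"
    unfolding sum.lessThan_Suc_shift by simp
  finally show ?case .
qed simp

lemma wlim_odd: "odd (count_list w c) \<Longrightarrow> wlim w = 0"
proof (induction w rule: length_induct)
  case (1 w)
  show ?case
  proof (cases w)
    case Nil
    then show ?thesis using 1 by simp
  next
    case (Cons d v)
    have "wlim (fst x) * wlim (snd x) = 0" if x: "x \<in> set (splits d v)" for x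
    proof -
      have v: "v = fst x @ d # snd x" using splits_eq[of "fst x" "snd x" d v] x by simp
      then have "odd (count_list (fst x) c) \<or> odd (count_list (snd x) c)"
        using 1(2) Cons by (auto split: if_splits)
      moreover have "length (fst x) < length w" "length (snd x) < length w" using v Cons by auto
      ultimately show ?thesis using 1(1) by auto
    qed
    then have "(\<Sum>x\<leftarrow>splits d v. wlim (fst x) * wlim (snd x)) = (\<Sum>x\<leftarrow>splits d v. 0)"
      by (intro arg_cong[where f = sum_list] map_cong) auto
    then show ?thesis by (simp add: Cons)
  qed
qed

lemma count_acw: "w \<in> set (acw k) \<Longrightarrow> count_list w c = k"
  by (induction k arbitrary: w) auto

text \<open>Attaching one letter to a word of the expansion makes the multiplicity of one of the two letters odd.\<close>

lemma wlim_acw_odd: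
  assumes "w \<in> set (acw k)"
  shows "wlim (d # w) = 0" "wlim (w @ [d]) = 0"
proof -
  have "odd (count_list (d # w) d) \<or> odd (count_list (d # w) (\<not> d))"
    using count_acw[OF assms] by auto
  then show "wlim (d # w) = 0" using wlim_odd by blast
  have "odd (count_list (w @ [d]) d) \<or> odd (count_list (w @ [d]) (\<not> d))"
    using count_acw[OF assms] by auto
  then show "wlim (w @ [d]) = 0" using wlim_odd by blast
qed

lemma splits_append:
  "splits c (u @ v) = map (\<lambda>x. (fst x, snd x @ v)) (splits c u) @ map (\<lambda>x. (u @ fst x, snd x)) (splits c v)"
  by (induction u) (auto simp: case_prod_unfold comp_def)

text \<open>The limit moments of the anticommutator.\<close>

definition acm :: "nat \<Rightarrow> real" where
  "acm k = (\<Sum>w\<leftarrow>acw k. wlim w)"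

text \<open>Auxiliary limits: the words of the expansion between two equal letters, and between two different letters.\<close>

definition acs :: "bool \<Rightarrow> nat \<Rightarrow> real" where
  "acs c k = (\<Sum>w\<leftarrow>acw k. wlim (c # w @ [c]))"

definition acr :: "bool \<Rightarrow> nat \<Rightarrow> real" where
  "acr c k = (\<Sum>w\<leftarrow>acw k. wlim (c # w @ [\<not> c]))"

lemma acs_rec: "acs c k = acm k + (\<Sum>j<k. acm j * acr (\<not> c) (k - 1 - j))"
proof -
  have "acs c k = (\<Sum>w\<leftarrow>acw k. wlim w + (\<Sum>x\<leftarrow>splits c w. wlim (fst x) * wlim (snd x @ [c])))"
    unfolding acs_def by (simp add: splits_append comp_def add.commute)
  also have "\<dots> = acm k + (\<Sum>w\<leftarrow>acw k. \<Sum>x\<leftarrow>splits c w. wlim (fst x) * wlim (snd x @ [c]))"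
    by (simp add: sum_list_addf acm_def)
  also have "(\<Sum>w\<leftarrow>acw k. \<Sum>x\<leftarrow>splits c w. wlim (fst x) * wlim (snd x @ [c]))
     = (\<Sum>j<k. \<Sum>w1\<leftarrow>acw j. \<Sum>w2\<leftarrow>acw (k - 1 - j).
          wlim w1 * wlim (((\<not> c) # w2) @ [c]) + wlim (w1 @ [\<not> c]) * wlim (w2 @ [c]))"
    by (rule sum_splits_acw)
  also have "\<dots> = (\<Sum>j<k. \<Sum>w1\<leftarrow>acw j. \<Sum>w2\<leftarrow>acw (k - 1 - j). wlim w1 * wlim ((\<not> c) # w2 @ [c]))"
    by (intro sum.cong refl arg_cong[where f = sum_list] map_cong) (simp add: wlim_acw_odd del: wlim.simps)
  also have "\<dots> = (\<Sum>j<k. acm j * acr (\<not> c) (k - 1 - j))"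
    unfolding sum_list_prod by (simp add: acm_def acr_def)
  finally show ?thesis .
qed

lemma acr_rec: "acr c k = (\<Sum>j<k. acm j * acs (\<not> c) (k - 1 - j))"
proof -
  have nc: "c \<noteq> (\<not> c)" by auto
  have "acr c k = (\<Sum>w\<leftarrow>acw k. \<Sum>x\<leftarrow>splits c w. wlim (fst x) * wlim (snd x @ [\<not> c]))"
    unfolding acr_def by (simp add: splits_append comp_def nc)
  also have "\<dots> = (\<Sum>j<k. \<Sum>w1\<leftarrow>acw j. \<Sum>w2\<leftarrow>acw (k - 1 - j).
          wlim w1 * wlim (((\<not> c) # w2) @ [\<not> c]) + wlim (w1 @ [\<not> c]) * wlim (w2 @ [\<not> c]))"
    by (rule sum_splits_acw)
  also have "\<dots> = (\<Sum>j<k. \<Sum>w1\<leftarrow>acw j. \<Sum>w2\<leftarrow>acw (k - 1 - j). wlim w1 * wlim ((\<not> c) # w2 @ [\<not> c]))"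
    by (intro sum.cong refl arg_cong[where f = sum_list] map_cong) (simp add: wlim_acw_odd del: wlim.simps)
  also have "\<dots> = (\<Sum>j<k. acm j * acs (\<not> c) (k - 1 - j))"
    unfolding sum_list_prod by (simp add: acm_def acs_def)
  finally show ?thesis .
qed

lemma acm_0: "acm 0 = 1" by (simp add: acm_def)

lemma acm_Suc: "acm (Suc k) = (\<Sum>j<k. acs True j * acm (k - 1 - j)) + (\<Sum>j<k. acs False j * acm (k - 1 - j))"
proof -
  have h: "(\<Sum>w\<leftarrow>acw k. wlim (c # (\<not> c) # w)) = (\<Sum>j<k. acs (\<not> c) j * acm (k - 1 - j))" for c
  proof -
    have nc: "c \<noteq> (\<not> c)" by auto
    have "(\<Sum>w\<leftarrow>acw k. wlim (c # (\<not> c) # w))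
        = (\<Sum>w\<leftarrow>acw k. \<Sum>x\<leftarrow>splits c w. wlim ((\<not> c) # fst x) * wlim (snd x))"
      by (subst wlim.simps(2)[of c]) (simp add: nc case_prod_unfold comp_def del: wlim.simps)
    also have "\<dots> = (\<Sum>j<k. \<Sum>w1\<leftarrow>acw j. \<Sum>w2\<leftarrow>acw (k - 1 - j).
          wlim ((\<not> c) # w1) * wlim ((\<not> c) # w2) + wlim ((\<not> c) # w1 @ [\<not> c]) * wlim w2)"
      by (rule sum_splits_acw)
    also have "\<dots> = (\<Sum>j<k. \<Sum>w1\<leftarrow>acw j. \<Sum>w2\<leftarrow>acw (k - 1 - j). wlim ((\<not> c) # w1 @ [\<not> c]) * wlim w2)"
      by (intro sum.cong refl arg_cong[where f = sum_list] map_cong) (simp add: wlim_acw_odd del: wlim.simps)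
    also have "\<dots> = (\<Sum>j<k. acs (\<not> c) j * acm (k - 1 - j))"
      unfolding sum_list_prod by (simp add: acm_def acs_def)
    finally show ?thesis .
  qed
  have "acm (Suc k) = (\<Sum>w\<leftarrow>acw k. wlim (False # (\<not> False) # w)) + (\<Sum>w\<leftarrow>acw k. wlim (True # (\<not> True) # w))"
    unfolding acm_def sum_acw_Suc[where c = False] by (simp add: sum_list_addf del: wlim.simps)
  then show ?thesis unfolding h by simp
qed

lemma fps_X_mult_conv:
  fixes a b :: "nat \<Rightarrow> real"
  shows "fps_nth (fps_X * (Abs_fps a * Abs_fps b)) k = (\<Sum>j<k. a j * b (k - 1 - j))"
proof (cases k)
  case (Suc n)
  then show ?thesis
    by (subst fps_X_mult_nth) (simp add: fps_mult_nth atLeast0AtMost lessThan_Suc_atMost)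
qed simp

text \<open>The series \<open>S c\<close> and \<open>R c\<close> of the auxiliary limits satisfy \<open>S c = F + X F R d\<close> and \<open>R d = X F S c\<close>
  for the letter \<open>d\<close> other than \<open>c\<close>, and \<open>F = 1 + X^2 F (S c + S d)\<close>; eliminating \<open>S\<close> and \<open>R\<close>
  leaves the cubic.\<close>

theorem acm_fps:
  defines "F \<equiv> Abs_fps acm"
  shows "F = 1 + fps_X ^ 2 * F ^ 2 * (F + 1)"
proof -
  define S where "S = (\<lambda>c. Abs_fps (acs c))"
  define R where "R = (\<lambda>c. Abs_fps (acr c))"
  have S: "S c = F + fps_X * (F * R (\<not> c))" for c
    unfolding S_def F_def R_def by (rule fps_ext) (simp add: fps_X_mult_conv acs_rec del: fps_X_mult_nth)
  have R: "R c = fps_X * (F * S (\<not> c))" for c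
    unfolding S_def F_def R_def by (rule fps_ext) (simp add: fps_X_mult_conv acr_rec del: fps_X_mult_nth)
  have F: "F = 1 + fps_X * (fps_X * (S True * F) + fps_X * (S False * F))"
  proof (rule fps_ext)
    fix n
    show "fps_nth F n = fps_nth (1 + fps_X * (fps_X * (S True * F) + fps_X * (S False * F))) n"
    proof (cases n)
      case 0
      then show ?thesis by (simp add: F_def acm_0)
    next
      case (Suc k)
      have "fps_nth (1 + fps_X * (fps_X * (S True * F) + fps_X * (S False * F))) (Suc k)
         = fps_nth (fps_X * (S True * F)) k + fps_nth (fps_X * (S False * F)) k" by simp
      also have "\<dots> = acm (Suc k)"
        unfolding S_def F_def fps_X_mult_conv acm_Suc ..
      finally show ?thesis using Suc by (simp add: F_def)
    qed
  qed
  have S2: "S c * (1 - fps_X^2 * F^2) = F" for c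
    using S[of c] R[of "\<not> c"] by (simp add: algebra_simps power2_eq_square)
  have "F * (1 - fps_X^2 * F^2) = (1 - fps_X^2 * F^2) +
      fps_X^2 * F * (S True * (1 - fps_X^2 * F^2) + S False * (1 - fps_X^2 * F^2))"
    by (subst (1) F) (simp add: algebra_simps power2_eq_square)
  then have "F * (1 - fps_X^2 * F^2) = (1 - fps_X^2 * F^2) + fps_X^2 * F * (F + F)"
    unfolding S2 .
  then show ?thesis by (simp add: algebra_simps power2_eq_square)
qed

lemma fps_cubic_unique:
  fixes F G :: "'a::{idom} fps"
  assumes F: "F = 1 + fps_X ^ 2 * F ^ 2 * (F + 1)" and G: "G = 1 + fps_X ^ 2 * G ^ 2 * (G + 1)"
  shows "F = G"
proof -
  let ?H = "fps_X ^ 2 * (F^2 + F * G + G^2 + F + G)"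
  have "F - G = fps_X ^ 2 * F ^ 2 * (F + 1) - fps_X ^ 2 * G ^ 2 * (G + 1)"
    using F G by (metis add_diff_cancel_left)
  also have "\<dots> = ?H * (F - G)" by (simp add: algebra_simps power2_eq_square)
  finally have "(F - G) * (1 - ?H) = 0" by (simp add: algebra_simps)
  moreover have "fps_nth (1 - ?H) 0 = 1" by simp
  then have "1 - ?H \<noteq> 0" by (metis fps_zero_nth zero_neq_one)
  ultimately show ?thesis by simp
qed

section \<open>Eigenvalues of the anticommutator and traces of words\<close>

lemma map_poly_of_real_mult:
  "map_poly complex_of_real (p * q) = map_poly complex_of_real p * map_poly complex_of_real q"
  by (rule poly_eqI) (simp add: coeff_map_poly coeff_mult)

lemma map_poly_of_real_linear_factors:
  "map_poly complex_of_real (\<Prod>e\<leftarrow>es. [:- e, 1:]) = (\<Prod>e\<leftarrow>es. [:- complex_of_real e, 1:])"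
proof (induction es)
  case (Cons e es)
  have "map_poly complex_of_real [:- e, 1:] = [:- complex_of_real e, 1:]"
    by (simp add: map_poly_pCons)
  then show ?case using Cons by (simp only: list.map prod_list.Cons map_poly_of_real_mult)
qed simp

lemma map_poly_of_real_inject:
  "map_poly complex_of_real p = map_poly complex_of_real q \<Longrightarrow> p = q"
  by (metis (no_types, lifting) coeff_map_poly of_real_0 of_real_eq_iff poly_eqI)

text \<open>The usual argument: the Hermitian form of a real symmetric matrix takes real values.\<close>

lemma symmetric_eigenvalue_real:
  fixes C :: "real mat"
  assumes C: "C \<in> carrier_mat n n" "transpose_mat C = C"
    and ev: "eigenvalue (map_mat complex_of_real C) a"
  shows "a = of_real (Re a)"
proof -
  let ?C = "map_mat complex_of_real C"
  have Cc: "?C \<in> carrier_mat n n" using C by simp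
  obtain v where v: "v \<in> carrier_vec n" "v \<noteq> 0\<^sub>v n" "?C *\<^sub>v v = a \<cdot>\<^sub>v v"
    using ev C unfolding eigenvalue_def eigenvector_def by auto
  define T where "T = (\<Sum>i<n. v $ i * cnj (v $ i))"
  define S where "S = (\<Sum>i<n. \<Sum>j<n. complex_of_real (C $$ (i, j)) * v $ j * cnj (v $ i))"
  have sym: "C $$ (i, j) = C $$ (j, i)" if "i < n" "j < n" for i j
    using C that by (metis carrier_matD index_transpose_mat(1))
  have row: "(\<Sum>j<n. complex_of_real (C $$ (i, j)) * v $ j) = a * v $ i" if "i < n" for i
  proof -
    have "(?C *\<^sub>v v) $ i = (\<Sum>j<n. complex_of_real (C $$ (i, j)) * v $ j)"
      using that C v(1) by (simp add: scalar_prod_def atLeast0LessThan)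
    then show ?thesis using v(1,3) that by simp
  qed
  have "S = (\<Sum>i<n. (a * v $ i) * cnj (v $ i))"
    unfolding S_def sum_distrib_right[symmetric] by (intro sum.cong) (auto simp: row)
  then have ST: "S = a * T"
    by (simp add: T_def sum_distrib_left mult.assoc)
  have "cnj S = (\<Sum>i<n. \<Sum>j<n. complex_of_real (C $$ (i, j)) * cnj (v $ j) * v $ i)"
    by (simp add: S_def)
  also have "\<dots> = (\<Sum>j<n. \<Sum>i<n. complex_of_real (C $$ (i, j)) * cnj (v $ j) * v $ i)"
    by (rule sum.swap)
  also have "\<dots> = S" unfolding S_def
    by (intro sum.cong refl) (auto simp: sym mult_ac)
  finally have cS: "cnj S = S" .
  have Tr: "T = of_real (\<Sum>i<n. (norm (v $ i))\<^sup>2)"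
    unfolding T_def by (simp only: of_real_sum complex_norm_square)
  obtain i where i: "i < n" "v $ i \<noteq> 0"
    using v(1,2) by (metis carrier_vecD eq_vecI index_zero_vec)
  have "(\<Sum>i<n. (norm (v $ i))\<^sup>2) > 0"
    by (rule sum_pos2[of _ i]) (use i in auto)
  then have T0: "T \<noteq> 0" unfolding Tr by (metis less_irrefl of_real_eq_0_iff)
  have "cnj a * T = a * T" using cS unfolding ST by (simp add: Tr)
  then have "cnj a = a" using T0 by simp
  then show ?thesis by (metis Reals_cnj_iff complex_is_Real_iff of_real_Re)
qed

lemma symmetric_char_poly_splits:
  fixes C :: "real mat"
  assumes C: "C \<in> carrier_mat n n" "transpose_mat C = C"
  obtains es where "char_poly C = (\<Prod>e\<leftarrow>es. [:- e, 1:])" "length es = n"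
proof -
  let ?C = "map_mat complex_of_real C"
  have Cc: "?C \<in> carrier_mat n n" using C by simp
  obtain as where as: "char_poly ?C = (\<Prod>a\<leftarrow>as. [:- a, 1:])" "length as = n"
    using char_poly_factorized[OF Cc] by blast
  have "a = of_real (Re a)" if "a \<in> set as" for a
  proof -
    have "poly (char_poly ?C) a = 0" unfolding as(1) using that by (induction as) auto
    then have "eigenvalue ?C a" using eigenvalue_root_char_poly[OF Cc] by simp
    then show ?thesis by (rule symmetric_eigenvalue_real[OF C])
  qed
  then have "as = map (\<lambda>a. of_real (Re a)) as" by (simp add: map_idI[symmetric])
  then have "char_poly ?C = (\<Prod>e\<leftarrow>map Re as. [:- complex_of_real e, 1:])"
    unfolding as(1) by (metis (no_types, lifting) list.map_comp comp_def map_eq_conv)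
  then have "map_poly complex_of_real (char_poly C) = map_poly complex_of_real (\<Prod>e\<leftarrow>map Re as. [:- e, 1:])"
    unfolding map_poly_of_real_linear_factors using of_real_hom.char_poly_hom[OF C(1)] by metis
  then show ?thesis using map_poly_of_real_inject as(2) that[of "map Re as"] by simp
qed

text \<open>The trace of a square matrix of size \<open>n\<close>.\<close>

definition mtr :: "nat \<Rightarrow> real mat \<Rightarrow> real" where
  "mtr n X = (\<Sum>i<n. X $$ (i, i))"

lemma mtr_commute:
  assumes "X \<in> carrier_mat n n" "Z \<in> carrier_mat n n"
  shows "mtr n (X * Z) = mtr n (Z * X)"
proof -
  have "mtr n (X * Z) = (\<Sum>i<n. \<Sum>j<n. X $$ (i, j) * Z $$ (j, i))"
    unfolding mtr_def using assms by (intro sum.cong) (auto simp: scalar_prod_def atLeast0LessThan)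
  also have "\<dots> = (\<Sum>j<n. \<Sum>i<n. X $$ (i, j) * Z $$ (j, i))" by (rule sum.swap)
  also have "\<dots> = mtr n (Z * X)"
    unfolding mtr_def using assms by (intro sum.cong) (auto simp: scalar_prod_def atLeast0LessThan mult.commute)
  finally show ?thesis .
qed

lemma upper_triangular_pow:
  fixes T :: "real mat"
  assumes T: "T \<in> carrier_mat n n" "upper_triangular T"
  shows "\<forall>i<n. \<forall>j<n. (j < i \<longrightarrow> (T ^\<^sub>m k) $$ (i, j) = 0) \<and> (T ^\<^sub>m k) $$ (i, i) = (T $$ (i, i)) ^ k"
proof (induction k)
  case 0
  then show ?case using T by auto
next
  case (Suc k)
  have c: "T ^\<^sub>m k \<in> carrier_mat n n" using T(1) by (rule pow_carrier_mat)
  have T0: "T $$ (i, j) = 0" if "j < i" "i < n" for i j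
    using upper_triangularD[OF T(2), of j i] that T(1) by auto
  have e: "(T ^\<^sub>m Suc k) $$ (i, j) = (\<Sum>l<n. (T ^\<^sub>m k) $$ (i, l) * T $$ (l, j))" if "i < n" "j < n" for i j
    using that T(1) c by (simp add: scalar_prod_def atLeast0LessThan)
  show ?case
  proof (intro allI impI conjI)
    fix i j assume ij: "i < n" "j < n" "j < i"
    have "(T ^\<^sub>m k) $$ (i, l) * T $$ (l, j) = 0" if "l < n" for l
      by (cases "l < i") (use Suc ij that T0 in auto)
    then show "(T ^\<^sub>m Suc k) $$ (i, j) = 0"
      unfolding e[OF ij(1,2)] by (intro sum.neutral) auto
  next
    fix i j assume i: "i < n"
    have "(\<Sum>l<n. (T ^\<^sub>m k) $$ (i, l) * T $$ (l, i)) = (\<Sum>l<n. if l = i then (T $$ (i, i)) ^ k * T $$ (i, i) else 0)"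
    proof (intro sum.cong refl)
      fix l assume "l \<in> {..<n}"
      then show "(T ^\<^sub>m k) $$ (i, l) * T $$ (l, i) = (if l = i then (T $$ (i, i)) ^ k * T $$ (i, i) else 0)"
        using Suc i T0[of i l] by (cases l i rule: linorder_cases) auto
    qed
    also have "\<dots> = (T $$ (i, i)) ^ Suc k" using i by simp
    finally show "(T ^\<^sub>m Suc k) $$ (i, i) = (T $$ (i, i)) ^ Suc k" using e[OF i i] by simp
  qed
qed

lemma mtr_pow_eq_power_sum:
  fixes C :: "real mat"
  assumes C: "C \<in> carrier_mat n n" and es: "char_poly C = (\<Prod>e\<leftarrow>es. [:- e, 1:])"
  shows "mtr n (C ^\<^sub>m k) = (\<Sum>e\<leftarrow>es. e ^ k)"
proof -
  obtain T P Q where dec: "schur_decomposition C es = (T, P, Q)" by (cases "schur_decomposition C es") auto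
  from schur_decomposition[OF C es dec]
  have w: "similar_mat_wit C T P Q" and ut: "upper_triangular T" and d: "diag_mat T = es" by auto
  have car: "T \<in> carrier_mat n n" "P \<in> carrier_mat n n" "Q \<in> carrier_mat n n" "Q * P = 1\<^sub>m n"
    using w C unfolding similar_mat_wit_def by (auto simp: Let_def)
  have Tk: "T ^\<^sub>m k \<in> carrier_mat n n" using car(1) by (rule pow_carrier_mat)
  have "mtr n (C ^\<^sub>m k) = mtr n ((P * T ^\<^sub>m k) * Q)" using similar_mat_wit_pow_id[OF w] by simp
  also have "\<dots> = mtr n (Q * (P * T ^\<^sub>m k))"
    by (rule mtr_commute) (use car Tk in auto)
  also have "Q * (P * T ^\<^sub>m k) = Q * P * T ^\<^sub>m k"
    by (rule assoc_mult_mat[symmetric]) (use car Tk in auto)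
  also have "\<dots> = T ^\<^sub>m k" using car Tk by simp
  also have "mtr n (T ^\<^sub>m k) = (\<Sum>i<n. (T $$ (i, i)) ^ k)"
    unfolding mtr_def using upper_triangular_pow[OF car(1) ut] by (intro sum.cong) auto
  also have "\<dots> = (\<Sum>e\<leftarrow>es. e ^ k)"
    unfolding d[symmetric] diag_mat_def using car(1)
    by (simp add: comp_def interv_sum_list_conv_sum_set_nat atLeast0LessThan)
  finally show ?thesis .
qed

lemma proots_linear_factors: "proots (\<Prod>e\<leftarrow>es. [:- e, 1 :: real:]) = mset es"
proof (induction es)
  case (Cons e es)
  have "(\<Prod>e\<leftarrow>es. [:- e, 1 :: real:]) \<noteq> 0"
    using prod_list_zero_iff[of "map (\<lambda>e. [:- e, 1 :: real:]) es"] by auto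
  then have "proots ([:- e, 1:] * (\<Prod>e\<leftarrow>es. [:- e, 1 :: real:])) = mset (e # es)"
    using Cons by (subst proots_mult) auto
  then show ?case by (simp only: list.map prod_list.Cons)
qed simp

lemma wmat_scale:
  "wmat N (\<lambda>e. y e / r) w i j = wmat N y w i j / r ^ length w"
  by (induction w arbitrary: i) (simp_all add: sum_divide_distrib)

lemma mat_pow_Suc_left:
  fixes C :: "real mat"
  assumes C: "C \<in> carrier_mat n n"
  shows "C ^\<^sub>m Suc k = C * C ^\<^sub>m k"
proof (induction k)
  case 0
  then show ?case using C by simp
next
  case (Suc k)
  have "C ^\<^sub>m Suc (Suc k) = (C * C ^\<^sub>m k) * C" using Suc by simp
  also have "\<dots> = C * (C ^\<^sub>m k * C)"
    by (rule assoc_mult_mat) (use C pow_carrier_mat[OF C] in auto)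
  finally show ?case by simp
qed

lemma anticommutator_pow_entry:
  assumes A: "A \<in> carrier_mat N N" and B: "B \<in> carrier_mat N N" and y: "\<And>c i j. y (c, i, j) = (if c then A else B) $$ (i, j)"
  shows "i < N \<Longrightarrow> j < N \<Longrightarrow> (anticommutator A B ^\<^sub>m k) $$ (i, j) = (\<Sum>w\<leftarrow>acw k. wmat N y w i j)"
proof (induction k arbitrary: i j)
  case 0
  then show ?case using A B by (simp add: anticommutator_def)
next
  case (Suc k)
  let ?C = "anticommutator A B"
  have C: "?C \<in> carrier_mat N N" using A B by (simp add: anticommutator_def)
  have Ck: "?C ^\<^sub>m k \<in> carrier_mat N N" using C by (rule pow_carrier_mat)
  have C2: "?C $$ (a, b) = wmat N y [True, False] a b + wmat N y [False, True] a b" if "a < N" "b < N" for a b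
  proof -
    have "wmat N y [c, d] a b = (\<Sum>l<N. y (c, a, l) * y (d, l, b))" for c d
      unfolding wmat.simps(2)[of N y c "[d]"] using that by (intro sum.cong) (auto simp: wmat_singleton simp del: wmat.simps)
    then show ?thesis using A B that
      by (simp add: anticommutator_def scalar_prod_def atLeast0LessThan y del: wmat.simps)
  qed
  have "?C ^\<^sub>m Suc k = ?C * ?C ^\<^sub>m k" using mat_pow_Suc_left[OF C] .
  then have "(?C ^\<^sub>m Suc k) $$ (i, j) = (\<Sum>l<N. ?C $$ (i, l) * (?C ^\<^sub>m k) $$ (l, j))"
    using Suc.prems C Ck by (simp add: scalar_prod_def atLeast0LessThan)
  also have "\<dots> = (\<Sum>l<N. \<Sum>w\<leftarrow>acw k. wmat N y [True, False] i l * wmat N y w l j + wmat N y [False, True] i l * wmat N y w l j)"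
    using Suc by (intro sum.cong refl) (simp add: C2 sum_list_const_mult[symmetric] distrib_right del: wmat.simps)
  also have "\<dots> = (\<Sum>w\<leftarrow>acw k. wmat N y ([True, False] @ w) i j + wmat N y ([False, True] @ w) i j)"
    unfolding sum_list_sum_swap using Suc.prems by (simp only: sum.distrib wmat_append)
  also have "\<dots> = (\<Sum>w\<leftarrow>acw (Suc k). wmat N y w i j)"
    unfolding sum_acw_Suc[where c = True] by simp
  finally show ?case .
qed

lemma length_acw: "w \<in> set (acw k) \<Longrightarrow> length w = 2 * k"
  by (induction k arbitrary: w) auto

text \<open>The scaled eigenvalues \<open>es\<close>: the empirical spectral distribution is their distribution function, and
  their power sums are traces of words.\<close>

theorem esd_as_average:
  assumes A: "A \<in> carrier_mat N N" "transpose_mat A = A" and B: "B \<in> carrier_mat N N" "transpose_mat B = B"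
    and N: "N \<ge> 1"
    and y: "\<And>c i j. y (c, i, j) = (if c then A else B) $$ (i, j) / sqrt (real N)"
  obtains es where "length es = N"
    "\<And>x. esd N (anticommutator A B) x = (\<Sum>e\<leftarrow>es. of_bool (e \<le> x)) / real N"
    "\<And>k. (\<Sum>e\<leftarrow>es. e ^ k) / real N = (\<Sum>w\<leftarrow>acw k. ntr N y w)"
proof -
  let ?C = "anticommutator A B"
  have C: "?C \<in> carrier_mat N N" using A B by (simp add: anticommutator_def)
  have "transpose_mat ?C = ?C"
    unfolding anticommutator_def using A B
    by (simp add: transpose_add[of _ N N] transpose_mult[of _ N N _ N] comm_add_mat[of _ N N])
  then obtain fs where fs: "char_poly ?C = (\<Prod>e\<leftarrow>fs. [:- e, 1:])" "length fs = N"
    using symmetric_char_poly_splits[OF C] by blast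
  define es where "es = map (\<lambda>e. e / real N) fs"
  show ?thesis
  proof (rule that[of es])
    show "length es = N" by (simp add: es_def fs)
    fix x
    have "real (length (filter (\<lambda>l. l / real N \<le> x) fs)) = (\<Sum>e\<leftarrow>fs. of_bool (e / real N \<le> x))" for fs
      by (induction fs) auto
    then show "esd N ?C x = (\<Sum>e\<leftarrow>es. of_bool (e \<le> x)) / real N"
      by (simp add: esd_def fs(1) proots_linear_factors es_def comp_def flip: mset_filter)
  next
    fix k
    define y0 where "y0 = (\<lambda>(c, i, j). (if c then A else B) $$ (i, j))"
    have y0: "y = (\<lambda>e. y0 e / sqrt (real N))" by (auto simp: y0_def y)
    have "sqrt (real N) ^ length w = real N ^ k" if "w \<in> set (acw k)" for w
      using length_acw[OF that] by (simp add: power_mult)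
    then have "(\<Sum>w\<leftarrow>acw k. ntr N y w) = (\<Sum>w\<leftarrow>acw k. wtr N y0 w / real N ^ k / real N)"
      unfolding ntr_def wtr_def y0 wmat_scale
      by (intro arg_cong[where f = sum_list] map_cong) (auto simp: sum_divide_distrib)
    also have "\<dots> = (\<Sum>w\<leftarrow>acw k. wtr N y0 w) / real N ^ k / real N"
      by (simp add: divide_inverse sum_list_mult_const)
    also have "(\<Sum>w\<leftarrow>acw k. wtr N y0 w) = mtr N (?C ^\<^sub>m k)"
      unfolding wtr_def mtr_def sum_list_sum_swap[symmetric]
      by (intro sum.cong refl anticommutator_pow_entry[OF A(1) B(1), symmetric]) (auto simp: y0_def)
    also have "\<dots> = (\<Sum>e\<leftarrow>fs. e ^ k)" by (rule mtr_pow_eq_power_sum[OF C fs(1)])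
    also have "\<dots> / real N ^ k = (\<Sum>e\<leftarrow>es. e ^ k)"
      by (simp add: es_def comp_def divide_inverse power_mult_distrib power_inverse sum_list_mult_const)
    finally show "(\<Sum>e\<leftarrow>es. e ^ k) / real N = (\<Sum>w\<leftarrow>acw k. ntr N y w)" by simp
  qed
qed

section \<open>A parametrization of the density\<close>

text \<open>The squared modulus of the boundary value \<open>G = r e^{i t}\<close> of the Stieltjes transform as a function of
  \<open>c = cos t\<close>: the positive solution \<open>q\<close> of \<open>q^2 + 4 c^2 q = 1\<close>.\<close>

definition curve_q :: "real \<Rightarrow> real" where
  "curve_q c = sqrt (1 + 4 * c ^ 4) - 2 * c\<^sup>2"

text \<open>The point of the spectrum at which this boundary value is taken.\<close>

definition curve_x :: "real \<Rightarrow> real" where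
  "curve_x c = 2 * c / (sqrt (curve_q c) * (1 + curve_q c))"

lemma curve_q_gt: "2 * c\<^sup>2 < sqrt (1 + 4 * c ^ 4)"
  by (rule real_less_rsqrt) (simp add: power_mult_distrib flip: power_mult)

lemma curve_q_pos: "curve_q c > 0"
  unfolding curve_q_def using curve_q_gt[of c] by simp

lemma curve_q_eq: "curve_q c ^ 2 + 4 * c\<^sup>2 * curve_q c = 1"
proof -
  have "sqrt (1 + 4 * c ^ 4) ^ 2 = 1 + 4 * c ^ 4" by (rule real_sqrt_pow2) simp
  then show ?thesis unfolding curve_q_def by (simp add: power2_eq_square algebra_simps power4_eq_xxxx)
qed

lemma curve_q_antimono:
  assumes "c\<^sup>2 \<le> d\<^sup>2" shows "curve_q d \<le> curve_q c"
proof (rule ccontr)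
  assume n: "\<not> curve_q d \<le> curve_q c"
  then have "curve_q c ^ 2 < curve_q d ^ 2" using curve_q_pos[of c] by (intro power_strict_mono) auto
  moreover have "4 * c\<^sup>2 * curve_q c \<le> 4 * d\<^sup>2 * curve_q d"
    using n assms curve_q_pos[of c] by (intro mult_mono) auto
  ultimately show False using curve_q_eq[of c] curve_q_eq[of d] by linarith
qed

lemma curve_q_le_1: "curve_q c \<le> 1"
  using curve_q_antimono[of 0 c] by (simp add: curve_q_def)

lemma curve_q_lt_1: "c \<noteq> 0 \<Longrightarrow> curve_q c < 1"
proof -
  assume "c \<noteq> 0"
  then have "4 * c\<^sup>2 * curve_q c > 0" using curve_q_pos[of c] by simp
  then have "curve_q c \<noteq> 1" using curve_q_eq[of c] by auto
  then show ?thesis using curve_q_le_1[of c] by simp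
qed

lemma curve_q_uminus: "curve_q (- c) = curve_q c" by (simp add: curve_q_def)

lemma curve_x_uminus: "curve_x (- c) = - curve_x c" by (simp add: curve_x_def curve_q_uminus)

lemma curve_x_mono_nonneg:
  assumes "0 \<le> c" "c \<le> d" shows "curve_x c \<le> curve_x d"
proof -
  have "curve_q d \<le> curve_q c" using assms by (intro curve_q_antimono power_mono)
  then have "sqrt (curve_q d) * (1 + curve_q d) \<le> sqrt (curve_q c) * (1 + curve_q c)"
    using curve_q_pos[of d] curve_q_pos[of c] by (intro mult_mono) auto
  then show ?thesis unfolding curve_x_def using assms curve_q_pos[of d]
    by (intro frac_le) auto
qed

lemma curve_x_mono: "mono curve_x"
proof
  fix c d :: real assume cd: "c \<le> d"
  have nn: "0 \<le> curve_x c" if "0 \<le> c" for c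
    using curve_x_mono_nonneg[of 0 c] that by (simp add: curve_x_def)
  consider "0 \<le> c" | "d \<le> 0" | "c \<le> 0" "0 \<le> d" using cd by linarith
  then show "curve_x c \<le> curve_x d"
  proof cases
    case 1 then show ?thesis using curve_x_mono_nonneg cd by simp
  next
    case 2
    then have "curve_x (- d) \<le> curve_x (- c)" using curve_x_mono_nonneg[of "-d" "-c"] cd by simp
    then show ?thesis by (simp add: curve_x_uminus)
  next
    case 3
    then have "0 \<le> curve_x (- c)" "0 \<le> curve_x d" using nn[of "-c"] nn[of d] by auto
    then show ?thesis by (simp add: curve_x_uminus)
  qed
qed

lemma curve_x_sq: "curve_x c ^ 2 = (1 - curve_q c) / ((curve_q c)\<^sup>2 * (1 + curve_q c))"
proof -
  define q where "q = curve_q c"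
  have q: "q > 0" "4 * c\<^sup>2 * q = (1 - q) * (1 + q)"
    using curve_q_pos curve_q_eq[of c] by (auto simp: q_def power2_eq_square algebra_simps)
  have "curve_x c ^ 2 = 4 * c\<^sup>2 / (q * (1 + q)\<^sup>2)"
    unfolding curve_x_def q_def[symmetric] using q(1) by (simp add: power_divide power_mult_distrib)
  also have "\<dots> = (4 * c\<^sup>2 * q) / (q\<^sup>2 * (1 + q)\<^sup>2)" using q(1) by (simp add: power2_eq_square)
  also have "\<dots> = (1 - q) / (q\<^sup>2 * (1 + q))" unfolding q(2) using q(1) by (simp add: power2_eq_square)
  finally show ?thesis by (simp add: q_def)
qed

lemma curve_x_1: "curve_x 1 = sqrt ((11 + 5 * sqrt 5) / 2)"
proof -
  have s: "sqrt 5 * sqrt 5 = (5::real)" by simp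
  have s2: "sqrt 5 > (2::real)" by (rule real_less_rsqrt) simp
  have s3: "sqrt 5 < (3::real)" by (rule real_less_lsqrt) auto
  have q: "curve_q 1 = sqrt 5 - 2" by (simp add: curve_q_def)
  have "curve_x 1 ^ 2 = (3 - sqrt 5) / ((sqrt 5 - 2)\<^sup>2 * (sqrt 5 - 1))"
    unfolding curve_x_sq q by simp
  also have "\<dots> = (11 + 5 * sqrt 5) / 2"
  proof -
    have "(3 - sqrt 5) * 2 = (11 + 5 * sqrt 5) * ((sqrt 5 - 2)\<^sup>2 * (sqrt 5 - 1))"
      using s by (simp add: power2_eq_square algebra_simps)
    moreover have "(sqrt 5 - 2)\<^sup>2 * (sqrt 5 - 1) \<noteq> 0" using s2 by simp
    ultimately show ?thesis by (simp add: divide_simps)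
  qed
  finally have "curve_x 1 ^ 2 = (11 + 5 * sqrt 5) / 2" .
  moreover have "curve_x 1 \<ge> 0" using curve_x_mono_nonneg[of 0 1] by (simp add: curve_x_def)
  ultimately show ?thesis by (metis real_sqrt_unique)
qed

text \<open>The Cardano formula in the definition of \<open>mu\<close>, evaluated along the parametrization. The two cubic
  radicals are \<open>a + p\<close> and \<open>a - p\<close>, identified by their product and the sum of their cubes.\<close>

theorem mu_curve_x:
  assumes c: "\<bar>c\<bar> \<le> 1" "c \<noteq> 0"
  shows "mu (curve_x c) = sqrt (curve_q c) * sqrt (1 - c\<^sup>2) / pi"
proof -
  define q where "q = curve_q c"
  define x where "x = curve_x c"
  define s where "s = sqrt (1 - c\<^sup>2)"
  \<comment> \<open>the common real part and the half difference of the two radicals\<close>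
  define p where "p = \<bar>x\<bar> * sqrt q * s / sqrt 3"
  define a where "a = (3 - q) / (6 * q)"
  have q: "q > 0" "q < 1" "4 * c\<^sup>2 * q = (1 - q) * (1 + q)"
    using curve_q_pos curve_q_eq[of c] curve_q_lt_1[OF c(2)] by (auto simp: q_def power2_eq_square algebra_simps)
  have c1: "c\<^sup>2 \<le> 1" using c(1) by (simp add: abs_square_le_1)
  have X: "x\<^sup>2 = (1 - q) / (q\<^sup>2 * (1 + q))" unfolding x_def q_def by (rule curve_x_sq)
  have x0: "x \<noteq> 0" using c(2) q(1) by (simp add: x_def curve_x_def flip: q_def)
  have s2: "s\<^sup>2 = (q\<^sup>2 + 4 * q - 1) / (4 * q)"
    using c1 q by (simp add: s_def field_simps power2_eq_square)
  have p0: "p \<ge> 0" unfolding p_def s_def using q(1) c1 by simp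
  have p2: "p\<^sup>2 = (1 - q) * (q\<^sup>2 + 4 * q - 1) / (12 * q\<^sup>2 * (1 + q))"
  proof -
    have "p\<^sup>2 = x\<^sup>2 * q * s\<^sup>2 / 3" unfolding p_def using q(1) by (simp add: power_divide power_mult_distrib)
    also have "\<dots> = (1 - q) * (q\<^sup>2 + 4 * q - 1) / (12 * q\<^sup>2 * (1 + q))"
      unfolding X s2 using q(1) by (simp add: divide_simps)
    finally show ?thesis .
  qed
  have a0: "a > 0" unfolding a_def using q by simp
  define H where "H = a + p"
  have H0: "H > 0" using a0 p0 by (simp add: H_def)
  have hk: "H * (a - p) = (3 * x\<^sup>2 + 1) / 9"
  proof -
    have "H * (a - p) = a\<^sup>2 - p\<^sup>2" by (simp add: H_def power2_eq_square algebra_simps)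
    also have "\<dots> = (3 * x\<^sup>2 + 1) / 9"
      unfolding p2 a_def X using q(1) by (simp add: divide_simps) (simp add: algebra_simps power2_eq_square power3_eq_cube)
    finally show ?thesis .
  qed
  have avg: "a ^ 3 + 3 * a * p\<^sup>2 = (18 * x\<^sup>2 + 1) / 27"
    unfolding p2 a_def X using q(1) by (simp add: divide_simps) (simp add: algebra_simps power2_eq_square power3_eq_cube)
  have dsc: "x\<^sup>2 * (1 + 11 * x\<^sup>2 - x ^ 4) / 27 = (3 * a\<^sup>2 * p + p ^ 3)\<^sup>2"
  proof -
    have "x\<^sup>2 * (1 + 11 * x\<^sup>2 - x ^ 4) / 27 = ((18 * x\<^sup>2 + 1) / 27)\<^sup>2 - ((3 * x\<^sup>2 + 1) / 9) ^ 3"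
      by (simp add: field_simps power2_eq_square power3_eq_cube power4_eq_xxxx)
    also have "\<dots> = (a ^ 3 + 3 * a * p\<^sup>2)\<^sup>2 - ((a + p) * (a - p)) ^ 3"
      unfolding avg[symmetric] hk[symmetric] H_def ..
    also have "\<dots> = (3 * a\<^sup>2 * p + p ^ 3)\<^sup>2" by (simp add: algebra_simps power2_eq_square power3_eq_cube)
    finally show ?thesis .
  qed
  have "sqrt (x\<^sup>2 * (1 + 11 * x\<^sup>2 - x ^ 4) / 27) = 3 * a\<^sup>2 * p + p ^ 3"
    unfolding dsc using p0 by simp
  then have "h x = root 3 (a ^ 3 + 3 * a * p\<^sup>2 + (3 * a\<^sup>2 * p + p ^ 3))"
    unfolding h_def avg by simp
  also have "a ^ 3 + 3 * a * p\<^sup>2 + (3 * a\<^sup>2 * p + p ^ 3) = H ^ 3" unfolding H_def by (simp add: algebra_simps power2_eq_square power3_eq_cube)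
  also have "root 3 (H ^ 3) = H" using H0 by (simp add: real_root_power_cancel)
  finally have hx: "h x = H" .
  have "(3 * x\<^sup>2 + 1) / (9 * h x) = a - p"
    unfolding hx using hk H0 by (simp add: field_simps)
  then have diff: "(3 * x\<^sup>2 + 1) / (9 * h x) - h x = - 2 * p" unfolding hx H_def by simp
  have "\<bar>x\<bar> \<le> curve_x 1"
    using curve_x_mono c(1) unfolding x_def mono_def abs_le_iff
    by (metis curve_x_uminus)
  then have "mu x = - (sqrt 3 / (2 * pi * \<bar>x\<bar>)) * (- 2 * p)"
    unfolding mu_def diff curve_x_1 by simp
  also have "\<dots> = sqrt q * s / pi" unfolding p_def using x0 by (simp add: field_simps)
  finally show ?thesis by (simp add: x_def q_def s_def)
qed

lemma curve_R_deriv: 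
  defines "R \<equiv> \<lambda>c. sqrt (curve_q c)"
  obtains R' where "\<And>c. (R has_real_derivative R' c) (at c)" "continuous_on UNIV R'"
proof
  define R' where "R' = (\<lambda>c::real. ((16 * c ^ 3) * (inverse (sqrt (1 + 4 * c ^ 4)) / 2) - 4 * c) * (inverse (sqrt (curve_q c)) / 2))"
  have p: "1 + 4 * c ^ 4 > (0::real)" for c by (simp add: add_pos_nonneg)
  show "(R has_real_derivative R' c) (at c)" for c
  proof -
    have "(curve_q has_real_derivative (16 * c ^ 3) * (inverse (sqrt (1 + 4 * c ^ 4)) / 2) - 4 * c) (at c)"
      unfolding curve_q_def using p[of c]
      by (auto intro!: derivative_eq_intros)
    then show ?thesis unfolding R_def R'_def using curve_q_pos[of c]
      by (auto intro!: derivative_eq_intros)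
  qed
  have "continuous_on UNIV curve_q" unfolding curve_q_def by (intro continuous_intros)
  moreover have "sqrt (curve_q c) \<noteq> 0" "sqrt (1 + 4 * c ^ 4) \<noteq> 0" for c
    using curve_q_pos[of c] p[of c] by auto
  ultimately show "continuous_on UNIV R'" unfolding R'_def
    by (intro continuous_intros) auto
qed

lemma curve_x_deriv:
  obtains x' where "\<And>c. (curve_x has_real_derivative x' c) (at c)" "continuous_on UNIV x'"
    "\<And>c. x' c \<ge> 0"
proof -
  define R where "R = (\<lambda>c. sqrt (curve_q c))"
  obtain R' where R': "\<And>c. (R has_real_derivative R' c) (at c)" "continuous_on UNIV R'"
    using curve_R_deriv unfolding R_def by blast
  have Rp: "R c > 0" for c using curve_q_pos[of c] by (simp add: R_def)
  have cR: "continuous_on UNIV R" using R'(1)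
    by (meson DERIV_isCont continuous_at_imp_continuous_on)
  have eq: "curve_x = (\<lambda>c. 2 * c / (R c * (1 + (R c)\<^sup>2)))"
    unfolding curve_x_def R_def using curve_q_pos by (auto simp: less_imp_le)
  have nz: "R c * (1 + (R c)\<^sup>2) \<noteq> 0" for c
    using Rp[of c] by (auto simp: add_nonneg_eq_0_iff)
  define D where "D = (\<lambda>c. R' c * (1 + (R c)\<^sup>2) + R c * (2 * R c * R' c))"
  define x' where "x' = (\<lambda>c. (2 * (R c * (1 + (R c)\<^sup>2)) - 2 * c * D c) / ((R c * (1 + (R c)\<^sup>2)) * (R c * (1 + (R c)\<^sup>2))))"
  have 1: "(curve_x has_real_derivative x' c) (at c)" for c
  proof -
    have "((\<lambda>c. R c * (1 + (R c)\<^sup>2)) has_real_derivative D c) (at c)"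
      unfolding D_def by (auto intro!: derivative_eq_intros R'(1))
    moreover have "((\<lambda>c. 2 * c) has_real_derivative 2) (at c)" by (auto intro!: derivative_eq_intros)
    ultimately show ?thesis unfolding eq x'_def using DERIV_divide nz by blast
  qed
  moreover have "continuous_on UNIV x'"
    unfolding x'_def D_def by (intro continuous_intros cR R'(2)) (use nz in auto)
  moreover have "x' c \<ge> 0" for c
    by (rule mono_on_imp_deriv_nonneg[OF _ 1, of UNIV]) (use curve_x_mono in auto)
  ultimately show ?thesis using that by blast
qed

section \<open>The curve of boundary values of the Stieltjes transform\<close>

text \<open>The inverse of the Stieltjes transform as a rational function, and its reciprocal.\<close>

definition zmap :: "complex \<Rightarrow> complex" where
  "zmap w = (1 + w\<^sup>2) / (w * (1 - w\<^sup>2))"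

definition umap :: "complex \<Rightarrow> complex" where
  "umap w = w * (1 - w\<^sup>2) / (1 + w\<^sup>2)"

lemma zmap_inverse_umap: "zmap w = inverse (umap w)"
  by (simp add: zmap_def umap_def)

text \<open>The closed curve of boundary values of the Stieltjes transform.\<close>

definition curve_path :: "real \<Rightarrow> complex" where
  "curve_path t = of_real (sqrt (curve_q (cos (2 * pi * t)))) * cis (2 * pi * t)"

lemma Re_curve_path: "Re (curve_path t) = sqrt (curve_q (cos (2 * pi * t))) * cos (2 * pi * t)"
  and Im_curve_path: "Im (curve_path t) = sqrt (curve_q (cos (2 * pi * t))) * sin (2 * pi * t)"
  by (simp_all add: curve_path_def)

abbreviation pole_free :: "complex set" where "pole_free \<equiv> - {0, 1, -1}"

lemma open_pole_free: "open pole_free" by (intro open_Compl finite_imp_closed) auto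

lemma pole_free_denominator: "w \<in> pole_free \<Longrightarrow> w * (1 - w\<^sup>2) \<noteq> 0"
  by (auto simp: power2_eq_1_iff)

lemma norm_curve_path: "norm (curve_path t) = sqrt (curve_q (cos (2 * pi * t)))"
  using curve_q_pos[of "cos (2 * pi * t)"] by (simp add: curve_path_def norm_mult)

lemma curve_path_pole_free: "curve_path t \<in> pole_free"
proof -
  have n0: "norm (curve_path t) > 0" using curve_q_pos unfolding norm_curve_path by simp
  have "curve_path t \<noteq> 1 \<and> curve_path t \<noteq> -1"
  proof (rule ccontr)
    assume "\<not> ?thesis"
    then have "norm (curve_path t) = 1 \<and> Re (curve_path t) \<noteq> 0" by auto
    then have "curve_q (cos (2 * pi * t)) = 1 \<and> cos (2 * pi * t) \<noteq> 0"
      unfolding norm_curve_path Re_curve_path by auto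
    then show False using curve_q_lt_1 by fastforce
  qed
  then show ?thesis using n0 by auto
qed

text \<open>Along the curve \<open>zmap\<close> is real, by the quadratic relation between \<open>q\<close> and \<open>c\<close>.\<close>

lemma zmap_curve_path: "zmap (curve_path t) = of_real (curve_x (cos (2 * pi * t)))"
proof -
  define c where "c = cos (2 * pi * t)"
  define s where "s = sin (2 * pi * t)"
  define q where "q = curve_q c"
  define r where "r = sqrt q"
  have sc: "s\<^sup>2 = 1 - c\<^sup>2" by (simp add: s_def c_def sin_squared_eq)
  have q0: "q > 0" using curve_q_pos by (simp add: q_def)
  have r0: "r > 0" "r\<^sup>2 = q" using q0 by (auto simp: r_def)
  have qc: "4 * c\<^sup>2 * q = 1 - q\<^sup>2" using curve_q_eq[of c] by (simp add: q_def)
  have w: "curve_path t = Complex (r * c) (r * s)"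
    by (simp add: complex_eq_iff Re_curve_path Im_curve_path r_def q_def c_def s_def)
  have w2: "(Complex (r * c) (r * s))\<^sup>2 = Complex (q * (2 * c\<^sup>2 - 1)) (2 * q * c * s)"
  proof -
    have "(r * c) * (r * c) - (r * s) * (r * s) = r\<^sup>2 * (c\<^sup>2 - s\<^sup>2)"
      by (simp add: power2_eq_square algebra_simps)
    moreover have "(r * c) * (r * s) + (r * s) * (r * c) = 2 * r\<^sup>2 * c * s"
      by (simp add: power2_eq_square algebra_simps)
    ultimately show ?thesis
      unfolding power2_eq_square[of "Complex _ _"] complex_mult r0(2) sc by simp
  qed
  have "of_real (r * (1 + q)) * (1 + (curve_path t)\<^sup>2) = of_real (2 * c) * (curve_path t * (1 - (curve_path t)\<^sup>2))"
  proof (rule complex_eqI)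
    have "(1 + q) * (1 + q * (2 * c\<^sup>2 - 1)) = 2 * c\<^sup>2 * (1 - q * (2 * c\<^sup>2 - 1)) + 4 * q * c\<^sup>2 * s\<^sup>2"
    proof -
      have "(1 + q) * (1 + q * (2 * c\<^sup>2 - 1)) = (1 + q) * (1 - q) + (1 + q) / 2 * (4 * c\<^sup>2 * q)"
        by (simp add: field_simps)
      also have "\<dots> = (1 - q\<^sup>2) * (3 + q) / 2" unfolding qc by (simp add: field_simps power2_eq_square)
      also have "\<dots> = 2 * c\<^sup>2 * q * (3 + q)" unfolding qc[symmetric] by simp
      also have "\<dots> = 2 * c\<^sup>2 * (q\<^sup>2 + 3 * q)" by (simp add: power2_eq_square algebra_simps)
      also have "\<dots> = 2 * c\<^sup>2 * (1 - 4 * c\<^sup>2 * q + 3 * q)" unfolding qc by simp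
      also have "\<dots> = 2 * c\<^sup>2 * (1 - q * (2 * c\<^sup>2 - 1)) + 4 * q * c\<^sup>2 * s\<^sup>2"
        unfolding sc by (simp add: algebra_simps)
      finally show ?thesis .
    qed
    then have "r * ((1 + q) * (1 + q * (2 * c\<^sup>2 - 1))) = r * (2 * c\<^sup>2 * (1 - q * (2 * c\<^sup>2 - 1)) + 4 * q * c\<^sup>2 * s\<^sup>2)"
      by simp
    then show "Re (of_real (r * (1 + q)) * (1 + (curve_path t)\<^sup>2)) = Re (of_real (2 * c) * (curve_path t * (1 - (curve_path t)\<^sup>2)))"
      unfolding w w2 by (simp add: power2_eq_square algebra_simps)
  next
    have "(1 + q) * (2 * q) = 2 * (1 - q * (2 * c\<^sup>2 - 1)) - 4 * q * c\<^sup>2"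
    proof -
      have "2 * (1 - q * (2 * c\<^sup>2 - 1)) - 4 * q * c\<^sup>2 = 2 + 2 * q - 2 * (4 * c\<^sup>2 * q)" by (simp add: algebra_simps)
      also have "\<dots> = (1 + q) * (2 * q)" unfolding qc by (simp add: algebra_simps power2_eq_square)
      finally show ?thesis ..
    qed
    then have "(r * c * s) * ((1 + q) * (2 * q)) = (r * c * s) * (2 * (1 - q * (2 * c\<^sup>2 - 1)) - 4 * q * c\<^sup>2)"
      by simp
    then show "Im (of_real (r * (1 + q)) * (1 + (curve_path t)\<^sup>2)) = Im (of_real (2 * c) * (curve_path t * (1 - (curve_path t)\<^sup>2)))"
      unfolding w w2 by (simp add: power2_eq_square algebra_simps)
  qed
  moreover have "of_real (r * (1 + q)) \<noteq> (0 :: complex)" using r0 q0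
    by (simp only: of_real_eq_0_iff) simp
  moreover have "curve_path t * (1 - (curve_path t)\<^sup>2) \<noteq> 0"
    by (rule pole_free_denominator[OF curve_path_pole_free])
  ultimately have "zmap (curve_path t) = of_real (2 * c) / of_real (r * (1 + q))"
    unfolding zmap_def by (simp add: divide_simps mult_ac)
  then show ?thesis by (simp add: curve_x_def r_def q_def c_def)
qed

lemma curve_path_deriv:
  obtains D where "\<And>t. (curve_path has_vector_derivative D t) (at t)" "continuous_on UNIV D"
proof -
  obtain R' where R': "\<And>c. ((\<lambda>c. sqrt (curve_q c)) has_real_derivative R' c) (at c)" "continuous_on UNIV R'"
    using curve_R_deriv by blast
  define a where "a = (\<lambda>t. sqrt (curve_q (cos (2 * pi * t))))"
  have Re_a: "(\<lambda>t. Re (curve_path t)) = (\<lambda>t. a t * cos (2 * pi * t))"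
    and Im_a: "(\<lambda>t. Im (curve_path t)) = (\<lambda>t. a t * sin (2 * pi * t))"
    by (simp_all add: Re_curve_path Im_curve_path a_def)
  define a' where "a' = (\<lambda>t. R' (cos (2 * pi * t)) * (- sin (2 * pi * t) * (2 * pi)))"
  have a: "(a has_real_derivative a' t) (at t)" for t
  proof -
    have "((\<lambda>t. cos (2 * pi * t)) has_real_derivative (- sin (2 * pi * t) * (2 * pi))) (at t)"
      by (auto intro!: derivative_eq_intros)
    from DERIV_chain2[OF R'(1) this] show ?thesis unfolding a_def a'_def .
  qed
  have ca: "continuous_on UNIV a" using a by (meson DERIV_isCont continuous_at_imp_continuous_on)
  have ca': "continuous_on UNIV a'" unfolding a'_def
    by (intro continuous_intros continuous_on_compose2[OF R'(2)]) auto
  define D where "D = (\<lambda>t. Complex (a' t * cos (2 * pi * t) + a t * (- sin (2 * pi * t) * (2 * pi)))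
     (a' t * sin (2 * pi * t) + a t * (cos (2 * pi * t) * (2 * pi))))"
  have "(curve_path has_vector_derivative D t) (at t)" for t
  proof -
    have 1: "((\<lambda>t. Re (curve_path t)) has_real_derivative Re (D t)) (at t)"
      unfolding Re_a D_def
      by (auto intro!: derivative_eq_intros a)
    have 2: "((\<lambda>t. Im (curve_path t)) has_real_derivative Im (D t)) (at t)"
      unfolding Im_a D_def
      by (auto intro!: derivative_eq_intros a)
    show ?thesis
      using 1 2 unfolding has_vector_derivative_complex_iff has_real_derivative_iff_has_vector_derivative by simp
  qed
  moreover have "continuous_on UNIV D"
    unfolding D_def by (intro continuous_intros ca ca')
  ultimately show ?thesis using that by blast
qed

lemma valid_path_curve_path: "valid_path curve_path"
proof -
  obtain D where D: "\<And>t. (curve_path has_vector_derivative D t) (at t)" "continuous_on UNIV D"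
    using curve_path_deriv by blast
  have "curve_path C1_differentiable_on {0..1}"
    unfolding C1_differentiable_on_def using D continuous_on_subset by blast
  then show ?thesis unfolding valid_path_def by (rule C1_differentiable_imp_piecewise)
qed

lemma holomorphic_zmap: "zmap holomorphic_on pole_free"
  unfolding zmap_def using pole_free_denominator by (intro holomorphic_intros) auto

text \<open>The integrand \<open>z^k w dz\<close>, pulled back to the variable \<open>w\<close>.\<close>

definition moment_form :: "nat \<Rightarrow> complex \<Rightarrow> complex" where
  "moment_form k w = zmap w ^ k * w * deriv zmap w"

lemma holomorphic_moment_form: "moment_form k holomorphic_on pole_free"
  unfolding moment_form_def
  by (intro holomorphic_intros holomorphic_zmap holomorphic_deriv open_pole_free)

section \<open>The contour integrals of the moments\<close>

text \<open>A real power series with its coefficients read as complex numbers.\<close>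

definition fps_complex :: "real fps \<Rightarrow> complex fps" where
  "fps_complex F = Abs_fps (\<lambda>n. of_real (fps_nth F n))"

lemma fps_complex_hom:
  "fps_complex (F + G) = fps_complex F + fps_complex G"
  "fps_complex (F * G) = fps_complex F * fps_complex G"
  "fps_complex 1 = 1" "fps_complex fps_X = fps_X"
  unfolding fps_complex_def by (rule fps_ext; simp add: fps_mult_nth)+

text \<open>The inverse \<open>g\<close> of \<open>umap\<close> near \<open>0\<close> has the Taylor expansion \<open>X F\<close>, because the defining equation of
  \<open>g\<close> turns into the cubic equation of \<open>F\<close>. The last properties of \<open>g\<close> say that \<open>g v\<close> points
  roughly in the direction of \<open>v\<close>; they serve the homotopy.\<close>

theorem umap_local_inverse:
  fixes F :: "real fps"
  assumes F: "F = 1 + fps_X ^ 2 * F ^ 2 * (F + 1)"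
  obtains g \<delta> where "\<delta> > 0" "g holomorphic_on ball 0 (2 * \<delta>)"
    "\<And>v. v \<in> ball 0 (2 * \<delta>) \<Longrightarrow> umap (g v) = v"
    "\<And>v. v \<in> ball 0 (2 * \<delta>) - {0} \<Longrightarrow> norm (g v) < 1 \<and> Re (g v / v) > 0"
    "\<And>k. (deriv ^^ Suc k) g 0 / fact (Suc k) = of_real (fps_nth F k)"
proof -
  define S where "S = ball (0::complex) 1"
  have nz: "1 + w\<^sup>2 \<noteq> 0" if "w \<in> S" for w
  proof
    assume "1 + w\<^sup>2 = 0"
    then have "w\<^sup>2 = -1" by (simp add: add_eq_0_iff)
    then have "norm (w\<^sup>2) = 1" by simp
    then have "norm w = 1 \<or> norm w = -1" by (simp add: norm_power power2_eq_1_iff)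
    then have "norm w = 1" using norm_ge_zero[of w] by linarith
    then show False using that by (simp add: S_def)
  qed
  have hol: "umap holomorphic_on S" unfolding umap_def using nz by (intro holomorphic_intros) auto
  have d0: "(umap has_field_derivative 1) (at 0)"
    unfolding umap_def by (auto intro!: derivative_eq_intros)
  then have d0': "deriv umap 0 = 1" by (rule DERIV_imp_deriv)
  obtain r where r: "r > 0" "ball 0 r \<subseteq> S" "open (umap ` ball 0 r)" "inj_on umap (ball 0 r)"
    using has_complex_derivative_locally_invertible[OF hol, of 0] d0' by (auto simp: S_def)
  obtain g where g: "g holomorphic_on (umap ` ball 0 r)"
      "\<And>w. w \<in> ball 0 r \<Longrightarrow> deriv umap w * deriv g (umap w) = 1"
      "\<And>w. w \<in> ball 0 r \<Longrightarrow> g (umap w) = w"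
    using holomorphic_has_inverse[OF holomorphic_on_subset[OF hol r(2)] open_ball r(4)] by blast
  let ?U = "umap ` ball 0 r"
  have u0: "umap 0 = 0" by (simp add: umap_def)
  then have U0: "0 \<in> ?U" using r(1) by force
  have ug: "umap (g v) = v \<and> g v \<in> ball 0 r" if "v \<in> ?U" for v using that g(3) by force
  have g0: "g 0 = 0" using g(3)[of 0] r(1) u0 by simp
  have dg0: "deriv g 0 = 1" using g(2)[of 0] r(1) u0 d0' by simp
  have gd: "(g has_field_derivative 1) (at 0)"
    using holomorphic_derivI[OF g(1) r(3) U0] dg0 by simp
  then have "((\<lambda>v. (g v - g 0) / (v - 0)) \<longlongrightarrow> 1) (at 0)" by (simp add: has_field_derivative_iff)
  then have "eventually (\<lambda>v. dist (g v / v) 1 < 1) (at 0)"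
    using g0 by (auto simp: tendsto_iff)
  then obtain d1 where d1: "d1 > 0" "\<And>v. v \<noteq> 0 \<Longrightarrow> norm v < d1 \<Longrightarrow> dist (g v / v) 1 < 1"
    unfolding eventually_at by (auto simp: dist_norm)
  obtain d2 where d2: "d2 > 0" "ball 0 d2 \<subseteq> ?U" using r(3) U0 open_contains_ball by blast
  define \<delta> where "\<delta> = min d1 d2 / 2"
  have \<delta>: "\<delta> > 0" using d1(1) d2(1) by (simp add: \<delta>_def)
  have sub: "ball 0 (2 * \<delta>) \<subseteq> ?U" using d2(2) by (auto simp: \<delta>_def)
  show ?thesis
  proof (rule that[OF \<delta>, of g])
    show "g holomorphic_on ball 0 (2 * \<delta>)" using holomorphic_on_subset[OF g(1) sub] .
    show "umap (g v) = v" if "v \<in> ball 0 (2 * \<delta>)" for v using ug sub that by blast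
    show "norm (g v) < 1 \<and> Re (g v / v) > 0" if "v \<in> ball 0 (2 * \<delta>) - {0}" for v
    proof
      have "g v \<in> S" using ug sub that r(2) by blast
      then show "norm (g v) < 1" by (simp add: S_def)
      have "norm (g v / v - 1) < 1" using d1(2)[of v] that by (auto simp: \<delta>_def dist_norm)
      then have "\<bar>Re (g v / v - 1)\<bar> < 1" using abs_Re_le_cmod[of "g v / v - 1"] by linarith
      then show "Re (g v / v) > 0" by simp
    qed
    define W where "W = fps_expansion g 0"
    have "g analytic_on {0}" using g(1) r(3) U0 analytic_at by blast
    then have W: "g has_fps_expansion W" unfolding W_def by (rule analytic_at_imp_has_fps_expansion_0)
    have X: "(\<lambda>v::complex. v) has_fps_expansion fps_X" by (rule has_fps_expansion_fps_X)
    have "(\<lambda>v. g v * (1 - g v ^ 2) - v * (1 + g v ^ 2)) has_fps_expansion W * (1 - W ^ 2) - fps_X * (1 + W ^ 2)"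
      by (intro fps_expansion_intros W X)
    moreover have "eventually (\<lambda>v. g v * (1 - g v ^ 2) - v * (1 + g v ^ 2) = 0) (nhds 0)"
      unfolding eventually_nhds
    proof (intro exI conjI ballI)
      show "open ?U" "0 \<in> ?U" by fact+
      fix v assume v: "v \<in> ?U"
      then have "g v \<in> S" using ug r(2) by blast
      from nz[OF this] show "g v * (1 - g v ^ 2) - v * (1 + g v ^ 2) = 0"
        using ug[OF v] unfolding umap_def by (simp add: field_simps)
    qed
    then have "(\<lambda>v. g v * (1 - g v ^ 2) - v * (1 + g v ^ 2)) has_fps_expansion 0"
      by (simp add: has_fps_expansion_0_iff)
    ultimately have eq: "W * (1 - W ^ 2) - fps_X * (1 + W ^ 2) = 0"
      by (rule fps_expansion_unique_complex)
    define V where "V = fps_shift 1 W"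
    have "fps_nth W 0 = 0" using g0 by (simp add: W_def fps_expansion_def)
    then have WV: "W = fps_X * V"
      by (intro fps_ext) (simp add: V_def fps_X_mult_nth)
    have "fps_X * (V * (1 - fps_X ^ 2 * V ^ 2) - (1 + fps_X ^ 2 * V ^ 2)) = 0"
      using eq unfolding WV by (simp add: algebra_simps power_mult_distrib)
    then have "V * (1 - fps_X ^ 2 * V ^ 2) - (1 + fps_X ^ 2 * V ^ 2) = 0" by simp
    then have Vc: "V = 1 + fps_X ^ 2 * V ^ 2 * (V + 1)" by (simp add: algebra_simps power2_eq_square)
    have "fps_complex F = fps_complex (1 + fps_X ^ 2 * F ^ 2 * (F + 1))" using F by simp
    then have Fc: "fps_complex F = 1 + fps_X ^ 2 * fps_complex F ^ 2 * (fps_complex F + 1)"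
      by (simp add: fps_complex_hom power2_eq_square)
    have VF: "V = fps_complex F" using fps_cubic_unique[OF Vc Fc] .
    show "(deriv ^^ Suc k) g 0 / fact (Suc k) = of_real (fps_nth F k)" for k
    proof -
      have "(deriv ^^ Suc k) g 0 / fact (Suc k) = fps_nth W (Suc k)"
        by (simp add: W_def fps_expansion_def)
      also have "\<dots> = fps_nth V k" by (simp add: V_def)
      also have "\<dots> = of_real (fps_nth F k)" by (simp add: VF fps_complex_def)
      finally show ?thesis .
    qed
  qed
qed

text \<open>Over the image of a small circle the integral is a Taylor coefficient of the local inverse. The linear
  homotopy to \<open>curve_path\<close> moves each point roughly along its ray from the origin, inside the open unit disc
  until it ends, so that it avoids \<open>0\<close>, \<open>1\<close> and \<open>-1\<close>.\<close>

theorem moment_form_integral: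
  fixes F :: "real fps"
  assumes F: "F = 1 + fps_X ^ 2 * F ^ 2 * (F + 1)"
  shows "(moment_form k has_contour_integral - (2 * pi * \<i> * of_real (fps_nth F k))) curve_path"
proof -
  obtain g \<delta> where \<delta>: "\<delta> > 0" and g: "g holomorphic_on ball 0 (2 * \<delta>)"
    "\<And>v. v \<in> ball 0 (2 * \<delta>) \<Longrightarrow> umap (g v) = v"
    "\<And>v. v \<in> ball 0 (2 * \<delta>) - {0} \<Longrightarrow> norm (g v) < 1 \<and> Re (g v / v) > 0"
    "\<And>k. (deriv ^^ Suc k) g 0 / fact (Suc k) = of_real (fps_nth F k)"
    by (rule umap_local_inverse[OF F]) (rule that; assumption)
  let ?B = "ball (0::complex) (2 * \<delta>)"
  define circ where "circ = circlepath 0 \<delta>"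
  have circ: "circ t = of_real \<delta> * cis (2 * pi * t)" for t
    by (simp add: circ_def circlepath cis_conv_exp mult_ac)
  have pc: "path_image circ \<subseteq> ?B - {0}"
    unfolding circ_def using \<delta> by (auto simp: path_image_circlepath_nonneg less_imp_le)
  have gpf: "g v \<in> pole_free" if "v \<in> ?B - {0}" for v
  proof -
    have "g v \<noteq> 0" using g(3)[OF that] by auto
    then show ?thesis using g(3)[OF that] by auto
  qed
  have ana: "g analytic_on ?B" using g(1) analytic_on_open open_ball by blast
  have vp: "valid_path (g \<circ> circ)"
    by (rule valid_path_compose_analytic[of circ g ?B]) (use pc ana in \<open>auto simp: circ_def\<close>)
  have zg: "zmap (g v) = inverse v" if "v \<in> ?B" for v
    using g(2)[OF that] by (simp add: zmap_inverse_umap)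
  have "contour_integral (g \<circ> circ) (moment_form k) = contour_integral circ (\<lambda>v. deriv g v * moment_form k (g v))"
    by (rule contour_integral_comp_analyticW[OF ana]) (use pc in \<open>auto simp: circ_def\<close>)
  also have "\<dots> = contour_integral circ (\<lambda>v. - (g v / (v - 0) ^ Suc (Suc k)))"
  proof (rule contour_integral_eq)
    fix v assume "v \<in> path_image circ"
    then have v: "v \<in> ?B - {0}" using pc by blast
    have gv: "(g has_field_derivative deriv g v) (at v)"
      using holomorphic_derivI[OF g(1) open_ball] v by blast
    have zv: "(zmap has_field_derivative deriv zmap (g v)) (at (g v))"
      using holomorphic_derivI[OF holomorphic_zmap open_pole_free gpf[OF v]] .
    have "((\<lambda>v. zmap (g v)) has_field_derivative deriv zmap (g v) * deriv g v) (at v)"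
      by (rule DERIV_chain2[OF zv gv])
    then have "(inverse has_field_derivative deriv zmap (g v) * deriv g v) (at v)"
      by (rule has_field_derivative_transform_within_open[where S = ?B]) (use v zg in auto)
    moreover have "(inverse has_field_derivative - (inverse v ^ Suc (Suc 0))) (at v)"
      using v DERIV_inverse[of v] by simp
    ultimately have d: "deriv zmap (g v) * deriv g v = - (inverse v ^ Suc (Suc 0))"
      by (rule DERIV_unique)
    have "deriv g v * moment_form k (g v) = inverse v ^ k * g v * (deriv zmap (g v) * deriv g v)"
      using v zg by (simp add: moment_form_def)
    also have "\<dots> = - (g v / (v - 0) ^ Suc (Suc k))"
      unfolding d using v by (simp add: field_simps)
    finally show "deriv g v * moment_form k (g v) = - (g v / (v - 0) ^ Suc (Suc k))" .
  qed
  also have "\<dots> = - (2 * pi * \<i> * of_real (fps_nth F k))"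
  proof (rule contour_integral_unique, rule has_contour_integral_neg)
    have "continuous_on (cball 0 \<delta>) g"
      using holomorphic_on_imp_continuous_on[OF g(1)] \<delta> by (rule_tac continuous_on_subset) auto
    moreover have "g holomorphic_on ball 0 \<delta>" using g(1) \<delta> by (rule_tac holomorphic_on_subset) auto
    ultimately have "((\<lambda>u. g u / (u - 0) ^ Suc (Suc k)) has_contour_integral
       (2 * pi * \<i>) / fact (Suc k) * (deriv ^^ (Suc k)) g 0) circ"
      unfolding circ_def using \<delta> by (intro Cauchy_has_contour_integral_higher_derivative_circlepath) auto
    moreover have "(2 * pi * \<i>) / fact (Suc k) * (deriv ^^ (Suc k)) g 0 = 2 * pi * \<i> * of_real (fps_nth F k)"
      unfolding g(4)[symmetric] by simp
    ultimately show "((\<lambda>u. g u / (u - 0) ^ Suc (Suc k)) has_contour_integral 2 * pi * \<i> * of_real (fps_nth F k)) circ"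
      by simp
  qed
  finally have I: "contour_integral (g \<circ> circ) (moment_form k) = - (2 * pi * \<i> * of_real (fps_nth F k))" .
  have hom: "homotopic_loops pole_free (g \<circ> circ) curve_path"
  proof (rule homotopic_loops_linear)
    show "path (g \<circ> circ)" "path curve_path" using vp valid_path_curve_path valid_path_imp_path by auto
    show "pathfinish (g \<circ> circ) = pathstart (g \<circ> circ)"
      by (simp add: pathfinish_def pathstart_def circ)
    show "pathfinish curve_path = pathstart curve_path"
      by (simp add: pathfinish_def pathstart_def curve_path_def)
    fix t :: real assume t: "t \<in> {0..1}"
    define e where "e = cis (2 * pi * t)"
    define r where "r = sqrt (curve_q (cos (2 * pi * t)))"
    have r: "r > 0" "r \<le> 1" using curve_q_pos curve_q_le_1 by (auto simp: r_def)
    have e: "norm e = 1" "e \<noteq> 0" by (auto simp: e_def)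
    have cp: "curve_path t = of_real r * e" by (simp add: curve_path_def r_def e_def)
    have v: "circ t \<in> ?B - {0}" using pc t unfolding path_image_def by blast
    show "closed_segment ((g \<circ> circ) t) (curve_path t) \<subseteq> pole_free"
    proof
      fix w assume "w \<in> closed_segment ((g \<circ> circ) t) (curve_path t)"
      then obtain u where u: "0 \<le> u" "u \<le> 1" "w = (1 - u) *\<^sub>R g (circ t) + u *\<^sub>R curve_path t"
        by (auto simp: in_segment)
      show "w \<in> pole_free"
      proof (cases "u = 1")
        case True
        then show ?thesis using u curve_path_pole_free[of t] by simp
      next
        case False
        have "g (circ t) / e = of_real \<delta> * (g (circ t) / circ t)"
          using \<delta> e by (simp add: circ e_def[symmetric])
        then have "Re (g (circ t) / e) = \<delta> * Re (g (circ t) / circ t)"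
          by (simp del: times_divide_eq_right)
        then have pos: "Re (g (circ t) / e) > 0" using \<delta> g(3)[OF v] by (simp del: Re_divide)
        have "w / e = of_real (1 - u) * (g (circ t) / e) + of_real (u * r)"
          unfolding u(3) cp using e by (simp add: scaleR_conv_of_real field_simps)
        then have "Re (w / e) = (1 - u) * Re (g (circ t) / e) + u * r"
          by (simp del: times_divide_eq_right)
        moreover have "(1 - u) * Re (g (circ t) / e) > 0" using pos u(2) False by simp
        moreover have "u * r \<ge> 0" using u r by simp
        ultimately have "Re (w / e) > 0" by linarith
        then have w0: "w \<noteq> 0" by auto
        have "norm w \<le> (1 - u) * norm (g (circ t)) + u * norm (curve_path t)"
          unfolding u(3) using u(1,2) by (intro order.trans[OF norm_triangle_ineq]) simp
        also have "(1 - u) * norm (g (circ t)) < (1 - u) * 1"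
          using g(3)[OF v] u(2) False by (intro mult_strict_left_mono) auto
        also have "u * norm (curve_path t) \<le> u * 1"
          using u(1) r e unfolding cp by (intro mult_left_mono) (auto simp: norm_mult)
        finally have "norm w < 1" by simp
        then show ?thesis using w0 by auto
      qed
    qed
  qed
  have "contour_integral (g \<circ> circ) (moment_form k) = contour_integral curve_path (moment_form k)"
    by (rule Cauchy_theorem_homotopic_loops[OF hom open_pole_free holomorphic_moment_form vp valid_path_curve_path])
  moreover have "moment_form k contour_integrable_on curve_path"
    by (rule contour_integrable_holomorphic_simple[OF holomorphic_moment_form open_pole_free valid_path_curve_path])
       (use curve_path_pole_free in \<open>auto simp: path_image_def\<close>)
  ultimately show ?thesis using I by (metis has_contour_integral_integral)
qed


section \<open>Moments of the density\<close>

lemma measurable_mu: "mu \<in> borel_measurable borel"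
proof -
  have [measurable]: "root 3 \<in> borel_measurable borel"
    by (intro borel_measurable_continuous_onI continuous_intros)
  have [measurable]: "h \<in> borel_measurable borel" unfolding h_def by measurable
  show ?thesis unfolding mu_def by measurable
qed

lemma mu_bounds: "0 \<le> mu x" "mu x \<le> 1"
proof -
  have "0 \<le> mu x \<and> mu x \<le> 1"
  proof (cases "\<bar>x\<bar> \<le> curve_x 1")
    case False
    then show ?thesis by (simp add: mu_def curve_x_1)
  next
    case True
    obtain x' where x': "\<And>c. (curve_x has_real_derivative x' c) (at c)"
      using curve_x_deriv by blast
    have "\<exists>c\<ge>-1. c \<le> 1 \<and> curve_x c = x"
      using True x' curve_x_uminus[of 1] by (intro IVT) (auto intro: DERIV_isCont)
    then obtain c where "-1 \<le> c" "c \<le> 1" and cx: "curve_x c = x" by blast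
    then have c: "\<bar>c\<bar> \<le> 1" "curve_x c = x" by auto
    show ?thesis
  \<comment> \<open>at \<open>c = 0\<close> the formula for \<open>mu\<close> divides by 0 and yields 0\<close>
    proof (cases "c = 0")
      case True
      then show ?thesis using c by (simp add: curve_x_def mu_def)
    next
      case False
      have c1: "c\<^sup>2 \<le> 1" using c(1) by (simp add: abs_square_le_1)
      have "sqrt (curve_q c) * sqrt (1 - c\<^sup>2) \<le> 1 * 1"
        using curve_q_le_1[of c] curve_q_pos[of c] c1 by (intro mult_mono) auto
      then have "sqrt (curve_q c) * sqrt (1 - c\<^sup>2) / pi \<le> 1"
        using pi_gt3 by (simp add: divide_le_eq)
      moreover have "0 \<le> sqrt (curve_q c) * sqrt (1 - c\<^sup>2) / pi"
        using curve_q_pos[of c] c1 by simp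
      ultimately show ?thesis using mu_curve_x[OF c(1) False] c(2) by simp
    qed
  qed
  then show "0 \<le> mu x" "mu x \<le> 1" by auto
qed

lemma mu_support: "\<bar>x\<bar> > curve_x 1 \<Longrightarrow> mu x = 0"
  by (simp add: mu_def curve_x_1)

lemma integrable_mu_moment: "integrable lborel (\<lambda>x. x ^ k * mu x)"
proof (rule Bochner_Integration.integrable_bound)
  show "integrable lborel (\<lambda>x. curve_x 1 ^ k * indicator {- curve_x 1..curve_x 1} x)"
    by (intro integrable_mult_right integrable_real_indicator) (auto simp: emeasure_lborel_Icc_eq)
  show "(\<lambda>x. x ^ k * mu x) \<in> borel_measurable lborel"
    using measurable_mu by simp
  show "AE x in lborel. norm (x ^ k * mu x) \<le> norm (curve_x 1 ^ k * indicator {- curve_x 1..curve_x 1} x)"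
  proof (rule AE_I2)
    fix x
    show "norm (x ^ k * mu x) \<le> norm (curve_x 1 ^ k * indicator {- curve_x 1..curve_x 1} x)"
    proof (cases "\<bar>x\<bar> \<le> curve_x 1")
      case True
      then have "\<bar>x\<bar> ^ k * mu x \<le> curve_x 1 ^ k * 1"
        using mu_bounds[of x] by (intro mult_mono power_mono) auto
      then show ?thesis using True mu_bounds[of x] by (auto simp: abs_mult power_abs abs_le_iff)
    qed (simp add: mu_support)
  qed
qed

text \<open>The imaginary part of the contour integral, whose two halves agree by the reflection \<open>t \<mapsto> 1 - t\<close>;
  on the second half the substitution \<open>x = g t\<close> is increasing.\<close>

theorem mu_moment:
  fixes F :: "real fps"
  assumes F: "F = 1 + fps_X ^ 2 * F ^ 2 * (F + 1)"
  shows "(LBINT x. x ^ k * mu x) = fps_nth F k"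
proof -
  obtain D where D: "\<And>t. (curve_path has_vector_derivative D t) (at t)" "continuous_on UNIV D"
    using curve_path_deriv by blast
  obtain x' where x': "\<And>c. (curve_x has_real_derivative x' c) (at c)" "continuous_on UNIV x'" "\<And>c. x' c \<ge> 0"
    using curve_x_deriv by blast
  define g where "g = (\<lambda>t. curve_x (cos (2 * pi * t)))"
  define g' where "g' = (\<lambda>t. x' (cos (2 * pi * t)) * (- sin (2 * pi * t) * (2 * pi)))"
  have g: "(g has_real_derivative g' t) (at t)" for t
  proof -
    have "((\<lambda>t. cos (2 * pi * t)) has_real_derivative (- sin (2 * pi * t) * (2 * pi))) (at t)"
      by (auto intro!: derivative_eq_intros)
    from DERIV_chain2[OF x'(1) this] show ?thesis unfolding g_def g'_def .
  qed
  have cg: "continuous_on UNIV g" using g by (meson DERIV_isCont continuous_at_imp_continuous_on)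
  have cg': "continuous_on UNIV g'" unfolding g'_def
    by (intro continuous_intros continuous_on_compose2[OF x'(2)]) auto
  have cc: "continuous_on UNIV curve_path"
    using D(1) by (meson continuous_at_imp_continuous_on has_vector_derivative_continuous)
  define J where "J = (\<lambda>t. g t ^ k * g' t * Im (curve_path t))"
  have cJ: "continuous_on UNIV J" unfolding J_def by (intro continuous_intros cg cg' cc)
  have Dg: "D t * deriv zmap (curve_path t) = of_real (g' t)" for t
  proof -
    have "(zmap has_field_derivative deriv zmap (curve_path t)) (at (curve_path t))"
      using holomorphic_derivI[OF holomorphic_zmap open_pole_free curve_path_pole_free] .
    from field_vector_diff_chain_at[OF D(1) this]
    have "((\<lambda>t. of_real (g t)) has_vector_derivative D t * deriv zmap (curve_path t)) (at t)"
      by (simp add: comp_def zmap_curve_path g_def)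
    moreover have "((\<lambda>t. complex_of_real (g t)) has_vector_derivative of_real (g' t)) (at t)"
      using g by (intro has_vector_derivative_of_real)
    ultimately show ?thesis by (rule vector_derivative_unique_at)
  qed
  have "((\<lambda>t. moment_form k (curve_path t) * vector_derivative curve_path (at t within {0..1}))
      has_integral - (2 * pi * \<i> * of_real (fps_nth F k))) {0..1}"
    using moment_form_integral[OF F, of k] unfolding has_contour_integral_def .
  then have "((\<lambda>t. of_real (g t ^ k * g' t) * curve_path t) has_integral - (2 * pi * \<i> * of_real (fps_nth F k))) {0..1}"
  proof (rule has_integral_eq[rotated])
    fix t :: real assume t: "t \<in> {0..1}"
    have "vector_derivative curve_path (at t within {0..1}) = D t"
      by (rule vector_derivative_at_within_ivl[OF D(1)]) (use t in auto)
    then have "moment_form k (curve_path t) * vector_derivative curve_path (at t within {0..1})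
       = zmap (curve_path t) ^ k * curve_path t * (D t * deriv zmap (curve_path t))"
      by (simp add: moment_form_def)
    also have "\<dots> = of_real (g t ^ k * g' t) * curve_path t"
      unfolding Dg by (simp add: zmap_curve_path g_def)
    finally show "moment_form k (curve_path t) * vector_derivative curve_path (at t within {0..1})
       = of_real (g t ^ k * g' t) * curve_path t" .
  qed
  from has_integral_linear[OF this bounded_linear_Im]
  have J01: "(J has_integral - (2 * pi * fps_nth F k)) {0..1}"
    by (simp add: comp_def J_def)
  have Ji: "J integrable_on {a..b}" for a b
    using cJ by (intro integrable_continuous_interval) (rule continuous_on_subset, auto)
  have Jsym: "J (- t + 1) = J t" for t
  proof -
    have "2 * pi * (- t + 1) = 2 * pi - 2 * pi * t" by (simp add: algebra_simps)
    then have "cos (2 * pi * (- t + 1)) = cos (2 * pi * t)" "sin (2 * pi * (- t + 1)) = - sin (2 * pi * t)"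
      by (simp_all add: cos_diff sin_diff)
    then show ?thesis by (simp add: J_def g_def g'_def Im_curve_path)
  qed
  have "(J has_integral integral {0..1/2} J) (cbox 0 (1/2))"
    using integrable_integral[OF Ji[of 0 "1/2"]] by simp
  from has_integral_affinity[OF this, of "-1" 1]
  have "(J has_integral integral {0..1/2} J) ((\<lambda>x. - x + 1) ` {0..1/2})" by (simp add: Jsym[simplified])
  moreover have "(\<lambda>x::real. - x + 1) ` {0..1/2} = {1/2..1}"
    using image_affinity_atLeastAtMost[of "-1" 1 0 "1/2::real"] by simp
  ultimately have "integral {1/2..1} J = integral {0..1/2} J"
    by (metis integral_unique)
  moreover have "integral {0..1/2} J + integral {1/2..1} J = integral {0..1} J"
    by (rule Henstock_Kurzweil_Integration.integral_combine[OF _ _ Ji]) auto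
  moreover have "integral {0..1} J = - (2 * pi * fps_nth F k)" using J01 by (rule integral_unique)
  ultimately have J12: "integral {1/2..1} J = - (pi * fps_nth F k)" by simp
  define f where "f = (\<lambda>x. x ^ k * mu x)"
  have g1: "g (1/2) = - curve_x 1" "g 1 = curve_x 1"
    using curve_x_uminus[of 1] by (simp_all add: g_def)
  have fint: "set_integrable lborel {g (1/2)..g 1} f"
    unfolding set_integrable_def f_def
    by (rule integrable_mult_indicator) (auto intro: integrable_mu_moment)
  have nonneg: "g' t \<ge> 0" if "t \<in> {1/2..1}" for t
  proof -
    have "2 * pi * t = pi + (2 * pi * t - pi)" by simp
    then have "sin (2 * pi * t) = - sin (2 * pi * t - pi)" by (metis sin_periodic_pi2)
    moreover have "sin (2 * pi * t - pi) \<ge> 0"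
      using that by (intro sin_ge_zero) (auto simp: algebra_simps)
    ultimately have "sin (2 * pi * t) \<le> 0" by simp
    then show ?thesis unfolding g'_def using x'(3) by (intro mult_nonneg_nonneg) auto
  qed
  have fg: "f (g t) * g' t = - (1 / pi) * J t" if t: "t \<in> {1/2..1}" "t \<noteq> 3/4" for t
  proof -
    define y where "y = 2 * pi * t - pi"
    have y: "0 \<le> y" "y \<le> pi" using t by (auto simp: y_def algebra_simps)
    have "2 * pi * t = pi + y" by (simp add: y_def)
    then have cs: "cos (2 * pi * t) = - cos y" "sin (2 * pi * t) = - sin y"
      by (simp_all add: add.commute)
    have "cos y \<noteq> 0"
    proof
      assume "cos y = 0"
      then have "cos y = cos (pi / 2)" by simp
      then have "y = pi / 2" using cos_inj_pi[of y "pi / 2"] y by simp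
      then show False using t(2) by (simp add: y_def field_simps)
    qed
    then have c: "\<bar>cos (2 * pi * t)\<bar> \<le> 1" "cos (2 * pi * t) \<noteq> 0" using cs by auto
    have "sqrt (1 - (cos (2 * pi * t))\<^sup>2) = \<bar>sin (2 * pi * t)\<bar>"
      by (simp flip: sin_squared_eq)
    also have "\<dots> = - sin (2 * pi * t)" using sin_ge_zero[OF y] by (simp add: cs)
    finally have "mu (g t) = - (Im (curve_path t) / pi)"
      unfolding g_def mu_curve_x[OF c] Im_curve_path by simp
    then show ?thesis by (simp add: f_def J_def)
  qed
  have "(LBINT x. f x) = (LBINT x. f x * indicator {g (1/2)..g 1} x)"
  proof (rule Bochner_Integration.integral_cong[OF refl])
    fix x
    show "f x = f x * indicator {g (1/2)..g 1} x"
      unfolding g1 f_def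
      by (cases "\<bar>x\<bar> \<le> curve_x 1") (use mu_support[of x] in \<open>auto simp: indicator_def\<close>)
  qed
  also have "\<dots> = (LBINT t. f (g t) * g' t * indicator {1/2..1} t)"
    by (rule integral_substitution(2)[where g = g and a = "1/2" and b = 1])
       (use fint g continuous_on_subset[OF cg'] nonneg in auto)
  also have "\<dots> = (LBINT t. - (1 / pi) * (indicator {1/2..1} t *\<^sub>R J t))"
  proof (rule integral_cong_AE)
    have [measurable]: "J \<in> borel_measurable borel" "g \<in> borel_measurable borel" "g' \<in> borel_measurable borel"
      using cJ cg cg' borel_measurable_continuous_onI by auto
    have [measurable]: "f \<in> borel_measurable borel" unfolding f_def using measurable_mu by measurable
    show "(\<lambda>t. f (g t) * g' t * indicator {1/2..1} t) \<in> borel_measurable lborel"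
      "(\<lambda>t. - (1 / pi) * (indicator {1/2..1} t *\<^sub>R J t)) \<in> borel_measurable lborel" by measurable
    have "AE t in lborel. t \<noteq> (3/4 :: real)" by (rule AE_lborel_singleton)
    then show "AE t in lborel. f (g t) * g' t * indicator {1/2..1} t = - (1 / pi) * (indicator {1/2..1} t *\<^sub>R J t)"
      by (rule AE_mp) (rule AE_I2, use fg in \<open>auto simp: indicator_def\<close>)
  qed
  also have "\<dots> = - (1 / pi) * (LBINT t:{1/2..1}. J t)"
    unfolding set_lebesgue_integral_def by (rule integral_mult_right_zero)
  also have "(LBINT t:{1/2..1}. J t) = integral {1/2..1} J"
    by (rule set_borel_integral_eq_integral(2)) (rule borel_integrable_atLeastAtMost', rule continuous_on_subset[OF cJ], simp)
  also have "- (1 / pi) * \<dots> = fps_nth F k" unfolding J12 by simp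
  finally show ?thesis by (simp add: f_def)
qed

section \<open>Polynomial majorants and minorants of half-line indicators\<close>

lemma integrable_mu: "integrable lborel mu"
  using integrable_mu_moment[of 0] by simp

lemma mu_moment_acm: "(LBINT x. x ^ k * mu x) = acm k"
  using mu_moment[OF acm_fps, of k] by simp

lemma integral_mu: "(LBINT x. mu x) = 1"
  using mu_moment_acm[of 0] by (simp add: acm_0)

lemma integrable_bounded_mult_mu:
  assumes "f \<in> borel_measurable borel" "\<And>t. \<bar>f t\<bar> \<le> (C :: real)"
  shows "integrable lborel (\<lambda>t. f t * mu t)"
proof (rule Bochner_Integration.integrable_bound[of _ "\<lambda>t. C * mu t"])
  show "integrable lborel (\<lambda>t. C * mu t)" using integrable_mu by simp
  show "(\<lambda>t. f t * mu t) \<in> borel_measurable lborel" using assms(1) measurable_mu by simp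
  show "AE t in lborel. norm (f t * mu t) \<le> norm (C * mu t)"
  proof (rule AE_I2)
    fix t
    have "0 \<le> C" using assms(2)[of t] by linarith
    then show "norm (f t * mu t) \<le> norm (C * mu t)"
      using assms(2)[of t] mu_bounds(1)[of t] by (simp add: abs_mult mult_right_mono)
  qed
qed

lemma integrable_sum_mu:
  "integrable lborel (\<lambda>t. (\<Sum>i\<le>n. a i * t ^ i) * mu t)"
  "(LBINT t. (\<Sum>i\<le>n. a i * t ^ i) * mu t) = (\<Sum>i\<le>n. a i * acm i)"
proof -
  have eq: "(\<Sum>i\<le>n. a i * t ^ i) * mu t = (\<Sum>i\<le>n. a i * (t ^ i * mu t))" for t
    by (simp add: sum_distrib_right mult.assoc)
  show "integrable lborel (\<lambda>t. (\<Sum>i\<le>n. a i * t ^ i) * mu t)"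
    unfolding eq by (intro Bochner_Integration.integrable_sum integrable_mult_right integrable_mu_moment)
  show "(LBINT t. (\<Sum>i\<le>n. a i * t ^ i) * mu t) = (\<Sum>i\<le>n. a i * acm i)"
    unfolding eq by (subst Bochner_Integration.integral_sum) (auto simp: integrable_mu_moment mu_moment_acm)
qed

lemma integrable_polynomial_mu:
  assumes "real_polynomial_function g" shows "integrable lborel (\<lambda>t. g t * mu t)"
  using assms integrable_sum_mu(1) unfolding real_polynomial_function_iff_sum by auto

text \<open>Weierstrass approximation on \<open>{-K..K}\<close>, corrected outside of this interval by a large even
  power of \<open>t / K\<close>. The correction is small on the support of \<open>mu\<close>, which is contained in the open
  interval.\<close>

theorem polynomial_majorant:
  fixes f :: "real \<Rightarrow> real"
  assumes f: "continuous_on UNIV f" "\<And>t. 0 \<le> f t" "\<And>t. f t \<le> 1" and \<epsilon>: "\<epsilon> > 0"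
  obtains g where "real_polynomial_function g" "\<And>t. f t \<le> g t"
    "(LBINT t. g t * mu t) \<le> (LBINT t. f t * mu t) + \<epsilon>"
proof -
  define c where "c = curve_x 1"
  define K where "K = c + 1"
  have c0: "c \<ge> 0" using curve_x_mono_nonneg[of 0 1] by (simp add: c_def curve_x_def)
  have K: "K \<ge> 1" "K > 0" "c / K < 1" "0 \<le> c / K" using c0 by (auto simp: K_def)
  obtain P where P: "real_polynomial_function P" "\<And>t. t \<in> {-K..K} \<Longrightarrow> \<bar>f t - P t\<bar> < \<epsilon> / 3"
    using Stone_Weierstrass_real_polynomial_function[of "{-K..K}" f "\<epsilon> / 3"]
      continuous_on_subset[OF f(1)] \<epsilon> by auto
  \<comment> \<open>shifted up, so that it dominates \<open>f\<close> on the interval\<close>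
  define P' where "P' = (\<lambda>t. P t + \<epsilon> / 3)"
  have P': "real_polynomial_function P'" unfolding P'_def using P(1)
    by (intro real_polynomial_function.intros(3) real_polynomial_function.intros(2))
  obtain a n where an: "P' = (\<lambda>t. \<Sum>i\<le>n. a i * t ^ i)"
    using P' unfolding real_polynomial_function_iff_sum by blast
  define B where "B = (\<Sum>i\<le>n. \<bar>a i\<bar>)"
  \<comment> \<open>chosen so that the correction is at least \<open>1 + \<bar>P' t\<bar>\<close> outside of the interval\<close>
  define A where "A = 1 + B * K ^ n"
  have B0: "B \<ge> 0" by (simp add: B_def sum_nonneg)
  have A0: "A > 0" using B0 K by (simp add: A_def add_pos_nonneg)
  have "(\<lambda>j. A * (c / K) ^ j) \<longlonglongrightarrow> A * 0"
    using K c0 by (intro tendsto_intros LIMSEQ_power_zero) (auto simp: abs_of_nonneg)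
  then have "eventually (\<lambda>j. A * (c / K) ^ j < \<epsilon> / 3) sequentially"
    using \<epsilon> by (intro order_tendstoD) auto
  then obtain j0 where j0: "\<And>j. j \<ge> j0 \<Longrightarrow> A * (c / K) ^ j < \<epsilon> / 3"
    unfolding eventually_sequentially by blast
  \<comment> \<open>even, at least the degree of \<open>P'\<close>, and large enough for the correction to be small on the support\<close>
  define j where "j = 2 * (j0 + n)"
  have j: "even j" "j \<ge> n" "A * (c / K) ^ j < \<epsilon> / 3" using j0[of j] by (auto simp: j_def)
  define g where "g = (\<lambda>t. P' t + A / K ^ j * t ^ j)"
  have lin: "real_polynomial_function (\<lambda>t::real. t)"
    by (rule real_polynomial_function.intros(1)) (rule bounded_linear_ident)
  have gp: "real_polynomial_function g" unfolding g_def
    by (intro real_polynomial_function.intros(3) P' real_polynomial_function.intros(4) real_polynomial_function.intros(2)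
        real_polynomial_function_power lin)
  have tj: "A / K ^ j * t ^ j = A * (\<bar>t\<bar> / K) ^ j" for t
    using j(1) by (simp add: power_divide power_even_abs)
  have maj: "f t \<le> g t" for t
  proof (cases "\<bar>t\<bar> \<le> K")
    case True
    then have "\<bar>f t - P t\<bar> < \<epsilon> / 3" by (intro P(2)) auto
    then have "f t \<le> P' t" unfolding P'_def by linarith
    moreover have "A / K ^ j * t ^ j \<ge> 0" unfolding tj using A0 K by simp
    ultimately show ?thesis by (simp add: g_def)
  next
    case False
    then have t1: "\<bar>t\<bar> / K \<ge> 1" "\<bar>t\<bar> \<ge> 1" using K by auto
    have "\<bar>P' t\<bar> \<le> (\<Sum>i\<le>n. \<bar>a i\<bar> * \<bar>t\<bar> ^ i)"
      unfolding an by (intro order.trans[OF sum_abs] sum_mono) (simp add: abs_mult power_abs)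
    also have "\<dots> \<le> (\<Sum>i\<le>n. \<bar>a i\<bar> * \<bar>t\<bar> ^ n)"
      using t1 by (intro sum_mono mult_left_mono power_increasing) auto
    also have "\<dots> = B * K ^ n * (\<bar>t\<bar> / K) ^ n"
    proof -
      have "K ^ n * (\<bar>t\<bar> / K) ^ n = \<bar>t\<bar> ^ n" using K by (simp add: power_divide)
      then show ?thesis by (simp only: B_def sum_distrib_right mult.assoc)
    qed
    also have "\<dots> \<le> B * K ^ n * (\<bar>t\<bar> / K) ^ j"
      using t1 j(2) B0 K by (intro mult_left_mono power_increasing) auto
    finally have "\<bar>P' t\<bar> \<le> B * K ^ n * (\<bar>t\<bar> / K) ^ j" .
    moreover have "1 \<le> (\<bar>t\<bar> / K) ^ j" using t1 by (intro one_le_power)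
    moreover have "A * (\<bar>t\<bar> / K) ^ j = (\<bar>t\<bar> / K) ^ j + B * K ^ n * (\<bar>t\<bar> / K) ^ j"
      by (simp only: A_def distrib_right mult_1_left)
    ultimately have "1 \<le> g t" unfolding g_def tj by linarith
    then show ?thesis using f(3)[of t] by linarith
  qed
  have fi: "integrable lborel (\<lambda>t. f t * mu t)"
    by (rule integrable_bounded_mult_mu[of _ 1])
       (use f borel_measurable_continuous_onI in \<open>auto simp: abs_of_nonneg\<close>)
  have "g t * mu t \<le> f t * mu t + \<epsilon> * mu t" for t
  proof (cases "\<bar>t\<bar> \<le> c")
    case True
    then have "\<bar>f t - P t\<bar> < \<epsilon> / 3" by (intro P(2)) (auto simp: K_def)
    then have "P' t \<le> f t + 2 * \<epsilon> / 3" unfolding P'_def by linarith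
    moreover have "(\<bar>t\<bar> / K) ^ j \<le> (c / K) ^ j"
      using True K by (intro power_mono divide_right_mono) auto
    then have "A * (\<bar>t\<bar> / K) ^ j \<le> A * (c / K) ^ j" using A0 by simp
    ultimately have "g t \<le> f t + \<epsilon>" unfolding g_def tj using j(3) by linarith
    then have "g t * mu t \<le> (f t + \<epsilon>) * mu t" using mu_bounds by (intro mult_right_mono)
    then show ?thesis by (simp add: algebra_simps)
  next
    case False
    then show ?thesis using mu_support[of t] by (simp add: c_def)
  qed
  then have "(LBINT t. g t * mu t) \<le> (LBINT t. f t * mu t + \<epsilon> * mu t)"
    using integrable_polynomial_mu[OF gp] fi integrable_mu by (intro integral_mono) auto
  also have "\<dots> = (LBINT t. f t * mu t) + \<epsilon>"
    using fi integrable_mu integral_mu by simp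
  finally show ?thesis using that gp maj by blast
qed

text \<open>The continuous function that is 1 up to \<open>x\<close>, 0 from \<open>x + \<delta>\<close> on, and linear between.\<close>

definition ramp :: "real \<Rightarrow> real \<Rightarrow> real \<Rightarrow> real" where
  "ramp x \<delta> t = min 1 (max 0 ((x + \<delta> - t) / \<delta>))"

text \<open>The distribution function of the density \<open>mu\<close>.\<close>

definition distr_mu :: "real \<Rightarrow> real" where
  "distr_mu x = (LBINT t. indicator {..x} t * mu t)"

lemma distr_mu_close: "x \<le> y \<Longrightarrow> distr_mu y \<le> distr_mu x + (y - x)"
proof -
  assume xy: "x \<le> y"
  have i: "integrable lborel (\<lambda>t. indicator {..x} t * mu t)" for x :: real
    by (rule integrable_bounded_mult_mu[of _ 1]) auto
  have fin: "integrable lborel (\<lambda>t. indicator {x..y} t :: real)"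
    by (intro integrable_real_indicator) (auto simp: emeasure_lborel_Icc_eq)
  have "indicator {..y} t * mu t \<le> indicator {..x} t * mu t + indicator {x..y} t" for t
    using mu_bounds[of t] xy by (auto simp: indicator_def)
  then have "distr_mu y \<le> (LBINT t. indicator {..x} t * mu t + indicator {x..y} t)"
    unfolding distr_mu_def using i fin by (intro integral_mono) auto
  also have "\<dots> = distr_mu x + (y - x)"
    unfolding distr_mu_def using i fin xy by simp
  finally show ?thesis .
qed

lemma continuous_ramp: "\<delta> > 0 \<Longrightarrow> continuous_on UNIV (ramp x \<delta>)"
  unfolding ramp_def by (intro continuous_intros) auto

lemma ramp_bounds: "0 \<le> ramp x \<delta> t" "ramp x \<delta> t \<le> 1"
  by (auto simp: ramp_def)

lemma ramp_indicator:
  assumes "\<delta> > 0"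
  shows "indicator {..x} t \<le> ramp x \<delta> t" "ramp x \<delta> t \<le> indicator {..x + \<delta>} t"
  using assms by (auto simp: ramp_def indicator_def divide_le_0_iff le_divide_eq max_def min_def)

lemma integral_ramp_mu:
  assumes "\<delta> > 0"
  shows "distr_mu x \<le> (LBINT t. ramp x \<delta> t * mu t)" "(LBINT t. ramp x \<delta> t * mu t) \<le> distr_mu (x + \<delta>)"
    and integrable_ramp_mu: "integrable lborel (\<lambda>t. ramp x \<delta> t * mu t)"
proof -
  have i: "integrable lborel (\<lambda>t. indicator {..x} t * mu t)" for x :: real
    by (rule integrable_bounded_mult_mu[of _ 1]) auto
  show r: "integrable lborel (\<lambda>t. ramp x \<delta> t * mu t)"
    by (rule integrable_bounded_mult_mu[of _ 1])
       (use continuous_ramp[OF assms] borel_measurable_continuous_onI ramp_bounds in \<open>auto simp: abs_of_nonneg\<close>)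
  show "distr_mu x \<le> (LBINT t. ramp x \<delta> t * mu t)" unfolding distr_mu_def
    by (intro integral_mono i r mult_right_mono ramp_indicator assms mu_bounds)
  show "(LBINT t. ramp x \<delta> t * mu t) \<le> distr_mu (x + \<delta>)" unfolding distr_mu_def
    by (intro integral_mono i r mult_right_mono ramp_indicator assms mu_bounds)
qed

text \<open>Majorants of the ramp to the right of \<open>x\<close>, and of 1 minus the ramp to the left of \<open>x\<close>; since \<open>mu\<close> is at
  most 1, each ramp costs at most \<open>\<epsilon>\<close>.\<close>

theorem indicator_polynomial_sandwich:
  assumes \<epsilon>: "\<epsilon> > 0"
  obtains p q where "real_polynomial_function p" "real_polynomial_function q"
    "\<And>t. indicator {..x} t \<le> p t" "\<And>t. q t \<le> indicator {..x} t"
    "(LBINT t. p t * mu t) \<le> distr_mu x + 2 * \<epsilon>" "distr_mu x - 2 * \<epsilon> \<le> (LBINT t. q t * mu t)"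
proof -
  obtain p where p: "real_polynomial_function p" "\<And>t. ramp x \<epsilon> t \<le> p t"
    "(LBINT t. p t * mu t) \<le> (LBINT t. ramp x \<epsilon> t * mu t) + \<epsilon>"
    using polynomial_majorant[of "ramp x \<epsilon>" \<epsilon>] continuous_ramp ramp_bounds \<epsilon> by metis
  let ?f = "\<lambda>t. 1 - ramp (x - \<epsilon>) \<epsilon> t"
  have cf: "continuous_on UNIV ?f" using continuous_ramp[OF \<epsilon>] by (intro continuous_intros)
  obtain g where g: "real_polynomial_function g" "\<And>t. ?f t \<le> g t"
    "(LBINT t. g t * mu t) \<le> (LBINT t. ?f t * mu t) + \<epsilon>"
    using polynomial_majorant[of ?f \<epsilon>, OF cf _ _ \<epsilon>] ramp_bounds
    by (metis diff_ge_0_iff_ge diff_le_eq le_add_same_cancel1)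
  define q where "q = (\<lambda>t. 1 - g t)"
  have q: "real_polynomial_function q" unfolding q_def
    by (intro real_polynomial_function_diff g real_polynomial_function.intros(2))
  have "(LBINT t. ?f t * mu t) = 1 - (LBINT t. ramp (x - \<epsilon>) \<epsilon> t * mu t)"
    using integrable_mu integrable_ramp_mu[OF \<epsilon>] integral_mu by (simp add: left_diff_distrib)
  moreover have "(LBINT t. q t * mu t) = 1 - (LBINT t. g t * mu t)"
    unfolding q_def using integrable_mu integrable_polynomial_mu[OF g(1)] integral_mu
    by (simp add: left_diff_distrib)
  moreover have "distr_mu (x - \<epsilon>) \<le> (LBINT t. ramp (x - \<epsilon>) \<epsilon> t * mu t)"
    by (rule integral_ramp_mu(1)[OF \<epsilon>])
  moreover have "distr_mu x \<le> distr_mu (x - \<epsilon>) + \<epsilon>"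
    using distr_mu_close[of "x - \<epsilon>" x] \<epsilon> by simp
  ultimately have lower: "distr_mu x - 2 * \<epsilon> \<le> (LBINT t. q t * mu t)" using g(3) by linarith
  have upper: "(LBINT t. p t * mu t) \<le> distr_mu x + 2 * \<epsilon>"
    using p(3) integral_ramp_mu(2)[OF \<epsilon>, of x] distr_mu_close[of x "x + \<epsilon>"] \<epsilon> by simp
  show ?thesis
  proof (rule that[OF p(1) q _ _ upper lower])
    show "indicator {..x} t \<le> p t" for t using ramp_indicator(1)[OF \<epsilon>, of x t] p(2)[of t] by linarith
    show "q t \<le> indicator {..x} t" for t
      using ramp_indicator(2)[OF \<epsilon>, of "x - \<epsilon>" t] g(2)[of t] unfolding q_def by simp
  qed
qed

text \<open>The limiting spectral distribution.\<close>

definition mu_measure :: "real measure" where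
  "mu_measure = density lborel (\<lambda>x. ennreal (mu x))"

lemma measure_mu_measure:
  assumes "X \<in> sets borel"
  shows "emeasure mu_measure X = ennreal (LBINT t. indicator X t * mu t)"
proof -
  have "emeasure mu_measure X = (\<integral>\<^sup>+t. ennreal (mu t) * indicator X t \<partial>lborel)"
    unfolding mu_measure_def using assms measurable_mu by (subst emeasure_density) auto
  also have "\<dots> = (\<integral>\<^sup>+t. ennreal (indicator X t * mu t) \<partial>lborel)"
    by (intro nn_integral_cong) (auto simp: indicator_def)
  also have "\<dots> = ennreal (LBINT t. indicator X t * mu t)"
    by (intro nn_integral_eq_integral integrable_bounded_mult_mu[of _ 1])
       (use assms mu_bounds in auto)
  finally show ?thesis .
qed

lemma real_distribution_mu: "real_distribution mu_measure"
proof -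
  have "emeasure mu_measure (space mu_measure) = 1"
    using measure_mu_measure[of UNIV] integral_mu by (simp add: mu_measure_def)
  then have "prob_space mu_measure" by (rule prob_spaceI)
  then show ?thesis unfolding real_distribution_def real_distribution_axioms_def
    by (simp add: mu_measure_def)
qed

lemma cdf_mu: "cdf mu_measure x = distr_mu x"
proof -
  have "0 \<le> distr_mu x" unfolding distr_mu_def using mu_bounds by (intro integral_nonneg_AE) auto
  then show ?thesis
    unfolding cdf_def measure_def distr_mu_def using measure_mu_measure[of "{..x}"] by simp
qed

section \<open>Convergence of the empirical spectral distribution\<close>

theorem anticommutator_esd_converges:
  fixes M :: "'a measure" and A B :: "nat \<Rightarrow> 'a \<Rightarrow> real mat"
  assumes P: "prob_space M"
    and A: "\<And>N. N \<ge> 1 \<Longrightarrow> GOE M N (A N)"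
    and B: "\<And>N. N \<ge> 1 \<Longrightarrow> GOE M N (B N)"
    and AB: "\<And>N. N \<ge> 1 \<Longrightarrow> indep_matrices M N (A N) (B N)"
    and \<epsilon>: "\<epsilon> > 0"
  shows "(\<lambda>N. measure M {\<omega> \<in> space M. \<bar>esd N (anticommutator (A N \<omega>) (B N \<omega>)) x - distr_mu x\<bar> > \<epsilon>}) \<longlonglongrightarrow> 0"
proof -
  interpret prob_space M by fact
  define Y where "Y = (\<lambda>N \<omega> e. pair_entry (A N) (B N) e \<omega> / sqrt (real N))"
  have wf: "wick_family M N (1 / real N) (Y N)" if "N \<ge> 1" for N
    unfolding Y_def using GOE_pair_wick_family[OF P A[OF that] B[OF that] AB[OF that] that] .
  define S where "S = (\<lambda>N \<omega> i. \<Sum>w\<leftarrow>acw i. ntr N (Y N \<omega>) w)"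
  define \<eta> where "\<eta> = \<epsilon> / 4"
  have \<eta>: "\<eta> > 0" using \<epsilon> by (simp add: \<eta>_def)
  have poly_conv: "(\<lambda>N. measure M {\<omega> \<in> space M. \<eta> \<le> \<bar>(\<Sum>i\<le>n. a i * S N \<omega> i) - (\<Sum>i\<le>n. a i * acm i)\<bar>}) \<longlonglongrightarrow> 0"
    and poly_meas: "N \<ge> 1 \<Longrightarrow> {\<omega> \<in> space M. \<eta> \<le> \<bar>(\<Sum>i\<le>n. a i * S N \<omega> i) - (\<Sum>i\<le>n. a i * acm i)\<bar>} \<in> sets M"
    for a n N
  proof -
    define L where "L = concat (map (\<lambda>i. map (\<lambda>w. (a i, w)) (acw i)) [0..<Suc n])"
    have L: "(\<Sum>x\<leftarrow>L. fst x * F (snd x)) = (\<Sum>i\<le>n. a i * (\<Sum>w\<leftarrow>acw i. F w))" for F :: "word \<Rightarrow> real"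
    proof -
      have "(\<Sum>x\<leftarrow>concat (map (\<lambda>i. map (\<lambda>w. (a i, w)) (acw i)) is). fst x * F (snd x))
         = (\<Sum>i\<leftarrow>is. a i * (\<Sum>w\<leftarrow>acw i. F w))" for "is"
        by (induction "is") (auto simp: comp_def sum_list_const_mult)
      then show ?thesis unfolding L_def
        by (simp only: interv_sum_list_conv_sum_set_nat atLeast0LessThan set_upt lessThan_Suc_atMost)
    qed
    show "(\<lambda>N. measure M {\<omega> \<in> space M. \<eta> \<le> \<bar>(\<Sum>i\<le>n. a i * S N \<omega> i) - (\<Sum>i\<le>n. a i * acm i)\<bar>}) \<longlonglongrightarrow> 0"
      using linear_statistic_converges[where L = L, OF wf \<eta>] unfolding L S_def acm_def .
    show "{\<omega> \<in> space M. \<eta> \<le> \<bar>(\<Sum>i\<le>n. a i * S N \<omega> i) - (\<Sum>i\<le>n. a i * acm i)\<bar>} \<in> sets M" if "N \<ge> 1"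
      using linear_statistic_measurable[where L = L, OF wf \<eta> that] unfolding L S_def acm_def .
  qed
  obtain p q where pq: "real_polynomial_function p" "real_polynomial_function q"
    "\<And>t. indicator {..x} t \<le> p t" "\<And>t. q t \<le> indicator {..x} t"
    "(LBINT t. p t * mu t) \<le> distr_mu x + 2 * \<eta>" "distr_mu x - 2 * \<eta> \<le> (LBINT t. q t * mu t)"
    using indicator_polynomial_sandwich[OF \<eta>, of x] by blast
  obtain a n where p: "p = (\<lambda>t. \<Sum>i\<le>n. a i * t ^ i)" using pq(1) unfolding real_polynomial_function_iff_sum by blast
  obtain b m where q: "q = (\<lambda>t. \<Sum>i\<le>m. b i * t ^ i)" using pq(2) unfolding real_polynomial_function_iff_sum by blast
  define T1 where "T1 = (\<lambda>N. {\<omega> \<in> space M. \<eta> \<le> \<bar>(\<Sum>i\<le>n. a i * S N \<omega> i) - (\<Sum>i\<le>n. a i * acm i)\<bar>})"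
  define T2 where "T2 = (\<lambda>N. {\<omega> \<in> space M. \<eta> \<le> \<bar>(\<Sum>i\<le>m. b i * S N \<omega> i) - (\<Sum>i\<le>m. b i * acm i)\<bar>})"
  let ?Z = "\<lambda>N. {\<omega> \<in> space M. \<bar>esd N (anticommutator (A N \<omega>) (B N \<omega>)) x - distr_mu x\<bar> > \<epsilon>}"
  have sub: "?Z N \<subseteq> T1 N \<union> T2 N" if N: "N \<ge> 1" for N
  proof
    fix \<omega> assume \<omega>: "\<omega> \<in> ?Z N"
    have car: "A N \<omega> \<in> carrier_mat N N" "transpose_mat (A N \<omega>) = A N \<omega>"
        "B N \<omega> \<in> carrier_mat N N" "transpose_mat (B N \<omega>) = B N \<omega>"
      using A[OF N] B[OF N] \<omega> by (auto simp: GOE_def)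
    have y: "Y N \<omega> (c, i, j) = (if c then A N \<omega> else B N \<omega>) $$ (i, j) / sqrt (real N)" for c i j
      by (simp add: Y_def)
    obtain es where es: "length es = N"
      "\<And>x. esd N (anticommutator (A N \<omega>) (B N \<omega>)) x = (\<Sum>e\<leftarrow>es. of_bool (e \<le> x)) / real N"
      "\<And>k. (\<Sum>e\<leftarrow>es. e ^ k) / real N = S N \<omega> k"
      using esd_as_average[OF car N y] unfolding S_def by blast
    have avg: "(\<Sum>i\<le>n. a i * S N \<omega> i) = (\<Sum>e\<leftarrow>es. \<Sum>i\<le>n. a i * e ^ i) / real N" for a n
    proof -
      have "(\<Sum>e\<leftarrow>es. \<Sum>i\<le>n. a i * e ^ i) = (\<Sum>i\<le>n. a i * (\<Sum>e\<leftarrow>es. e ^ i))"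
        unfolding sum_list_sum_swap[symmetric] by (simp add: sum_list_const_mult)
      then show ?thesis by (simp add: sum_divide_distrib flip: es(3))
    qed
    have ind: "(of_bool (e \<le> x) :: real) = indicator {..x} e" for e :: real by (simp add: indicator_def)
    have "esd N (anticommutator (A N \<omega>) (B N \<omega>)) x \<le> (\<Sum>e\<leftarrow>es. p e) / real N"
      unfolding es(2) ind by (intro divide_right_mono sum_list_mono pq) simp
    then have up: "esd N (anticommutator (A N \<omega>) (B N \<omega>)) x \<le> (\<Sum>i\<le>n. a i * S N \<omega> i)"
      unfolding avg p .
    have "(\<Sum>e\<leftarrow>es. q e) / real N \<le> esd N (anticommutator (A N \<omega>) (B N \<omega>)) x"
      unfolding es(2) ind by (intro divide_right_mono sum_list_mono pq) simp
    then have low: "(\<Sum>i\<le>m. b i * S N \<omega> i) \<le> esd N (anticommutator (A N \<omega>) (B N \<omega>)) x"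
      unfolding avg q .
    have ints: "(\<Sum>i\<le>n. a i * acm i) \<le> distr_mu x + 2 * \<eta>" "distr_mu x - 2 * \<eta> \<le> (\<Sum>i\<le>m. b i * acm i)"
      using pq(5,6) unfolding p q integrable_sum_mu(2) .
    show "\<omega> \<in> T1 N \<union> T2 N"
    proof (rule ccontr)
      assume "\<omega> \<notin> T1 N \<union> T2 N"
      then have "\<bar>(\<Sum>i\<le>n. a i * S N \<omega> i) - (\<Sum>i\<le>n. a i * acm i)\<bar> < \<eta>"
        "\<bar>(\<Sum>i\<le>m. b i * S N \<omega> i) - (\<Sum>i\<le>m. b i * acm i)\<bar> < \<eta>"
        using \<omega> by (auto simp: T1_def T2_def)
      moreover have "\<bar>esd N (anticommutator (A N \<omega>) (B N \<omega>)) x - distr_mu x\<bar> > 4 * \<eta>"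
        using \<omega> by (simp add: \<eta>_def)
      ultimately show False using up low ints \<eta> by linarith
    qed
  qed
  have T: "T1 N \<in> sets M" "T2 N \<in> sets M" if "N \<ge> 1" for N
    unfolding T1_def T2_def using poly_meas[OF that] by auto
  have bound: "measure M (?Z N) \<le> measure M (T1 N) + measure M (T2 N)" if "N \<ge> 1" for N
  proof -
    have "measure M (?Z N) \<le> measure M (T1 N \<union> T2 N)"
      using sub[OF that] T[OF that] by (intro finite_measure_mono) auto
    also have "\<dots> \<le> measure M (T1 N) + measure M (T2 N)"
      using T[OF that] by (intro measure_Un_le)
    finally show ?thesis .
  qed
  have "(\<lambda>N. measure M (T1 N) + measure M (T2 N)) \<longlonglongrightarrow> 0 + 0"
    unfolding T1_def T2_def by (intro tendsto_add poly_conv)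
  then have lim: "(\<lambda>N. measure M (T1 N) + measure M (T2 N)) \<longlonglongrightarrow> 0" by simp
  show ?thesis
    by (rule tendsto_sandwich[OF _ _ tendsto_const lim])
       (auto intro!: always_eventually eventually_mono[OF eventually_ge_at_top[of 1]] bound)
qed

theorem corollary1p10:
  fixes M :: "'a measure" and A B :: "nat \<Rightarrow> 'a \<Rightarrow> real mat"
  assumes "prob_space M"
    and "\<And>N. N \<ge> 1 \<Longrightarrow> GOE M N (A N)"
    and "\<And>N. N \<ge> 1 \<Longrightarrow> GOE M N (B N)"
    and "\<And>N. N \<ge> 1 \<Longrightarrow> indep_matrices M N (A N) (B N)"
  shows "limiting_spectral_density M (\<lambda>N \<omega>. anticommutator (A N \<omega>) (B N \<omega>)) mu"
  unfolding limiting_spectral_density_def limiting_spectral_distribution_def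
    esd_converges_in_probability_def mu_measure_def[symmetric] cdf_mu
  using measurable_mu mu_bounds(1) real_distribution_mu anticommutator_esd_converges[OF assms]
  by blast

end
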